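(* Assume that for every integer $k\ge1$ and every positive integer $m$ with $\gcd(k,m)=1$ one has $G_m^{(k)}=G_m^{(1)}$. Then for every integer $k\ge1$, the polynomial $L_{D_1}(t)$ divides $L_{D_k}(t)$ in $\mathbb{Z}[t]$.
   Context: For $k\ge1$, $D_k$ is the smooth projective (absolutely irreducible) curve over $\mathbb{F}_2$ birational to the affine curve $y^2+y=x^{2^k+1}+x^{-1}$, and $L_{D_k}(t)\in\mathbb{Z}[t]$ is its L-polynomial over $\mathbb{F}_2$, defined by $\exp\left(\sum_{n\ge1}\#D_k(\mathbb{F}_{2^n})\frac{t^n}{n}\right)=\frac{L_{D_k}(t)}{(1-t)(1-2t)}$. For $m\ge1$, $G_m^{(k)}=\sum_{x\in\mathbb{F}_{2^m}^*}(-1)^{\mathrm{Tr}_m(x^{2^k+1}+x^{-1})}$, where $\mathrm{Tr}_m$ is the trace from $\mathbb{F}_{2^m}$ to $\mathbb{F}_2$. *)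

theory Defs
  imports
    "HOL-Algebra.Algebraic_Closure_Type"
    "HOL-Algebra.Generated_Fields"
    "HOL-Computational_Algebra.Formal_Power_Series"
    "HOL-Computational_Algebra.Polynomial_FPS"
    "HOL-Computational_Algebra.Fraction_Field"
    "HOL-Library.FuncSet"
    "HOL-Library.Z2"
begin

section \<open>Finite fields of characteristic 2\<close>

text \<open>The field \<open>GF2 n\<close> with \<open>2 ^ n\<close> elements (for \<open>n \<ge> 1\<close>) is taken inside a fixed
  algebraic closure of the two-element field \<^typ>\<open>bit\<close>.\<close>

definition GF2 :: "nat \<Rightarrow> bit alg_closure set" where
  "GF2 n = {a. a ^ (2 ^ n) = a}"

text \<open>The conjugates of \<open>a\<close> over the prime field are \<open>a ^ (2 ^ i)\<close> for \<open>i < m\<close>. On \<open>GF2 m\<close> the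
  trace takes its values in the prime field, that is, in \<open>{0, 1}\<close>.\<close>

definition Tr :: "nat \<Rightarrow> bit alg_closure \<Rightarrow> bit alg_closure" where
  "Tr m a = (\<Sum>i<m. a ^ (2 ^ i))"

definition G :: "nat \<Rightarrow> nat \<Rightarrow> int" where
  "G k m = (\<Sum>a\<in>GF2 m - {0}. if Tr m (a ^ (2 ^ k + 1) + inverse a) = 0 then 1 else -1)"


section \<open>Rational points of smooth projective curves over the prime field\<close>

text \<open>A smooth projective curve over the field with two elements is determined by its function
  field \<open>F\<close>: its closed points \<open>P\<close> correspond to the proper valuation rings \<open>A\<close> of \<open>F\<close>, with
  \<open>A\<close> the local ring at \<open>P\<close>. A point with values in a finite field \<open>K\<close> is a closed point
  together with an embedding of its residue field into \<open>K\<close>, i.e. with a ring homomorphism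
  \<open>A \<rightarrow> K\<close> whose kernel is the maximal ideal of \<open>A\<close>, the set of its non-units. As the base
  field is the prime field, every ring homomorphism is linear over it, and every subring contains
  it.\<close>

definition valuation_rings :: "'f::field set \<Rightarrow> 'f set set" where
  "valuation_rings F =
     {A. subring A ring_of_type_algebra \<and> A \<subset> F \<and> (\<forall>f\<in>F. f \<in> A \<or> inverse f \<in> A)}"

definition nonunits :: "'f::field set \<Rightarrow> 'f set" where
  "nonunits A = {f \<in> A. f = 0 \<or> inverse f \<notin> A}"

definition rational_points ::
  "'f::field set \<Rightarrow> 'c::field set \<Rightarrow> ('f set \<times> ('f \<Rightarrow> 'c)) set" where
  "rational_points F K =
     {(A, \<phi>). A \<in> valuation_rings F \<and>
        \<phi> \<in> ring_hom (ring_of_type_algebra\<lparr>carrier := A\<rparr>) (ring_of_type_algebra\<lparr>carrier := K\<rparr>) \<and>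
        \<phi> \<in> extensional A \<and>
        {f \<in> A. \<phi> f = 0} = nonunits A}"


section \<open>The curves \<open>D k\<close>\<close>

text \<open>The function field of \<open>y\<^sup>2 + y = x ^ (2 ^ k + 1) + 1 / x\<close> is realised inside an algebraic
  closure of the rational function field in \<open>x\<close>. The two possible choices of \<open>y\<close> differ by \<open>1\<close>
  and generate the same field.\<close>

definition x_fun :: "bit poly fract alg_closure" where
  "x_fun = to_ac (Fract [:0, 1:] 1)"

definition y_fun :: "nat \<Rightarrow> bit poly fract alg_closure" where
  "y_fun k = (SOME y. y ^ 2 + y = x_fun ^ (2 ^ k + 1) + inverse x_fun)"

lemma y_fun: "y_fun k ^ 2 + y_fun k = x_fun ^ (2 ^ k + 1) + inverse x_fun"
proof -
  let ?c = "x_fun ^ (2 ^ k + 1) + inverse x_fun"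
  have "\<exists>y. poly [:- ?c, 1, 1:] y = 0"
    by (rule alg_closed_imp_poly_has_root) simp
  then obtain y where "- ?c + y * (1 + y) = 0"
    by auto
  then have "y ^ 2 + y = ?c"
    by (simp add: algebra_simps power2_eq_square)
  then show ?thesis
    unfolding y_fun_def by (rule someI)
qed

definition D :: "nat \<Rightarrow> bit poly fract alg_closure set" where
  "D k = generate_field ring_of_type_algebra {x_fun, y_fun k}"

definition num_points :: "nat \<Rightarrow> nat \<Rightarrow> nat" where
  "num_points k n = card (rational_points (D k) (GF2 n))"

definition zeta :: "nat \<Rightarrow> rat fps" where
  "zeta k = fps_exp 1 oo
     Abs_fps (\<lambda>n. if n = 0 then 0 else of_nat (num_points k n) / of_nat n)"

definition L_poly :: "nat \<Rightarrow> int poly" where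
  "L_poly k = (THE L. zeta k =
     fps_of_poly (map_poly of_int L) / ((1 - fps_X) * (1 - 2 * fps_X)))"

end

theory Submission
  imports Defs
begin

text \<open>
  The number of points of \<open>D k\<close> over the field with \<open>2 ^ m\<close> elements is \<open>2 ^ m + 1 + G k m\<close>, so the
  L-polynomial is \<open>exp (\<Sum>m. G k m * X ^ m / m)\<close>. This is the L-series
  \<open>\<Sum>f. \<chi>(f) * X ^ degree f\<close> of a character \<open>\<chi>\<close> with values \<open>\<plusminus>1\<close> on the monic polynomials over
  the prime field that do not vanish at \<open>0\<close>. The coefficients vanish in degree \<open>\<ge> 2 ^ k + 3\<close>, and
  pairing \<open>f\<close> with \<open>f + X\<close> shows that they are even in degree \<open>\<ge> 2\<close>.
  Hence the L-polynomial is congruent to \<open>1 + X\<close> modulo \<open>2\<close>: it has a single reciprocal root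
  \<open>u\<close> that is a 2-adic unit (the curve has 2-rank 1), and \<open>G k m \<equiv> - (u ^ m)\<close> modulo \<open>2 ^ s\<close> for large
  \<open>m\<close>. Every \<open>m \<equiv> 1\<close> modulo \<open>k\<close> is coprime to \<open>k\<close>, so comparing \<open>m\<close> with \<open>m + k\<close> shows that
  \<open>L_poly 1\<close> and \<open>L_poly k\<close> have the same unit root. As \<open>L_poly 1 = 1 + X + 2 X\<^sup>3 + 4 X\<^sup>4\<close> is
  irreducible, it divides \<open>L_poly k\<close>.
\<close>

text \<open>The hypothesis compares the sums only for m coprime to k. Over the complex numbers all
  reciprocal roots have the same absolute value, so agreement along a progression would not single
  out any one of them. Modulo powers of 2 only one reciprocal root survives for large m, which is
  why the argument is 2-adic. Congruences modulo \<open>2 ^ s\<close> for every s stand in for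
  2-adic numbers: a root becomes a family of integers v with \<open>2 ^ s dvd poly L v\<close>, and
  the use made of a common root rests on the fact that no nonzero integer is divisible by all powers
  of 2. The point count needs two charts, because the right-hand side of the given equation has
  poles at x = 0 and at infinity. The functions \<open>z_fin\<close> and \<open>z_inf\<close>
  satisfy integral equations that are regular there, and every place of \<open>D k\<close> is the
  localisation of one of these charts at a point.\<close>

section \<open>Characteristic 2\<close>

text \<open>These rules would turn field arithmetic on \<^typ>\<open>bit\<close> into bit operations.\<close>

declare add_bit_eq_xor [simp del] mult_bit_eq_and [simp del] power_bit_unfold [simp del]

text \<open>One class serves \<open>bit\<close>, its polynomials, power series, fractions and
  algebraic closure, so that signs disappear by simplification in all of them.\<close>

class char2_ring = comm_ring_1 +
  assumes one_plus_one_eq_0: "1 + 1 = 0"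
begin

lemma char2_add_self [simp]: "a + a = 0"
  by (metis distrib_left mult_1_right mult_zero_right one_plus_one_eq_0)

lemma char2_add_self_left [simp]: "a + (a + b) = b"
  by (metis add.assoc add_0_left char2_add_self)

lemma char2_uminus [simp]: "- a = a"
  by (simp add: minus_unique)

lemma char2_minus [simp]: "a - b = a + b"
  by (simp only: diff_conv_add_uminus char2_uminus)

lemma char2_two [simp]: "2 = 0"
  by (metis one_add_one one_plus_one_eq_0)

lemma char2_of_nat: "of_nat n = (if even n then 0 else 1)"
  by (induction n) (auto simp: one_plus_one_eq_0)

end

lemma char2_eq_iff: "a + b = 0 \<longleftrightarrow> a = (b :: 'a :: char2_ring)"
  by (metis char2_uminus eq_neg_iff_add_eq_0)

lemma char2_square_add: "(a + b) ^ 2 = a ^ 2 + (b :: 'a :: char2_ring) ^ 2"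
  by (simp add: power2_sum)

lemma char2_power_add: "(a + b) ^ (2 ^ i) = a ^ (2 ^ i) + (b :: 'a :: char2_ring) ^ (2 ^ i)"
proof (induction i)
  case (Suc i)
  have "(a + b) ^ (2 ^ Suc i) = ((a + b) ^ (2 ^ i)) ^ 2"
    by (simp add: power_mult[symmetric] mult.commute)
  also have "\<dots> = a ^ (2 ^ Suc i) + b ^ (2 ^ Suc i)"
    by (simp add: Suc char2_square_add power_mult[symmetric] mult.commute)
  finally show ?case .
qed simp

lemma char2_power_sum:
  "(\<Sum>x\<in>A. f x) ^ (2 ^ i) = (\<Sum>x\<in>A. (f x :: 'a :: char2_ring) ^ (2 ^ i))"
  by (induction A rule: infinite_finite_induct) (auto simp: char2_power_add zero_power)

lemma char2_power_inj:
  fixes a b :: "'a :: {char2_ring, idom}"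
  assumes "a ^ (2 ^ i) = b ^ (2 ^ i)"
  shows "a = b"
proof -
  have "(a + b) ^ (2 ^ i) = 0"
    using assms by (simp add: char2_power_add)
  then show ?thesis
    by (simp add: char2_eq_iff)
qed

instance bit :: char2_ring
  by standard simp

instance poly :: (char2_ring) char2_ring
  by standard (simp add: one_pCons)

instance fps :: (char2_ring) char2_ring
  by standard (simp only: fps_eq_iff fps_add_nth char2_add_self fps_zero_nth HOL.simp_thms)

instance fract :: ("{char2_ring, idom}") char2_ring
  by standard (simp add: One_fract_def Zero_fract_def)

instance alg_closure :: ("{char2_ring, field}") char2_ring
proof
  show "1 + 1 = (0 :: 'a alg_closure)"
    by (metis one_plus_one_eq_0 to_ac_0 to_ac_1 to_ac_add)
qed

definition emb :: "bit \<Rightarrow> 'a :: comm_ring_1" where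
  "emb b = (if b = 0 then 0 else 1)"

lemma emb_simps [simp]:
  "emb 0 = 0" "emb 1 = 1"
  "emb (a + b) = (emb a + emb b :: 'a :: char2_ring)"
  "emb (a * b) = (emb a * emb b :: 'a)"
  by (cases a; cases b; simp add: emb_def)+

lemma emb_eq_iff [simp]: "emb a = (emb b :: 'a :: comm_ring_1) \<longleftrightarrow> a = b"
  by (cases a; cases b; simp add: emb_def)

lemma emb_eq_0_iff [simp]: "emb a = (0 :: 'a :: comm_ring_1) \<longleftrightarrow> a = 0"
  by (cases a; simp add: emb_def)

lemma emb_sum: "emb (\<Sum>x\<in>A. f x) = (\<Sum>x\<in>A. emb (f x) :: 'a :: char2_ring)"
  by (induction A rule: infinite_finite_induct) auto

definition embp :: "bit poly \<Rightarrow> 'a :: char2_ring poly" where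
  "embp P = map_poly emb P"

lemma coeff_embp [simp]: "coeff (embp P) i = emb (coeff P i)"
  by (simp add: embp_def coeff_map_poly)

lemma embp_0 [simp]: "embp 0 = 0"
  and embp_1 [simp]: "embp 1 = 1"
  and embp_add [simp]: "embp (P + Q) = embp P + embp Q"
  and embp_mult [simp]: "embp (P * Q) = (embp P * embp Q :: 'a :: char2_ring poly)"
  and embp_pCons [simp]: "embp (pCons b P) = pCons (emb b) (embp P)"
  by (auto simp: poly_eq_iff coeff_mult emb_sum coeff_pCons split: nat.splits)

lemma embp_power [simp]: "embp (P ^ n) = (embp P ^ n :: 'a :: char2_ring poly)"
  by (induction n) auto

lemma embp_eq_iff [simp]: "embp P = (embp Q :: 'a :: char2_ring poly) \<longleftrightarrow> P = Q"
  by (auto simp: poly_eq_iff)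

lemma embp_eq_0_iff [simp]: "embp P = (0 :: 'a :: char2_ring poly) \<longleftrightarrow> P = 0"
  by (metis embp_0 embp_eq_iff)

lemma degree_embp [simp]: "degree (embp P :: 'a :: char2_ring poly) = degree P"
  unfolding embp_def by (rule degree_map_poly) simp

definition ev :: "bit poly \<Rightarrow> 'a :: char2_ring \<Rightarrow> 'a" where
  "ev P c = poly (embp P) c"

lemma ev_simps [simp]:
  "ev 0 c = 0" "ev 1 c = 1" "ev (P + Q) c = ev P c + ev Q c" "ev (P * Q) c = ev P c * ev Q c"
  "ev (P ^ n) c = ev P c ^ n" "ev (pCons b P) c = emb b + c * ev P c"
  by (simp_all add: ev_def)

lemma ev_dvd: "P dvd Q \<Longrightarrow> ev P c = 0 \<Longrightarrow> ev Q c = 0"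
  by (auto elim: dvdE)

lemma ev_monom: "ev (monom 1 m) a = a ^ m"
  by (induction m) (simp_all add: monom_0 monom_Suc)

lemma ev_at_0: "ev P 0 = emb (coeff P 0)"
  by (simp add: ev_def poly_0_coeff_0)

lemma X_dvd_iff: "[:0, 1:] dvd P \<longleftrightarrow> coeff P 0 = (0 :: 'a :: idom)"
  by (simp add: dvd_iff_poly_eq_0 poly_0_coeff_0)

section \<open>Logarithmic derivatives\<close>

text \<open>Unlike the logarithm it needs no division by n, so it makes sense in characteristic 2.
  On a product of factors \<open>1 - a X\<close> its coefficients are minus the power sums of the
  a.\<close>

definition logd :: "'a :: field fps \<Rightarrow> 'a fps" where
  "logd F = fps_X * fps_deriv F * inverse F"

lemma logd_mult_self: "fps_nth F 0 \<noteq> 0 \<Longrightarrow> logd F * F = fps_X * fps_deriv F"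
  by (simp add: logd_def mult.assoc inverse_mult_eq_1)

lemma logd_nth_0 [simp]: "fps_nth (logd F) 0 = 0"
  by (simp add: logd_def)

lemma logd_unique:
  assumes "fps_nth F 0 \<noteq> 0" "P * F = fps_X * fps_deriv F"
  shows "P = logd F"
proof -
  have "F \<noteq> 0"
    using assms(1) by auto
  moreover have "P * F = logd F * F"
    using assms by (simp add: logd_mult_self)
  ultimately show ?thesis
    by simp
qed

lemma logd_mult:
  assumes "fps_nth F 0 \<noteq> 0" "fps_nth H 0 \<noteq> 0"
  shows "logd (F * H) = logd F + logd H"
proof (rule logd_unique[symmetric])
  have "(logd F + logd H) * (F * H) = (logd F * F) * H + (logd H * H) * F"
    by (simp add: algebra_simps)
  also have "\<dots> = fps_X * fps_deriv (F * H)"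
    by (simp only: logd_mult_self[OF assms(1)] logd_mult_self[OF assms(2)]) (simp add: algebra_simps)
  finally show "(logd F + logd H) * (F * H) = fps_X * fps_deriv (F * H)" .
qed (use assms in auto)

lemma logd_1 [simp]: "logd 1 = 0"
  by (simp add: logd_def)

lemma fps_nth_0_prod: "fps_nth (\<Prod>i\<in>A. F i :: 'a :: comm_ring_1 fps) 0 = (\<Prod>i\<in>A. fps_nth (F i) 0)"
  by (induction A rule: infinite_finite_induct) auto

lemma logd_prod:
  assumes "finite A" "\<And>i. i \<in> A \<Longrightarrow> fps_nth (F i) 0 \<noteq> 0"
  shows "logd (\<Prod>i\<in>A. F i) = (\<Sum>i\<in>A. logd (F i))"
  using assms by (induction A) (auto simp: logd_mult fps_nth_0_prod)

lemma logd_linear: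
  assumes "n \<ge> 1"
  shows "fps_nth (logd (1 - fps_const a * fps_X :: 'a :: field fps)) n = - (a ^ n)"
proof -
  let ?Q = "Abs_fps (\<lambda>n. a ^ n)" and ?F = "1 - fps_const a * fps_X"
  have "fps_nth (?Q * ?F) m = fps_nth 1 m" for m
    by (cases m) (simp_all add: right_diff_distrib mult.left_commute[of _ "fps_const a"])
  then have "?Q * ?F = 1"
    by (simp add: fps_eq_iff)
  then have "- (fps_const a * (fps_X * ?Q)) * ?F = fps_X * fps_deriv ?F"
    by (simp add: mult.assoc)
  then have "- (fps_const a * (fps_X * ?Q)) = logd ?F"
    by (rule logd_unique[rotated]) simp
  then have "fps_nth (logd ?F) n = fps_nth (- (fps_const a * (fps_X * ?Q))) n"
    by (rule arg_cong[OF sym])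
  also have "\<dots> = - (a ^ n)"
    using assms by (cases n) simp_all
  finally show ?thesis .
qed

lemma logd_nth_1:
  assumes "fps_nth F 0 \<noteq> 0"
  shows "fps_nth (logd F) 1 = fps_nth F 1 / fps_nth F 0"
proof -
  have "fps_nth (logd F * F) 1 = fps_nth (fps_X * fps_deriv F) 1"
    using logd_mult_self[OF assms] by simp
  then show ?thesis
    using assms by (simp add: fps_mult_nth_1 field_simps)
qed

text \<open>In Newton's identities the n-th elementary symmetric function enters the n-th power sum
  only linearly, with coefficient n up to sign. In characteristic 2 and for odd n, changing it
  therefore flips the power sum; this is what makes the high coefficients of the L-series
  cancel.\<close>

lemma logd_add_X_power:
  assumes "fps_nth F 0 = 1" "n \<ge> 1"
  shows "fps_nth (logd (F + fps_X ^ n)) n = fps_nth (logd F) n + of_nat n"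
proof -
  let ?F' = "F + fps_X ^ n"
  have "logd ?F' * ?F' = fps_X * fps_deriv ?F'"
    by (rule logd_mult_self) (use assms in auto)
  also have "fps_deriv ?F' = fps_deriv F + of_nat n * fps_X ^ (n - 1)"
    using assms by (simp add: fps_deriv_power fps_of_nat)
  also have "fps_X * \<dots> = fps_X * fps_deriv F + of_nat n * fps_X ^ n"
    using assms by (cases n) (simp_all add: algebra_simps)
  also have "fps_X * fps_deriv F = logd F * F"
    by (rule logd_mult_self[symmetric]) (use assms in auto)
  finally have "(logd ?F' - logd F) * F = fps_X ^ n * (of_nat n - logd ?F')"
    by (simp add: algebra_simps)
  then have "(logd ?F' - logd F) * F * inverse F = fps_X ^ n * (of_nat n - logd ?F') * inverse F"
    by (rule arg_cong)
  then have "(logd ?F' - logd F) * (F * inverse F) = fps_X ^ n * ((of_nat n - logd ?F') * inverse F)"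
    by (simp only: mult.assoc)
  also have "F * inverse F = 1"
    using assms by (simp add: inverse_mult_eq_1')
  finally have "logd ?F' = logd F + fps_X ^ n * ((of_nat n - logd ?F') * inverse F)"
    by (simp add: algebra_simps)
  then have "fps_nth (logd ?F') n
      = fps_nth (logd F + fps_X ^ n * ((of_nat n - logd ?F') * inverse F)) n"
    by (rule arg_cong)
  then show ?thesis
    using assms by (simp add: fps_X_power_mult_nth fps_of_nat[symmetric])
qed

section \<open>Power series over \<open>bit\<close> viewed over larger fields\<close>

definition embf :: "bit fps \<Rightarrow> 'a :: char2_ring fps" where
  "embf F = Abs_fps (\<lambda>n. emb (fps_nth F n))"

lemma embf_nth [simp]: "fps_nth (embf F) n = emb (fps_nth F n)"
  by (simp add: embf_def)

lemma emb_of_nat: "emb (of_nat n) = (of_nat n :: 'a :: char2_ring)"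
  by (simp add: char2_of_nat)

lemma embf_mult: "embf (F * H) = (embf F * embf H :: 'a :: char2_ring fps)"
  by (simp add: fps_eq_iff fps_mult_nth emb_sum)

lemma embf_X [simp]: "embf fps_X = fps_X"
  by (auto simp: fps_eq_iff)

lemma embf_deriv: "embf (fps_deriv F) = (fps_deriv (embf F) :: 'a :: char2_ring fps)"
  by (simp add: fps_eq_iff emb_of_nat del: of_nat_Suc)

lemma embf_of_poly: "embf (fps_of_poly p) = fps_of_poly (embp p)"
  by (simp add: fps_eq_iff)

lemma embf_logd:
  assumes "fps_nth F 0 \<noteq> 0"
  shows "embf (logd F) = (logd (embf F) :: 'a :: {char2_ring, field} fps)"
proof (rule logd_unique)
  have "embf (logd F * F) = (embf (fps_X * fps_deriv F) :: 'a fps)"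
    by (simp only: logd_mult_self[OF assms])
  then show "embf (logd F) * embf F = (fps_X * fps_deriv (embf F) :: 'a fps)"
    by (simp only: embf_mult embf_deriv embf_X)
qed (use assms in auto)

lemma embp_reflect: "embp (reflect_poly f) = (reflect_poly (embp f) :: 'a :: char2_ring poly)"
  by (simp add: poly_eq_iff coeff_reflect_poly)


section \<open>A character on polynomials\<close>

text \<open>Over \<^typ>\<open>bit\<close> every nonzero polynomial is monic.\<close>

definition Mon :: "nat \<Rightarrow> bit poly set" where
  "Mon d = {f. degree f = d \<and> coeff f 0 = 1}"

text \<open>By Newton's identities, \<open>tau n f\<close> is the sum of \<open>a ^ n + inverse a\<close> over the roots \<open>a\<close> of
  \<open>f\<close>, with multiplicity.\<close>

definition tau :: "nat \<Rightarrow> bit poly \<Rightarrow> bit" where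
  "tau n f = fps_nth (logd (fps_of_poly (reflect_poly f))) n + fps_nth (logd (fps_of_poly f)) 1"

definition chi :: "nat \<Rightarrow> bit poly \<Rightarrow> int" where
  "chi n f = (if tau n f = 0 then 1 else -1)"

lemma finite_Mon [simp, intro]: "finite (Mon d)"
proof (rule finite_subset)
  show "Mon d \<subseteq> Poly ` {xs. set xs \<subseteq> UNIV \<and> length xs \<le> Suc d}"
  proof
    fix f assume "f \<in> Mon d"
    then have "length (coeffs f) \<le> Suc d"
      by (cases "f = 0") (auto simp: Mon_def length_coeffs)
    then show "f \<in> Poly ` {xs. set xs \<subseteq> UNIV \<and> length xs \<le> Suc d}"
      by (intro image_eqI[of _ _ "coeffs f"]) auto
  qed
  have "finite (UNIV :: bit set)"
    by (rule finite_subset[of _ "{0, 1}"]) (auto intro: bit.exhaust)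
  then show "finite (Poly ` {xs :: bit list. set xs \<subseteq> UNIV \<and> length xs \<le> Suc d})"
    by (intro finite_imageI finite_lists_length_le)
qed

lemma Mon_lead_coeff: "f \<in> Mon d \<Longrightarrow> coeff f d = 1"
  by (metis (mono_tags, lifting) Mon_def bit_not_zero_iff coeff_0 leading_coeff_0_iff mem_Collect_eq)

lemma tau_mult:
  assumes "coeff f 0 = 1" "coeff g 0 = 1"
  shows "tau n (f * g) = tau n f + tau n g"
proof -
  have "f \<noteq> 0" "g \<noteq> 0"
    using assms by auto
  then show ?thesis
    using assms by (simp add: tau_def reflect_poly_mult fps_of_poly_mult logd_mult)
qed

lemma chi_mult:
  assumes "coeff f 0 = 1" "coeff g 0 = 1"
  shows "chi n (f * g) = chi n f * chi n g"
  using tau_mult[OF assms, of n] by (cases "tau n f"; cases "tau n g"; simp add: chi_def)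

lemma tau_eq:
  assumes "coeff f 0 = 1"
  shows "tau n f = fps_nth (logd (fps_of_poly (reflect_poly f))) n + coeff f 1"
  using logd_nth_1[of "fps_of_poly f"] assms by (simp add: tau_def)

lemma Mon_add_monom:
  assumes "f \<in> Mon d" "0 < i" "i < d"
  shows "f + monom 1 i \<in> Mon d"
proof -
  have "degree (f + monom 1 i) = d"
    using assms by (subst degree_add_eq_left) (auto simp: Mon_def degree_monom_eq)
  then show ?thesis
    using assms by (auto simp: Mon_def)
qed

lemma add_monom_bij:
  assumes "0 < i" "i < d"
  shows "bij_betw (\<lambda>f. f + monom 1 i) (Mon d) (Mon d)"
  by (rule bij_betwI[of _ _ _ "\<lambda>f. f + monom 1 i"])
    (use assms in \<open>auto simp: Mon_add_monom add.assoc\<close>)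

definition chi_sum :: "nat \<Rightarrow> nat \<Rightarrow> int" where
  "chi_sum n d = (\<Sum>f\<in>Mon d. chi n f)"

text \<open>Reflection turns \<open>X ^ (d - n)\<close> into \<open>X ^ n\<close>, so the n-th power
  sum changes by n, which is 1 in \<open>bit\<close>. The bound on d gives
  \<open>d - n >= 2\<close>, hence the coefficient of X, which carries the sum of the inverse roots,
  stays as it is.\<close>

lemma tau_add_monom:
  assumes "f \<in> Mon d" "odd n" "d \<ge> n + 2"
  shows "tau n (f + monom 1 (d - n)) = tau n f + 1"
proof -
  have n: "n \<ge> 1"
    using assms(2) by (cases n) auto
  let ?f' = "f + monom 1 (d - n)"
  have f': "?f' \<in> Mon d"
    by (rule Mon_add_monom) (use assms n in auto)
  have "reflect_poly ?f' = reflect_poly f + monom 1 n"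
    using assms(1,3) f' n by (auto simp: poly_eq_iff coeff_reflect_poly Mon_def)
  then have "fps_of_poly (reflect_poly ?f') = fps_of_poly (reflect_poly f) + fps_X ^ n"
    by (simp add: fps_of_poly_add fps_of_poly_monom')
  moreover have "fps_nth (fps_of_poly (reflect_poly f)) 0 = 1"
    using Mon_lead_coeff[OF assms(1)] assms(1) by (simp add: Mon_def)
  ultimately have "fps_nth (logd (fps_of_poly (reflect_poly ?f'))) n
      = fps_nth (logd (fps_of_poly (reflect_poly f))) n + 1"
    using logd_add_X_power[of "fps_of_poly (reflect_poly f)" n] n assms(2)
    by (simp add: char2_of_nat fps_of_poly_add fps_of_poly_monom')
  moreover have "coeff ?f' 1 = coeff f 1"
    using assms by auto
  ultimately show ?thesis
    using assms(1) f' by (simp add: tau_eq Mon_def algebra_simps)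
qed

text \<open>A bijection of \<open>Mon d\<close> that reverses the sign of every term. The degrees
  left over go up to n + 1, which for \<open>n = 2 ^ k + 1\<close> is twice the genus of the
  curve.\<close>

lemma chi_sum_eq_0:
  assumes "odd n" "d \<ge> n + 2"
  shows "chi_sum n d = 0"
proof -
  have n: "n \<ge> 1"
    using assms(1) by (cases n) auto
  have "chi_sum n d = (\<Sum>f\<in>Mon d. chi n (f + monom 1 (d - n)))"
    unfolding chi_sum_def
    by (rule sum.reindex_bij_betw[symmetric], rule add_monom_bij) (use assms n in auto)
  also have "\<dots> = (\<Sum>f\<in>Mon d. - chi n f)"
  proof (rule sum.cong)
    fix f assume "f \<in> Mon d"
    then show "chi n (f + monom 1 (d - n)) = - chi n f"
      using tau_add_monom[of f d n] assms by (cases "tau n f") (auto simp: chi_def)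
  qed simp
  also have "\<dots> = - chi_sum n d"
    by (simp add: chi_sum_def sum_negf)
  finally show ?thesis
    by simp
qed

lemma even_chi_sum:
  assumes "d \<ge> 2"
  shows "even (chi_sum n d)"
proof -
  let ?A = "{f \<in> Mon d. coeff f 1 = 0}" and ?B = "{f \<in> Mon d. coeff f 1 = 1}"
  have "bij_betw (\<lambda>f. f + monom 1 1) ?A ?B"
    by (rule bij_betwI[of _ _ _ "\<lambda>f. f + monom 1 1"])
      (use assms in \<open>auto simp: Mon_add_monom add.assoc\<close>)
  then have "card ?A = card ?B"
    by (rule bij_betw_same_card)
  have "Mon d = ?A \<union> ?B"
    using bit_not_zero_iff by blast
  then have "card (Mon d) = card (?A \<union> ?B)"
    by (rule arg_cong)
  also have "\<dots> = card ?A + card ?B"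
    by (rule card_Un_disjoint) auto
  finally have "card (Mon d) = card ?A + card ?B" .
  moreover note \<open>card ?A = card ?B\<close>
  \<comment> \<open>Every value of \<open>chi\<close> is odd, so only the number of terms matters
    for the parity.\<close>
  moreover have "even (chi_sum n d) \<longleftrightarrow> even (card (Mon d))"
  proof -
    have "even (sum (chi n) A) \<longleftrightarrow> even (card A)" if "finite A" for A
      using that by induction (auto simp: chi_def)
    then show ?thesis
      by (simp add: chi_sum_def)
  qed
  ultimately show ?thesis
    by simp
qed

lemma chi_sum_0: "chi_sum n 0 = 1"
proof -
  have "f = 1" if "f \<in> Mon 0" for f
    using that by (auto simp: Mon_def one_pCons elim!: degree_eq_zeroE)
  then have "Mon 0 = {1}"
    by (auto simp: Mon_def)
  then show ?thesis
    by (simp add: chi_sum_def chi_def tau_def)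
qed

section \<open>Roots over the algebraic closure\<close>

lemma proots_prod_linear:
  "proots (\<Prod>x\<in>#A. [:-x, 1:]) = (A :: 'a :: idom multiset)"
proof -
  have "proots [:-x, 1:] = {#x#}" for x :: 'a
  proof (rule multiset_eqI)
    fix y
    show "count (proots [:-x, 1:]) y = count {#x#} y"
      using order_power_n_n[of x 1] by (auto simp: order_eq_0_iff)
  qed
  moreover have "(\<Prod>x\<in>#A. [:-x, 1:]) \<noteq> 0" for A :: "'a multiset"
    by (auto simp: prod_mset_zero_iff)
  ultimately show ?thesis
    by (induction A) (simp_all add: proots_mult del: mult_pCons_left)
qed

lemma alg_closed_splits:
  fixes p :: "'a :: alg_closed_field poly"
  assumes "p \<noteq> 0"
  shows "p = smult (lead_coeff p) (\<Prod>x\<in>#proots p. [:-x, 1:])" "size (proots p) = degree p"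
proof -
  obtain A where A: "size A = degree p" "p = smult (lead_coeff p) (\<Prod>x\<in>#A. [:-x, 1:])"
    using alg_closed_imp_factorization[OF assms] by blast
  have "proots p = proots (smult (lead_coeff p) (\<Prod>x\<in>#A. [:-x, 1:]))"
    using A(2) by simp
  also have "\<dots> = A"
    using assms by (simp add: proots_prod_linear del: mult_pCons_left mult_pCons_right)
  finally show "p = smult (lead_coeff p) (\<Prod>x\<in>#proots p. [:-x, 1:])" "size (proots p) = degree p"
    using A by auto
qed

lemma sum_order_eq_degree:
  fixes p :: "'a :: alg_closed_field poly"
  assumes "p \<noteq> 0"
  shows "(\<Sum>x | poly p x = 0. order x p) = degree p"
  using alg_closed_splits(2)[OF assms] assms by (simp add: size_multiset_overloaded_eq)

lemma dvd_iff_order_le: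
  fixes p q :: "'a :: alg_closed_field poly"
  assumes "p \<noteq> 0" "q \<noteq> 0"
  shows "p dvd q \<longleftrightarrow> (\<forall>x. order x p \<le> order x q)"
proof
  assume "\<forall>x. order x p \<le> order x q"
  then have "proots p \<subseteq># proots q"
    using assms by (simp add: subseteq_mset_def)
  then have "image_mset (\<lambda>x. [:-x, 1:]) (proots p) \<subseteq># image_mset (\<lambda>x. [:-x, 1:]) (proots q)"
    by (rule image_mset_subseteq_mono)
  then have "(\<Prod>x\<in>#proots p. [:-x, 1:]) dvd (\<Prod>x\<in>#proots q. [:-x, 1:])"
    by (rule prod_mset_subset_imp_dvd)
  then have "smult (lead_coeff p) (\<Prod>x\<in>#proots p. [:-x, 1:])
      dvd smult (lead_coeff q) (\<Prod>x\<in>#proots q. [:-x, 1:])"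
    using assms by (simp add: smult_dvd_iff dvd_smult)
  then show "p dvd q"
    using alg_closed_splits(1)[OF assms(1)] alg_closed_splits(1)[OF assms(2)] by simp
qed (use assms in \<open>auto intro: dvd_imp_order_le\<close>)

section \<open>The Frobenius map on polynomials and on their roots\<close>

type_synonym K = "bit alg_closure"

definition frob :: "'a :: char2_ring poly \<Rightarrow> 'a poly" where
  "frob p = map_poly (\<lambda>c. c ^ 2) p"

lemma coeff_frob [simp]: "coeff (frob p) i = coeff p i ^ 2"
  by (simp add: frob_def coeff_map_poly)

lemma frob_mult: "frob (p * q) = frob p * (frob q :: 'a :: {char2_ring, idom} poly)"
  using char2_power_sum[of "\<lambda>i. coeff p i * coeff q (n - i)" "{..n}" 1 for n]
  by (simp add: poly_eq_iff coeff_mult power_mult_distrib)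

lemma frob_1 [simp]: "frob 1 = (1 :: 'a :: char2_ring poly)"
  by (simp add: poly_eq_iff coeff_1)

lemma frob_power: "frob (p ^ n) = frob (p :: 'a :: {char2_ring, idom} poly) ^ n"
  by (induction n) (auto simp: frob_mult)

lemma frob_prod: "frob (\<Prod>i\<in>A. f i) = (\<Prod>i\<in>A. frob (f i :: 'a :: {char2_ring, idom} poly))"
  by (induction A rule: infinite_finite_induct) (auto simp: frob_mult)

lemma frob_linear: "frob [:a, 1:] = [:a ^ 2, 1 :: 'a :: char2_ring:]"
  by (auto simp: poly_eq_iff coeff_pCons split: nat.splits)

lemma square_eq_self_iff: "a ^ 2 = a \<longleftrightarrow> a = 0 \<or> a = (1 :: 'a :: idom)"
  by (metis mult_cancel_right1 mult_zero_left power2_eq_square)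

text \<open>Descent to the prime field: in a domain only 0 and 1 equal their own square, and these
  are the values of \<open>emb\<close>.\<close>

lemma frob_eq_iff:
  fixes p :: "'a :: {char2_ring, idom} poly"
  shows "frob p = p \<longleftrightarrow> (\<exists>f. p = embp f)"
proof
  assume "frob p = p"
  then have p: "coeff p i = 0 \<or> coeff p i = 1" for i
    by (metis coeff_frob square_eq_self_iff)
  define f :: "bit poly" where "f = map_poly (\<lambda>c. if c = 0 then 0 else 1) p"
  have "p = embp f"
    using p by (auto simp: poly_eq_iff f_def coeff_map_poly)
  then show "\<exists>f. p = embp f" ..
next
  have "emb b ^ 2 = (emb b :: 'a)" for b
    by (cases b) auto
  then show "\<exists>f. p = embp f \<Longrightarrow> frob p = p"
    by (auto simp: poly_eq_iff)
qed

text \<open>Squaring the coefficients fixes \<open>embp f\<close> and moves the factor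
  \<open>X + a\<close> to \<open>X + a ^ 2\<close>. Thus multiplicities cannot drop along a
  Frobenius orbit.\<close>

lemma order_frob_le:
  fixes a :: K
  assumes "f \<noteq> 0"
  shows "order a (embp f) \<le> order (a ^ 2) (embp f)"
proof -
  let ?n = "order a (embp f)"
  obtain q where "embp f = [:a, 1:] ^ ?n * q"
    using order_1[of a "embp f"] by (auto elim: dvdE)
  then have "frob (embp f) = frob ([:a, 1:] ^ ?n * q)"
    by simp
  also have "\<dots> = [:a ^ 2, 1:] ^ ?n * frob q"
    by (simp only: frob_mult frob_power frob_linear)
  finally have "embp f = [:a ^ 2, 1:] ^ ?n * frob q"
    using frob_eq_iff[of "embp f :: K poly"] by auto
  then have "[:- (a ^ 2), 1:] ^ ?n dvd embp f"
    unfolding char2_uminus by (rule dvdI)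
  then show ?thesis
    using assms by (simp only: order_divides embp_eq_0_iff) simp
qed

lemma order_frob_iter_le:
  fixes a :: K
  assumes "f \<noteq> 0"
  shows "order a (embp f) \<le> order (a ^ 2 ^ i) (embp f)"
proof (induction i)
  case (Suc i)
  have "(a ^ 2 ^ i) ^ 2 = a ^ 2 ^ Suc i"
    by (simp add: power_mult[symmetric] mult.commute)
  then show ?case
    using Suc order_frob_le[OF assms, of "a ^ 2 ^ i"] by simp
qed simp

lemma iter_frob: "((a :: 'a :: monoid_mult) ^ 2 ^ i) ^ 2 ^ j = a ^ 2 ^ (i + j)"
  by (simp add: power_mult[symmetric] power_add)

text \<open>The orbit of a root stays inside the finite set of roots, so two iterates coincide;
  injectivity of Frobenius then brings the orbit back to \<open>a\<close> itself. The number e is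
  the degree of \<open>a\<close> over the prime field.\<close>

lemma ex_period:
  fixes a :: K
  assumes "f \<noteq> 0" "ev f a = 0"
  obtains e where "e \<ge> 1" "a ^ 2 ^ e = a" "\<And>i. a ^ 2 ^ i = a \<longleftrightarrow> e dvd i"
proof -
  have f: "embp f \<noteq> (0 :: K poly)"
    using assms by simp
  have "range (\<lambda>i. a ^ 2 ^ i) \<subseteq> {x. poly (embp f) x = 0}"
  proof safe
    fix i :: nat
    have "order a (embp f) > 0"
      using f assms(2) by (simp add: order_gt_0_iff ev_def)
    then have "order (a ^ 2 ^ i) (embp f) > 0"
      using order_frob_iter_le[OF assms(1), of a i] by linarith
    then show "poly (embp f) (a ^ 2 ^ i) = 0"
      using f by (simp add: order_gt_0_iff)
  qed
  then have "finite (range (\<lambda>i::nat. a ^ 2 ^ i))"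
    by (rule finite_subset) (use f in \<open>simp add: poly_roots_finite\<close>)
  then have "\<not> inj (\<lambda>i::nat. a ^ 2 ^ i)"
    using finite_imageD infinite_UNIV_nat by blast
  then obtain i j where ij: "i < j" "a ^ 2 ^ i = a ^ 2 ^ j"
    by (metis (mono_tags, lifting) injI linorder_neqE_nat)
  then have "(a ^ 2 ^ (j - i)) ^ 2 ^ i = a ^ 2 ^ i"
    by (simp add: iter_frob)
  then have ex: "j - i \<ge> 1 \<and> a ^ 2 ^ (j - i) = a"
    using ij(1) char2_power_inj[of "a ^ 2 ^ (j - i)" i a] by simp
  define e where "e = (LEAST e. e \<ge> 1 \<and> a ^ 2 ^ e = a)"
  have e: "e \<ge> 1 \<and> a ^ 2 ^ e = a"
    unfolding e_def by (rule LeastI[of "\<lambda>e. e \<ge> 1 \<and> a ^ 2 ^ e = a"]) (rule ex)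
  have mult: "a ^ 2 ^ (e * q) = a" for q
  proof (induction q)
    case (Suc q)
    have "a ^ 2 ^ (e * Suc q) = (a ^ 2 ^ e) ^ 2 ^ (e * q)"
      by (simp add: iter_frob)
    then show ?case
      using Suc e by simp
  qed simp
  have "e dvd i" if "a ^ 2 ^ i = a" for i
  proof (rule ccontr)
    assume "\<not> e dvd i"
    then have "i mod e \<ge> 1"
      by (simp add: mod_greater_zero_iff_not_dvd Suc_leI)
    moreover have "a ^ 2 ^ (i mod e) = a"
    proof -
      have "a = (a ^ 2 ^ (e * (i div e))) ^ 2 ^ (i mod e)"
        using that by (simp add: iter_frob)
      then show ?thesis
        using mult by simp
    qed
    ultimately have "e \<le> i mod e"
      unfolding e_def by (intro Least_le) auto
    then show False
      using e by (metis mod_less_divisor not_le less_eq_Suc_le One_nat_def)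
  qed
  then show ?thesis
    using that[of e] e mult by (auto elim!: dvdE)
qed

section \<open>The number of elements of \<open>GF2 m\<close>\<close>

lemma finite_GF2 [simp, intro]:
  assumes "m \<ge> 1"
  shows "finite (GF2 m)"
proof -
  let ?p = "monom 1 (2 ^ m) + [:0, 1:] :: K poly"
  have "(2::nat) ^ 1 \<le> 2 ^ m"
    using assms by (intro power_increasing) auto
  then have "coeff ?p 1 = 1"
    using assms by auto
  then have "?p \<noteq> 0"
    by fastforce
  then have "finite {x. poly ?p x = 0}"
    by (rule poly_roots_finite)
  moreover have "GF2 m = {x. poly ?p x = 0}"
    by (auto simp: GF2_def poly_monom char2_eq_iff)
  ultimately show ?thesis
    by simp
qed

text \<open>The polynomial \<open>X ^ (2 ^ m) + X\<close> has derivative 1, so its roots are simple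
  and as many as its degree.\<close>

lemma card_GF2:
  assumes "m \<ge> 1"
  shows "card (GF2 m) = 2 ^ m"
proof -
  let ?p = "monom 1 (2 ^ m) + [:0, 1:] :: K poly"
  have m: "(2::nat) ^ 1 \<le> 2 ^ m"
    using assms by (intro power_increasing) auto
  then have "coeff ?p 1 = 1"
    using assms by auto
  then have p: "?p \<noteq> 0"
    by fastforce
  have "pderiv ?p = 1"
    using assms by (simp add: pderiv_add pderiv_monom pderiv_pCons char2_of_nat one_pCons)
  have "order x ?p = 1" if "poly ?p x = 0" for x
  proof -
    have "\<not> [:x, 1:] ^ 2 dvd ?p"
    proof
      assume "[:x, 1:] ^ 2 dvd ?p"
      then obtain q where "?p = [:x, 1:] ^ 2 * q"
        by (rule dvdE)
      then have "?p = [:x, 1:] * ([:x, 1:] * q)"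
        by (simp only: power2_eq_square mult.assoc)
      then have "pderiv ?p = pderiv ([:x, 1:] * ([:x, 1:] * q))"
        by (rule arg_cong)
      then have "poly (pderiv ?p) x = 0"
        by (simp add: pderiv_mult del: mult_pCons_left)
      then show False
        using \<open>pderiv ?p = 1\<close> by simp
    qed
    then have "\<not> 2 \<le> order x ?p"
      using p order_divides[of x 2 ?p] by (simp only: char2_uminus) simp
    moreover have "order x ?p > 0"
      using that order_gt_0_iff[OF p, of x] by blast
    ultimately show ?thesis
      by linarith
  qed
  then have "card {x. poly ?p x = 0} = degree ?p"
    using sum_order_eq_degree[OF p] by simp
  also have "degree ?p = 2 ^ m"
    using m by (subst degree_add_eq_left) (auto simp: degree_monom_eq)
  also have "{x. poly ?p x = 0} = GF2 m"
    by (auto simp: GF2_def poly_monom char2_eq_iff)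
  finally show ?thesis .
qed


section \<open>Norms of linear polynomials\<close>

text \<open>For \<open>a\<close> in \<open>GF2 m\<close> this is the characteristic polynomial of
  \<open>a\<close> over the prime field: its minimal polynomial to the power m / e, with e the
  degree of \<open>a\<close>. Allowing every multiple m of e accounts for the powers of irreducible
  polynomials in the logarithmic derivative of an Euler product.\<close>

definition frob_norm :: "nat \<Rightarrow> K \<Rightarrow> K poly" where
  "frob_norm m a = (\<Prod>i<m. [:a ^ 2 ^ i, 1:])"

lemma frob_norm_nz [simp]: "frob_norm m a \<noteq> 0"
  by (auto simp: frob_norm_def)

lemma degree_frob_norm [simp]: "degree (frob_norm m a) = m"
  by (simp add: frob_norm_def degree_prod_eq_sum_degree)

lemma order_frob_norm: "order b (frob_norm m a) = card {i. i < m \<and> a ^ 2 ^ i = b}"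
proof -
  have "frob_norm m a = (\<Prod>x\<in>#image_mset (\<lambda>i. a ^ 2 ^ i) (mset_set {..<m}). [:-x, 1:])"
    by (simp add: frob_norm_def prod_unfold_prod_mset multiset.map_comp comp_def)
  then have "proots (frob_norm m a) = image_mset (\<lambda>i. a ^ 2 ^ i) (mset_set {..<m})"
    by (simp only: proots_prod_linear)
  then have "order b (frob_norm m a) = count (image_mset (\<lambda>i. a ^ 2 ^ i) (mset_set {..<m})) b"
    by (metis count_proots frob_norm_nz)
  also have "\<dots> = card {i. i < m \<and> a ^ 2 ^ i = b}"
    by (auto simp: count_image_mset intro!: arg_cong[of _ _ card])
  finally show ?thesis .
qed

text \<open>Frobenius shifts the factors by one place, and the last one returns to the first because
  \<open>a ^ 2 ^ m = a\<close>.\<close>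

lemma frob_frob_norm:
  assumes "a \<in> GF2 m"
  shows "frob (frob_norm m a) = frob_norm m a"
proof -
  have "frob (frob_norm m a) = (\<Prod>i<m. [:a ^ 2 ^ Suc i, 1:])"
    unfolding frob_norm_def frob_prod frob_linear
    by (simp add: power_mult[symmetric] mult.commute)
  also have "\<dots> = frob_norm m a"
  proof (cases m)
    case (Suc l)
    have "(\<Prod>i<m. [:a ^ 2 ^ Suc i, 1:]) = (\<Prod>i<l. [:a ^ 2 ^ Suc i, 1:]) * [:a ^ 2 ^ m, 1:]"
      by (simp add: Suc)
    also have "a ^ 2 ^ m = a ^ 2 ^ 0"
      using assms by (simp add: GF2_def)
    also have "(\<Prod>i<l. [:a ^ 2 ^ Suc i, 1:]) * [:a ^ 2 ^ 0, 1:] = frob_norm m a"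
      unfolding frob_norm_def Suc by (subst prod.lessThan_Suc_shift) (simp add: mult.commute)
    finally show ?thesis .
  qed (simp add: frob_norm_def)
  finally show ?thesis .
qed

text \<open>If e is the period of \<open>a\<close>, the admissible m are the multiples j * e, and
  \<open>frob_norm (j * e) a\<close> is the j-th power of the product over the orbit. It divides f
  exactly when j is at most the multiplicity of \<open>a\<close>, since the multiplicity of every
  conjugate is at least that of \<open>a\<close>.\<close>

lemma card_frob_norm_dvd:
  fixes a :: K
  assumes f: "f \<noteq> 0" and a: "ev f a = 0"
  shows "card {m. m \<ge> 1 \<and> a \<in> GF2 m \<and> frob_norm m a dvd embp f} = order a (embp f)"
proof -
  obtain e where e: "e \<ge> 1" "a ^ 2 ^ e = a" "\<And>i. a ^ 2 ^ i = a \<longleftrightarrow> e dvd i"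
    using ex_period[OF assms] by blast
  have e': "a ^ 2 ^ i = a ^ 2 ^ r \<longleftrightarrow> i mod e = r mod e" for i r
  proof (induction i r rule: linorder_wlog)
    case (le i r)
    have "a ^ 2 ^ i = a ^ 2 ^ r \<longleftrightarrow> a ^ 2 ^ i = (a ^ 2 ^ (r - i)) ^ 2 ^ i"
      using le by (simp add: iter_frob)
    also have "\<dots> \<longleftrightarrow> a = a ^ 2 ^ (r - i)"
      by (metis char2_power_inj)
    also have "\<dots> \<longleftrightarrow> e dvd r - i"
      using e(3) by metis
    also have "\<dots> \<longleftrightarrow> i mod e = r mod e"
      using le by (metis mod_eq_dvd_iff_nat)
    finally show ?case .
  qed metis
  \<comment> \<open>Each conjugate of \<open>a\<close> occurs j times among the j * e factors of
    \<open>frob_norm (j * e) a\<close>.\<close>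
  have cnt: "card {i. i < j * e \<and> i mod e = r mod e} = j" for j r
  proof -
    have "{i. i < j * e \<and> i mod e = r mod e} = (\<lambda>q. q * e + r mod e) ` {..<j}"
    proof (intro equalityI subsetI)
      fix i assume "i \<in> {i. i < j * e \<and> i mod e = r mod e}"
      then have "i = (i div e) * e + r mod e" "i div e < j"
        using e(1) by (auto simp: less_mult_imp_div_less) (metis div_mult_mod_eq)
      then show "i \<in> (\<lambda>q. q * e + r mod e) ` {..<j}"
        by blast
    next
      fix i assume "i \<in> (\<lambda>q. q * e + r mod e) ` {..<j}"
      then obtain q where q: "q < j" "i = q * e + r mod e"
        by blast
      have "i < q * e + e"
        using q e(1) by simp
      also have "\<dots> = Suc q * e"
        by simp
      also have "\<dots> \<le> j * e"
        using q by (intro mult_right_mono) auto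
      finally show "i \<in> {i. i < j * e \<and> i mod e = r mod e}"
        using q by simp
    qed
    moreover have "inj_on (\<lambda>q. q * e + r mod e) {..<j}"
      using e(1) by (auto simp: inj_on_def)
    ultimately show ?thesis
      by (simp add: card_image)
  qed
  have iff: "frob_norm (j * e) a dvd embp f \<longleftrightarrow> j \<le> order a (embp f)" for j
  proof
    assume "frob_norm (j * e) a dvd embp f"
    then have "order a (frob_norm (j * e) a) \<le> order a (embp f)"
      using f by (intro dvd_imp_order_le) auto
    moreover have "order a (frob_norm (j * e) a) = j"
      using cnt[of j 0] e'[of _ 0] by (simp add: order_frob_norm)
    ultimately show "j \<le> order a (embp f)"
      by simp
  next
    assume j: "j \<le> order a (embp f)"
    have "order b (frob_norm (j * e) a) \<le> order b (embp f)" for b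
    proof (cases "\<exists>r. b = a ^ 2 ^ r")
      case True
      then obtain r where r: "b = a ^ 2 ^ r"
        by blast
      then have "order b (frob_norm (j * e) a) = j"
        using cnt[of j r] e'[of _ r] by (simp add: order_frob_norm)
      then show ?thesis
        using j order_frob_iter_le[OF f, of a r] r by simp
    next
      case False
      then have none: "{i. i < j * e \<and> a ^ 2 ^ i = b} = {}"
        by blast
      show ?thesis
        unfolding order_frob_norm none by simp
    qed
    then show "frob_norm (j * e) a dvd embp f"
      using f by (subst dvd_iff_order_le) auto
  qed
  have "{m. m \<ge> 1 \<and> a \<in> GF2 m \<and> frob_norm m a dvd embp f} = (\<lambda>j. j * e) ` {1..order a (embp f)}"
  proof (intro equalityI subsetI)
    fix m assume m: "m \<in> {m. m \<ge> 1 \<and> a \<in> GF2 m \<and> frob_norm m a dvd embp f}"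
    then have "e dvd m"
      by (simp add: GF2_def e(3))
    then obtain j where j: "m = j * e"
      by (metis dvdE mult.commute)
    have "j \<noteq> 0"
    proof
      assume "j = 0"
      then show False
        using m j by simp
    qed
    then have "1 \<le> j"
      by linarith
    moreover have "j \<le> order a (embp f)"
      using m j iff[of j] by blast
    ultimately show "m \<in> (\<lambda>j. j * e) ` {1..order a (embp f)}"
      unfolding j by (intro imageI) (simp only: atLeastAtMost_iff)
  next
    fix m assume "m \<in> (\<lambda>j. j * e) ` {1..order a (embp f)}"
    then obtain j where "m = j * e" "j \<in> {1..order a (embp f)}"
      by (rule imageE)
    moreover have "a \<in> GF2 (j * e)"
      by (simp add: GF2_def e(3))
    ultimately show "m \<in> {m. m \<ge> 1 \<and> a \<in> GF2 m \<and> frob_norm m a dvd embp f}"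
      using iff[of j] e(1) by simp
  qed
  moreover have "inj_on (\<lambda>j. j * e) {1..order a (embp f)}"
    using e(1) by (auto simp: inj_on_def)
  ultimately show ?thesis
    by (simp add: card_image)
qed

text \<open>Grouping the pairs by \<open>a\<close> instead of m, each root contributes its
  multiplicity, and the multiplicities add up to the degree. The root 0 does not occur because the
  constant term is 1.\<close>

lemma card_frob_norm_pairs:
  assumes "f \<in> Mon d"
  shows "card (SIGMA m:{1..d}. {a \<in> GF2 m - {0}. frob_norm m a dvd embp f}) = d"
proof -
  have f: "f \<noteq> 0" "degree f = d" "coeff f 0 = 1"
    using assms by (auto simp: Mon_def)
  let ?R = "{a. poly (embp f) a = (0 :: K)}"
  let ?M = "\<lambda>a. {m. m \<ge> 1 \<and> a \<in> GF2 m \<and> frob_norm m a dvd embp f}"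
  have fin: "finite ?R"
    using f by (simp add: poly_roots_finite)
  have le: "m \<le> d" if "frob_norm m a dvd embp f" for m a
    using dvd_imp_degree_le[OF that] f by simp
  have root: "a \<in> ?R" if "m \<ge> 1" "frob_norm m a dvd embp f" for m a
  proof -
    have "order a (frob_norm m a) > 0"
      using that by (simp add: order_frob_norm card_gt_0_iff) (metis power_0 power_one_right less_eq_Suc_le One_nat_def)
    then have "poly (frob_norm m a) a = 0"
      by (simp add: order_gt_0_iff)
    then show ?thesis
      using that(2) by (auto elim: dvdE)
  qed
  have nz: "a \<noteq> 0" if "a \<in> ?R" for a
    using that f by (auto simp: poly_0_coeff_0)
  have finM: "finite (?M a)" for a
    by (rule finite_subset[of _ "{..d}"]) (use le in auto)
  let ?S = "SIGMA m:{1..d}. {a \<in> GF2 m - {0}. frob_norm m a dvd embp f}"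
  have iff: "m \<in> {1..d} \<and> a \<in> {a \<in> GF2 m - {0}. frob_norm m a dvd embp f} \<longleftrightarrow> a \<in> ?R \<and> m \<in> ?M a" for m a
    using le[of m a] root[of m a] nz[of a]
    by (simp only: mem_Collect_eq atLeastAtMost_iff Diff_iff singleton_iff) blast
  have "(SIGMA a:?R. ?M a) = ?S\<inverse>"
    by (simp only: set_eq_iff split_paired_All converse_iff mem_Sigma_iff iff) simp
  then have "card ?S = card (SIGMA a:?R. ?M a)"
    by simp
  also have "\<dots> = (\<Sum>a\<in>?R. card (?M a))"
    using fin finM by (subst card_SigmaI) auto
  also have "\<dots> = (\<Sum>a\<in>?R. order a (embp f))"
    by (rule sum.cong) (simp_all only: card_frob_norm_dvd f ev_def mem_Collect_eq not_False_eq_True)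
  also have "\<dots> = d"
    using f by (simp add: sum_order_eq_degree)
  finally show ?thesis .
qed

section \<open>Norms over the prime field and the recursion from the Euler product\<close>

definition norm_poly :: "nat \<Rightarrow> K \<Rightarrow> bit poly" where
  "norm_poly m a = (THE f. frob_norm m a = embp f)"

lemma embp_norm_poly:
  assumes "a \<in> GF2 m"
  shows "embp (norm_poly m a) = frob_norm m a"
proof -
  obtain f where f: "frob_norm m a = embp f"
    using frob_frob_norm[OF assms] frob_eq_iff[of "frob_norm m a"] by auto
  then have "frob_norm m a = embp (norm_poly m a)"
    unfolding norm_poly_def by (rule theI) (use f in auto)
  then show ?thesis
    by simp
qed

text \<open>The sum \<open>G\<close> with a general exponent n in place of \<open>2 ^ k + 1\<close>;
  the construction of the L-polynomial below works for every odd n.\<close>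

definition char_sum :: "nat \<Rightarrow> nat \<Rightarrow> int" where
  "char_sum n m = (\<Sum>a\<in>GF2 m - {0}. if Tr m (a ^ n + inverse a) = 0 then 1 else -1)"

lemma norm_poly_Mon:
  assumes "a \<in> GF2 m - {0}"
  shows "norm_poly m a \<in> Mon m"
proof -
  have "degree (embp (norm_poly m a) :: K poly) = m"
    using assms by (simp add: embp_norm_poly del: degree_embp)
  moreover have "coeff (embp (norm_poly m a) :: K poly) 0 \<noteq> 0"
    using assms by (auto simp: embp_norm_poly frob_norm_def poly_0_coeff_0[symmetric] poly_prod simp del: coeff_embp)
  ultimately show ?thesis
    by (simp add: Mon_def)
qed

text \<open>The roots of \<open>norm_poly m a\<close> are the conjugates of \<open>a\<close>, and a
  power sum over conjugates is a trace. This identifies the character on polynomials with the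
  additive character in \<open>G\<close>.\<close>

lemma emb_tau_norm_poly:
  assumes a: "a \<in> GF2 m - {0}" and n: "n \<ge> 1"
  shows "emb (tau n (norm_poly m a)) = Tr m (a ^ n + inverse a)"
proof -
  let ?f = "norm_poly m a"
  have f: "?f \<in> Mon m" "?f \<noteq> 0" "coeff ?f 0 = 1"
    using norm_poly_Mon[OF a] by (auto simp: Mon_def)
  have emb: "embp ?f = frob_norm m a"
    using a by (simp add: embp_norm_poly)
  have "emb (fps_nth (logd (fps_of_poly (reflect_poly ?f))) n)
      = fps_nth (embf (logd (fps_of_poly (reflect_poly ?f)))) n"
    by simp
  also have "\<dots> = fps_nth (logd (fps_of_poly (reflect_poly (frob_norm m a)))) n"
    using f(2) by (simp add: embf_logd embf_of_poly embp_reflect emb)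
  \<comment> \<open>Reflection turns \<open>X + c\<close> into \<open>1 + c X\<close>, the form to
    which \<open>logd_linear\<close> applies.\<close>
  also have "fps_of_poly (reflect_poly (frob_norm m a)) = (\<Prod>i<m. 1 - fps_const (a ^ 2 ^ i) * fps_X)"
    using a by (simp add: frob_norm_def reflect_poly_prod fps_of_poly_prod fps_of_poly_linear'
        reflect_poly_pCons)
  also have "logd \<dots> = (\<Sum>i<m. logd (1 - fps_const (a ^ 2 ^ i) * fps_X))"
    by (rule logd_prod) auto
  also have "fps_nth \<dots> n = (\<Sum>i<m. (a ^ 2 ^ i) ^ n)"
    unfolding fps_sum_nth by (rule sum.cong) (simp_all only: logd_linear[OF n] char2_uminus)
  finally have 1: "emb (fps_nth (logd (fps_of_poly (reflect_poly ?f))) n) = (\<Sum>i<m. (a ^ n) ^ 2 ^ i)"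
    by (simp add: power_mult[symmetric] mult.commute)
  have "emb (fps_nth (logd (fps_of_poly ?f)) 1) = fps_nth (embf (logd (fps_of_poly ?f))) 1"
    by simp
  also have "\<dots> = fps_nth (logd (fps_of_poly (frob_norm m a))) 1"
    using f(3) by (simp add: embf_logd embf_of_poly emb)
  also have "fps_of_poly (frob_norm m a) = (\<Prod>i<m. fps_of_poly [:a ^ 2 ^ i, 1:])"
    by (simp add: frob_norm_def fps_of_poly_prod)
  also have "logd \<dots> = (\<Sum>i<m. logd (fps_of_poly [:a ^ 2 ^ i, 1:]))"
    by (rule logd_prod) (use a in auto)
  also have "fps_nth \<dots> 1 = (\<Sum>i<m. inverse a ^ 2 ^ i)"
    unfolding fps_sum_nth
  proof (rule sum.cong)
    fix i
    show "fps_nth (logd (fps_of_poly [:a ^ 2 ^ i, 1:])) 1 = inverse a ^ 2 ^ i"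
      using a logd_nth_1[of "fps_of_poly [:a ^ 2 ^ i, 1:]"] by (simp add: power_inverse divide_inverse)
  qed simp
  finally show ?thesis
    using 1 by (simp add: tau_def Tr_def char2_power_add sum.distrib)
qed

lemma chi_norm_poly:
  assumes "a \<in> GF2 m - {0}" "n \<ge> 1"
  shows "chi n (norm_poly m a) = (if Tr m (a ^ n + inverse a) = 0 then 1 else -1)"
  using emb_tau_norm_poly[OF assms, symmetric] by (simp add: chi_def)

text \<open>If dividend and divisor are fixed by \<open>frob\<close>, cancellation shows that the
  quotient is fixed as well and so has coefficients in the prime field.\<close>

lemma frob_norm_dvd_iff:
  assumes "a \<in> GF2 m"
  shows "frob_norm m a dvd embp f \<longleftrightarrow> norm_poly m a dvd f"
proof
  assume "frob_norm m a dvd embp f"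
  then obtain q where q: "embp f = frob_norm m a * q"
    by (rule dvdE)
  then have "frob (embp f) = frob_norm m a * frob q"
    using frob_frob_norm[OF assms] by (simp add: frob_mult)
  moreover have "frob (embp f) = (embp f :: K poly)"
    using frob_eq_iff by blast
  ultimately have "frob_norm m a * frob q = frob_norm m a * q"
    using q by simp
  then have "frob q = q"
    by simp
  then obtain g where "q = embp g"
    using frob_eq_iff by blast
  then have "embp f = (embp (norm_poly m a * g) :: K poly)"
    using q embp_norm_poly[OF assms] by simp
  then show "norm_poly m a dvd f"
    unfolding embp_eq_iff by simp
next
  assume "norm_poly m a dvd f"
  then obtain g where "f = norm_poly m a * g"
    by (rule dvdE)
  then show "frob_norm m a dvd embp f"
    by (simp add: embp_norm_poly[OF assms])
qed

lemma sum_chi_multiples: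
  assumes g: "g \<in> Mon m" and "m \<le> d"
  shows "(\<Sum>f | f \<in> Mon d \<and> g dvd f. chi n f) = chi n g * chi_sum n (d - m)"
proof -
  have g': "g \<noteq> 0" "degree g = m" "coeff g 0 = 1"
    using g by (auto simp: Mon_def)
  have "bij_betw (\<lambda>h. g * h) (Mon (d - m)) {f \<in> Mon d. g dvd f}"
  proof (rule bij_betwI')
    fix h h' assume "h \<in> Mon (d - m)" "h' \<in> Mon (d - m)"
    show "(g * h = g * h') = (h = h')"
      using g' by simp
  next
    fix h assume h: "h \<in> Mon (d - m)"
    then have "h \<noteq> 0" "degree h = d - m" "coeff h 0 = 1"
      by (auto simp: Mon_def)
    then show "g * h \<in> {f \<in> Mon d. g dvd f}"
      using g' assms(2) by (simp add: Mon_def degree_mult_eq coeff_mult_0)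
  next
    fix f assume f: "f \<in> {f \<in> Mon d. g dvd f}"
    then obtain h where h: "f = g * h"
      by (auto elim: dvdE)
    have "coeff f 0 = 1" "degree f = d"
      using f by (auto simp: Mon_def)
    then have "coeff h 0 = 1" "h \<noteq> 0"
      using h g' by (auto simp: coeff_mult_0)
    then have "h \<in> Mon (d - m)"
      using h g' \<open>degree f = d\<close> by (simp add: Mon_def degree_mult_eq)
    then show "\<exists>h\<in>Mon (d - m). f = g * h"
      using h by blast
  qed
  then have "(\<Sum>f | f \<in> Mon d \<and> g dvd f. chi n f) = (\<Sum>h\<in>Mon (d - m). chi n (g * h))"
    by (rule sum.reindex_bij_betw[symmetric])
  also have "\<dots> = (\<Sum>h\<in>Mon (d - m). chi n g * chi n h)"
    by (rule sum.cong) (use g' in \<open>auto simp: chi_mult Mon_def\<close>)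
  finally show ?thesis
    by (simp add: chi_sum_def sum_distrib_left)
qed

text \<open>The logarithmic derivative of the Euler product, obtained without the product: both sides are
  sums over the triples \<open>(f, m, a)\<close> with \<open>frob_norm m a\<close> dividing \<open>f\<close>, of which each \<open>f\<close> of
  degree \<open>d\<close> has \<open>d\<close>.\<close>

lemma chi_sum_recursion:
  assumes n: "n \<ge> 1"
  shows "int d * chi_sum n d = (\<Sum>m=1..d. char_sum n m * chi_sum n (d - m))"
proof -
  let ?S = "\<lambda>f. SIGMA m:{1..d}. {a \<in> GF2 m - {0}. frob_norm m a dvd embp f}"
  let ?T = "SIGMA m:{1..d}. GF2 m - {0}"
  let ?P = "\<lambda>f p. norm_poly (fst p) (snd p) dvd f"
  have S: "?S f = {p \<in> ?T. ?P f p}" for f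
    by (auto simp: frob_norm_dvd_iff)
  have finT: "finite ?T"
  proof (rule finite_SigmaI)
    fix m assume "m \<in> {1..d}"
    then have "m \<ge> 1"
      by simp
    then show "finite (GF2 m - {0})"
      by (intro finite_Diff finite_GF2)
  qed simp
  have "int d * chi_sum n d = (\<Sum>f\<in>Mon d. int d * chi n f)"
    unfolding chi_sum_def by (rule sum_distrib_left)
  also have "\<dots> = (\<Sum>f\<in>Mon d. \<Sum>p | p \<in> ?T \<and> ?P f p. chi n f)"
  proof (rule sum.cong)
    fix f assume "f \<in> Mon d"
    then have "card {p \<in> ?T. ?P f p} = d"
      unfolding S[symmetric] by (rule card_frob_norm_pairs)
    then show "int d * chi n f = (\<Sum>p | p \<in> ?T \<and> ?P f p. chi n f)"
      by simp
  qed simp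
  also have "\<dots> = (\<Sum>p\<in>?T. \<Sum>f | f \<in> Mon d \<and> ?P f p. chi n f)"
    by (rule sum.swap_restrict) (rule finite_Mon, rule finT)
  also have "\<dots> = (\<Sum>(m, a)\<in>?T. \<Sum>f | f \<in> Mon d \<and> norm_poly m a dvd f. chi n f)"
    by (simp add: case_prod_beta)
  also have "\<dots> = (\<Sum>m=1..d. \<Sum>a\<in>GF2 m - {0}. \<Sum>f | f \<in> Mon d \<and> norm_poly m a dvd f. chi n f)"
    by (rule sum.Sigma[symmetric]) auto
  also have "\<dots> = (\<Sum>m=1..d. char_sum n m * chi_sum n (d - m))"
  proof (rule sum.cong)
    fix m assume m: "m \<in> {1..d}"
    have "(\<Sum>f | f \<in> Mon d \<and> norm_poly m a dvd f. chi n f)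
        = (if Tr m (a ^ n + inverse a) = 0 then 1 else -1) * chi_sum n (d - m)" if "a \<in> GF2 m - {0}" for a
      using sum_chi_multiples[OF norm_poly_Mon[OF that]] chi_norm_poly[OF that n] m by auto
    then show "(\<Sum>a\<in>GF2 m - {0}. \<Sum>f | f \<in> Mon d \<and> norm_poly m a dvd f. chi n f)
        = char_sum n m * chi_sum n (d - m)"
      by (simp add: char_sum_def sum_distrib_right)
  qed simp
  finally show ?thesis .
qed

lemma G_eq_char_sum: "G k m = char_sum (2 ^ k + 1) m"
  by (simp add: G_def char_sum_def)

section \<open>The 2-adic unit root\<close>

lemma diff_dvd_poly_diff: "x - y dvd poly p x - poly p (y :: 'a :: comm_ring_1)"
proof (induction p)
  case (pCons a p)
  have "poly (pCons a p) x - poly (pCons a p) y = (x - y) * poly p x + y * (poly p x - poly p y)"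
    by (simp add: algebra_simps)
  then show ?case
    using pCons by (metis dvd_add dvd_mult dvd_triv_left)
qed simp

text \<open>Congruence to 1 + X modulo 2. By Hensel's lemma such a polynomial has exactly one root
  in the 2-adic integers, a unit v; its inverse u is the unit reciprocal root.\<close>

definition one_unit_root :: "int poly \<Rightarrow> bool" where
  "one_unit_root L \<longleftrightarrow> (\<exists>M. L = [:1, 1:] + smult 2 M)"

lemma ex_half_poly:
  assumes "\<And>i. even (coeff p i)"
  obtains q :: "int poly" where "p = smult 2 q"
proof
  show "p = smult 2 (map_poly (\<lambda>c. c div 2) p)"
    using assms by (simp add: poly_eq_iff coeff_map_poly)
qed

lemma poly_one_unit_root_parity:
  assumes "one_unit_root L"
  shows "even (poly L v) \<longleftrightarrow> odd v"
  using assms by (auto simp: one_unit_root_def)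

text \<open>Hensel lifting: the derivative of L takes odd values, so replacing v by
  \<open>v + 2 ^ s\<close> changes \<open>poly L v\<close> by \<open>2 ^ s\<close> times an odd
  number. Whenever v fails modulo the next power, the shifted value works.\<close>

lemma ex_root_mod_power_2:
  assumes "one_unit_root L"
  shows "\<exists>v. 2 ^ s dvd poly L v"
proof (induction s)
  case (Suc s)
  then obtain v where v: "2 ^ s dvd poly L v"
    by blast
  show ?case
  proof (cases "2 ^ Suc s dvd poly L v")
    case False
    obtain M where M: "L = [:1, 1:] + smult 2 M"
      using assms by (auto simp: one_unit_root_def)
    obtain w where w: "poly L v = 2 ^ s * w"
      using v by (auto elim: dvdE)
    then have "odd w"
      using False by auto
    obtain t where "poly M (v + 2 ^ s) - poly M v = 2 ^ s * t"
      using diff_dvd_poly_diff[of "v + 2 ^ s" v M] by (auto elim: dvdE)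
    then have "poly M (v + 2 ^ s) = poly M v + 2 ^ s * t"
      by simp
    then have "poly L (v + 2 ^ s) = poly L v + 2 ^ s * (1 + 2 * t)"
      by (simp add: M algebra_simps)
    also have "\<dots> = 2 ^ s * (w + 1 + 2 * t)"
      using w by (simp add: algebra_simps)
    finally have "2 ^ Suc s dvd poly L (v + 2 ^ s)"
      using \<open>odd w\<close> by simp
    then show ?thesis
      by blast
  qed blast
qed auto

text \<open>Division by \<open>X - v\<close> leaves \<open>poly L v\<close>, which vanishes modulo
  \<open>2 ^ s\<close>. The cofactor is 1 modulo 2 because L and \<open>1 - u X\<close> are both 1 +
  X there.\<close>

lemma linear_factor_mod:
  assumes L: "one_unit_root L" and s: "s \<ge> 1"
    and v: "2 ^ s dvd poly L v" and u: "2 ^ s dvd u * v - 1"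
  obtains W T where "L = [:1, - u:] * (1 + smult 2 W) + smult (2 ^ s) T"
proof -
  obtain Q where Q: "L = [:- v, 1:] * Q + [:poly L v:]"
    using synthetic_div_correct'[of v L] by metis
  obtain c where c: "poly L v = 2 ^ s * c"
    using v by (auto elim: dvdE)
  obtain e where e: "u * v - 1 = 2 ^ s * e"
    using u by (auto elim: dvdE)
  \<comment> \<open>Since u v is 1 modulo \<open>2 ^ s\<close>, the factor \<open>X - v\<close> is
    congruent to \<open>- v (1 - u X)\<close>; the unit - v moves into the cofactor.\<close>
  define R where "R = smult (- v) Q"
  define T where "T = [:c:] - smult e ([:0, 1:] * Q)"
  have "L = [:1, - u:] * R + smult (u * v - 1) (- ([:0, 1:] * Q)) + smult (2 ^ s) [:c:]"
    by (subst Q) (simp add: R_def c smult_diff_left smult_add_right algebra_simps)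
  then have LR: "L = [:1, - u:] * R + smult (2 ^ s) T"
    unfolding e T_def by (simp add: smult_diff_right)
  have ev2: "even ((2::int) ^ s)"
    using s by simp
  have "even (u * v - 1)"
    using u ev2 by (meson dvd_trans)
  then have "odd u"
    by auto
  obtain M where M: "L = [:1, 1:] + smult 2 M"
    using L by (auto simp: one_unit_root_def)
  have cf: "coeff L i = coeff R i - (if i = 0 then 0 else u * coeff R (i - 1)) + 2 ^ s * coeff T i" for i
    by (subst LR) (auto simp: coeff_pCons algebra_simps split: nat.splits)
  \<comment> \<open>Power series division by \<open>1 - u X\<close>, carried out modulo 2.\<close>
  have "even (coeff (R - 1) i)" for i
  proof (induction i)
    case 0
    have "odd (coeff L 0)"
      by (simp add: M)
    then show ?case
      using cf[of 0] ev2 by auto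
  next
    case (Suc i)
    have "coeff L (Suc i) = (if i = 0 then 1 else 0) + 2 * coeff M (Suc i)"
      by (auto simp: M coeff_pCons split: nat.splits)
    moreover have "coeff R (Suc i) = coeff L (Suc i) + u * coeff R i - 2 ^ s * coeff T (Suc i)"
      using cf[of "Suc i"] by simp
    ultimately have "even (coeff R (Suc i)) \<longleftrightarrow> even ((if i = 0 then 1 else 0) + coeff R i)"
      using ev2 \<open>odd u\<close> by auto
    then show ?case
      using Suc by (auto split: if_splits)
  qed
  then obtain W where "R - 1 = smult 2 W"
    by (rule ex_half_poly)
  then have "R = 1 + smult 2 W"
    by (simp add: algebra_simps)
  then show ?thesis
    using LR that by blast
qed

lemma fps_const_dvd_nth: "fps_const (c :: int) dvd F \<Longrightarrow> c dvd fps_nth F n"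
  by (auto elim!: dvdE)

text \<open>Modulo \<open>2 ^ s\<close> the logarithmic derivative splits into that of
  \<open>1 - u X\<close>, with coefficients \<open>- (u ^ m)\<close>, and that of a cofactor
  \<open>R = 1 + 2 W\<close>. As 2 W is nilpotent modulo \<open>2 ^ s\<close>, the inverse of R is a
  polynomial there, so R contributes only finitely many coefficients.\<close>

lemma power_sums_mod_power_2:
  assumes L: "one_unit_root L"
    and S: "fps_X * fps_deriv (fps_of_poly L) = fps_of_poly L * Abs_fps S"
    and s: "s \<ge> 1" and v: "2 ^ s dvd poly L v" and u: "2 ^ s dvd u * v - 1"
  shows "\<exists>M. \<forall>m\<ge>M. 2 ^ s dvd S m + u ^ m"
proof -
  obtain Wp Tp where LWT: "L = [:1, - u:] * (1 + smult 2 Wp) + smult (2 ^ s) Tp"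
    using linear_factor_mod[OF L s v u] by blast
  define N :: "int fps" where "N = fps_const (2 ^ s)"
  define A where "A = 1 - fps_const u * fps_X"
  define W where "W = fps_of_poly Wp"
  define T where "T = fps_of_poly Tp"
  define R where "R = 1 + 2 * W"
  define U where "U = Abs_fps (\<lambda>m. if m = 0 then 0 else u ^ m)"
  define \<Sigma> where "\<Sigma> = Abs_fps S"
  have F: "fps_of_poly L = A * R + N * T"
    by (simp add: LWT fps_of_poly_add fps_of_poly_mult fps_of_poly_smult A_def R_def W_def N_def T_def
        fps_of_poly_pCons numeral_fps_const one_pCons)
  have AU: "A * (1 + U) = 1"
  proof (rule fps_ext)
    fix n
    show "fps_nth (A * (1 + U)) n = fps_nth 1 n"
      by (cases n) (auto simp: A_def U_def left_diff_distrib mult.assoc)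
  qed
  have A': "fps_deriv A = - fps_const u"
    by (simp add: A_def)
  have N': "fps_deriv N = 0"
    by (simp add: N_def)
  have "fps_X * (fps_deriv A * R + A * fps_deriv R + N * fps_deriv T) = (A * R + N * T) * \<Sigma>"
    using S by (simp add: F N' \<Sigma>_def algebra_simps)
  then have "A * (fps_X * fps_deriv R - R * \<Sigma>) - fps_const u * fps_X * R = N * (T * \<Sigma> - fps_X * fps_deriv T)"
    by (simp add: A' algebra_simps del: fps_const_neg)
  \<comment> \<open>The series 1 + U is the inverse of A; multiplying by it isolates the sum of
    \<Sigma> and U.\<close>
  then have "(1 + U) * (A * (fps_X * fps_deriv R - R * \<Sigma>) - fps_const u * fps_X * R)
      = (1 + U) * (N * (T * \<Sigma> - fps_X * fps_deriv T))"
    by simp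
  moreover have "(1 + U) * (A * (fps_X * fps_deriv R - R * \<Sigma>) - fps_const u * fps_X * R)
      = fps_X * fps_deriv R - R * (\<Sigma> + U)"
  proof -
    have uX: "fps_const u * fps_X = 1 - A"
      by (simp add: A_def)
    have "(1 + U) * (A * P - fps_const u * fps_X * R) = P - R * U" for P
    proof -
      have "(1 + U) * (A * P - (1 - A) * R) = (A * (1 + U)) * (P + R) - (1 + U) * R"
        by (simp add: algebra_simps)
      also have "\<dots> = P - R * U"
        unfolding AU by (simp add: algebra_simps)
      finally show ?thesis
        unfolding uX .
    qed
    then show ?thesis
      by (simp only:) (simp add: algebra_simps)
  qed
  ultimately have 1: "N dvd fps_X * fps_deriv R - R * (\<Sigma> + U)"
    by (simp add: mult.left_commute[of _ N])
  \<comment> \<open>The inverse of R modulo \<open>2 ^ s\<close>: the geometric series in - 2 W can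
    stop at s.\<close>
  define B where "B = (\<Sum>i<s. (- 2 * W) ^ i)"
  have "1 - (- 2 * W) ^ s = R * B"
    using one_diff_power_eq[of "- 2 * W" s] by (simp add: R_def B_def)
  moreover have "(- 2 * W) ^ s = N * ((- 1) ^ s * W ^ s)"
  proof -
    have "(- 2 * W) ^ s = ((- 1) * (2 * W)) ^ s"
      by simp
    also have "\<dots> = (- 1) ^ s * (2 ^ s * W ^ s)"
      by (simp only: power_mult_distrib)
    also have "(2 :: int fps) ^ s = N"
      by (simp add: N_def numeral_fps_const fps_const_power)
    finally show ?thesis
      by (simp only: mult.left_commute)
  qed
  ultimately have RB: "R * B = 1 - N * ((- 1) ^ s * W ^ s)"
    by simp
  have "N dvd B * (fps_X * fps_deriv R - R * (\<Sigma> + U))"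
    using 1 by (rule dvd_mult)
  also have "B * (fps_X * fps_deriv R - R * (\<Sigma> + U))
      = B * fps_X * fps_deriv R - (R * B) * (\<Sigma> + U)"
    by (simp add: algebra_simps)
  also have "\<dots> = (B * fps_X * fps_deriv R - (\<Sigma> + U)) + N * ((- 1) ^ s * W ^ s * (\<Sigma> + U))"
    unfolding RB by (simp add: algebra_simps)
  finally have 2: "N dvd B * fps_X * fps_deriv R - (\<Sigma> + U)"
    by (simp add: dvd_add_left_iff)
  define P where "P = (\<Sum>i<s. (- smult 2 Wp) ^ i) * [:0, 1:] * pderiv (1 + smult 2 Wp)"
  have "B * fps_X * fps_deriv R = fps_of_poly P"
    unfolding P_def B_def R_def W_def
    by (simp only: fps_of_poly_mult fps_of_poly_sum fps_of_poly_power fps_of_poly_uminus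
        fps_of_poly_smult fps_of_poly_pderiv fps_of_poly_add fps_of_poly_fps_X fps_of_poly_1)
      (simp flip: numeral_fps_const)
  then have 3: "2 ^ s dvd coeff P m - (S m + (if m = 0 then 0 else u ^ m))" for m
    using fps_const_dvd_nth[OF 2[unfolded N_def], of m] by (simp add: \<Sigma>_def U_def)
  have "2 ^ s dvd S m + u ^ m" if "m \<ge> Suc (degree P)" for m
  proof -
    have "coeff P m = 0" "m \<noteq> 0"
      using that by (auto simp: coeff_eq_0)
    then show ?thesis
      using 3[of m] dvd_minus_iff[of "2 ^ s" "S m + u ^ m"] by simp
  qed
  then show ?thesis
    by blast
qed

lemma cancel_odd_mod:
  fixes a :: int
  assumes "odd a" "2 ^ s dvd a * b"
  shows "2 ^ s dvd b"
  using assms by (simp add: coprime_dvd_mult_right_iff)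

lemma common_root_mod_power_2:
  assumes L1: "one_unit_root L1" "fps_X * fps_deriv (fps_of_poly L1) = fps_of_poly L1 * Abs_fps S1"
    and L2: "one_unit_root L2" "fps_X * fps_deriv (fps_of_poly L2) = fps_of_poly L2 * Abs_fps S2"
    and k: "k \<ge> 1" and eq: "\<And>j. S1 (1 + j * k) = S2 (1 + j * k)"
  shows "\<exists>v. 2 ^ s dvd poly L1 v \<and> 2 ^ s dvd poly L2 v"
proof (cases "s = 0")
  case False
  then have s: "s \<ge> 1"
    by simp
  \<comment> \<open>A root modulo an even number is odd here by
    \<open>poly_one_unit_root_parity\<close>, hence invertible modulo \<open>2 ^ s\<close>.\<close>
  have inv: "\<exists>v u. 2 ^ s dvd poly L v \<and> 2 ^ s dvd u * v - 1 \<and> odd u" if L: "one_unit_root L" for L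
  proof -
    obtain v where v: "2 ^ s dvd poly L v"
      using ex_root_mod_power_2[OF L] by blast
    have "even (poly L v)"
      using v s by (metis dvd_power dvd_trans not_one_le_zero gr_zeroI)
    then have "odd v"
      using poly_one_unit_root_parity[OF L] by blast
    then have "gcd v (2 ^ s) = 1"
      by (metis coprime_imp_gcd_eq_1 coprime_left_2_iff_odd coprime_commute coprime_power_right_iff)
    then obtain u w where "u * v + w * 2 ^ s = 1"
      using bezout_int[of v "2 ^ s"] by auto
    then have e: "u * v - 1 = 2 ^ s * (- w)"
      by (simp add: algebra_simps)
    then have "even (u * v - 1)"
      using s by (simp del: minus_mult_right)
    then have "odd u"
      by auto
    moreover have "2 ^ s dvd u * v - 1"
      using e by (rule dvdI)
    ultimately show ?thesis
      using v by blast
  qed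
  obtain v1 u1 where 1: "2 ^ s dvd poly L1 v1" "2 ^ s dvd u1 * v1 - 1" "odd u1"
    using inv[OF L1(1)] by blast
  obtain v2 u2 where 2: "2 ^ s dvd poly L2 v2" "2 ^ s dvd u2 * v2 - 1" "odd u2"
    using inv[OF L2(1)] by blast
  obtain M1 where M1: "\<And>m. m \<ge> M1 \<Longrightarrow> 2 ^ s dvd S1 m + u1 ^ m"
    using power_sums_mod_power_2[OF L1 s 1(1,2)] by blast
  obtain M2 where M2: "\<And>m. m \<ge> M2 \<Longrightarrow> 2 ^ s dvd S2 m + u2 ^ m"
    using power_sums_mod_power_2[OF L2 s 2(1,2)] by blast
  have pow: "2 ^ s dvd u1 ^ (1 + j * k) - u2 ^ (1 + j * k)" if "j \<ge> M1 + M2" for j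
  proof -
    have "j * 1 \<le> j * k"
      using k by (intro mult_left_mono) auto
    then have "1 + j * k \<ge> M1" "1 + j * k \<ge> M2"
      using that by linarith+
    then have "2 ^ s dvd (S1 (1 + j * k) + u1 ^ (1 + j * k)) - (S2 (1 + j * k) + u2 ^ (1 + j * k))"
      by (intro dvd_diff M1 M2)
    then show ?thesis
      using eq by simp
  qed
  \<comment> \<open>One large index suffices. Two consecutive members of the progression differ by
    the factor \<open>u ^ k\<close>, so cancelling odd powers gives first
    \<open>u1 ^ k = u2 ^ k\<close> and then \<open>u1 = u2\<close>, both modulo
    \<open>2 ^ s\<close>.\<close>
  define j where "j = M1 + M2"
  have a: "2 ^ s dvd u1 ^ (1 + j * k) - u2 ^ (1 + j * k)"
    and b: "2 ^ s dvd u1 ^ (1 + j * k) * u1 ^ k - u2 ^ (1 + j * k) * u2 ^ k"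
    using pow[of j] pow[of "Suc j"] by (simp_all add: j_def power_add mult_ac)
  have "2 ^ s dvd u1 ^ (1 + j * k) * (u1 ^ k - u2 ^ k)"
  proof -
    have "u1 ^ (1 + j * k) * (u1 ^ k - u2 ^ k) = (u1 ^ (1 + j * k) * u1 ^ k - u2 ^ (1 + j * k) * u2 ^ k)
        - (u1 ^ (1 + j * k) - u2 ^ (1 + j * k)) * u2 ^ k"
      by (simp add: algebra_simps)
    then show ?thesis
      using a b by (metis dvd_diff dvd_mult2)
  qed
  then have uk: "2 ^ s dvd u1 ^ k - u2 ^ k"
    by (rule cancel_odd_mod[rotated]) (use 1(3) in simp)
  have "u1 ^ k - u2 ^ k dvd (u1 ^ k) ^ j - (u2 ^ k) ^ j"
    using diff_dvd_poly_diff[of "u1 ^ k" "u2 ^ k" "monom 1 j"] by (simp add: poly_monom)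
  then have ujk: "2 ^ s dvd u1 ^ (j * k) - u2 ^ (j * k)"
    using uk by (metis dvd_trans mult.commute power_mult)
  have "2 ^ s dvd u1 ^ (j * k) * (u1 - u2)"
  proof -
    have "u1 ^ (j * k) * (u1 - u2) = (u1 ^ (1 + j * k) - u2 ^ (1 + j * k))
        - (u1 ^ (j * k) - u2 ^ (j * k)) * u2"
      by (simp add: algebra_simps)
    then show ?thesis
      using a ujk by (metis dvd_diff dvd_mult2)
  qed
  then have u12: "2 ^ s dvd u1 - u2"
    by (rule cancel_odd_mod[rotated]) (use 1(3) in simp)
  \<comment> \<open>Back from the inverses to the roots: modulo \<open>2 ^ s\<close> the difference
    of the v is \<open>v1 * v2\<close> times that of the u.\<close>
  have "v1 - v2 = v1 * v2 * (u2 - u1) + v2 * (u1 * v1 - 1) - v1 * (u2 * v2 - 1)"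
    by (simp add: algebra_simps)
  moreover have "2 ^ s dvd v1 * v2 * (u2 - u1)"
    using u12 by (metis dvd_diff_commute dvd_mult)
  ultimately have "2 ^ s dvd v1 - v2"
    using 1(2) 2(2) by (metis dvd_add dvd_diff dvd_mult)
  then have "2 ^ s dvd poly L2 v1 - poly L2 v2"
    using diff_dvd_poly_diff dvd_trans by blast
  then have "2 ^ s dvd poly L2 v1"
    using 2(1) by (metis dvd_add diff_add_cancel)
  then show ?thesis
    using 1(1) by blast
qed auto

text \<open>An element h of least degree in the ideal of L1 and L2 is a gcd over the rationals;
  pseudo-division keeps the computation over the integers. If h were constant, evaluation at the
  common roots would make it divisible by every power of 2. So h has positive degree, and primality
  of L1 forces L1 to divide h, hence a constant multiple of L2.\<close>

lemma prime_elem_dvd_if_common_roots: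
  fixes L1 L2 :: "int poly"
  assumes prime: "prime_elem L1" and deg: "degree L1 > 0"
    and root: "\<And>s. \<exists>v. 2 ^ s dvd poly L1 v \<and> 2 ^ s dvd poly L2 v"
  shows "L1 dvd L2"
proof -
  define I where "I = {h. \<exists>A B. h = A * L1 + B * L2}"
  have L1_I: "L1 \<in> I" and L2_I: "L2 \<in> I"
    unfolding I_def by (rule CollectI, rule exI[of _ 1], rule exI[of _ 0], simp)
      (rule CollectI, rule exI[of _ 0], rule exI[of _ 1], simp)
  have L1_nz: "L1 \<noteq> 0"
    using prime by auto
  define h where "h = arg_min degree (\<lambda>h. h \<in> I \<and> h \<noteq> 0)"
  have h: "h \<in> I \<and> h \<noteq> 0"
    unfolding h_def by (rule arg_min_natI[of _ L1]) (use L1_I L1_nz in simp)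
  have h_min: "degree h \<le> degree p" if "p \<in> I" "p \<noteq> 0" for p
    unfolding h_def by (rule arg_min_nat_le) (use that in simp)
  have mult_h: "\<exists>c q. c \<noteq> 0 \<and> smult c p = h * q" if p: "p \<in> I" for p
  proof -
    obtain c q where c: "c \<noteq> 0" "smult c p = h * q + pseudo_mod p h"
      using pseudo_mod(1)[of h p] h by auto
    have "pseudo_mod p h \<in> I"
    proof -
      obtain A B where p': "p = A * L1 + B * L2"
        using p by (auto simp: I_def)
      obtain C E where h': "h = C * L1 + E * L2"
        using h by (auto simp: I_def)
      have "pseudo_mod p h = smult c p - h * q"
        using c by simp
      also have "\<dots> = (smult c A - C * q) * L1 + (smult c B - E * q) * L2"
        unfolding p' by (subst h') (simp add: algebra_simps smult_add_right)
      finally show ?thesis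
        unfolding I_def by blast
    qed
    moreover have "pseudo_mod p h = 0 \<or> degree (pseudo_mod p h) < degree h"
      using pseudo_mod(2)[of h p] h by auto
    ultimately have "pseudo_mod p h = 0"
      using h_min by fastforce
    then show ?thesis
      using c by auto
  qed
  have deg_h: "degree h \<noteq> 0"
  proof
    assume "degree h = 0"
    then obtain c where c: "h = [:c:]"
      by (auto elim: degree_eq_zeroE)
    obtain A B where AB: "h = A * L1 + B * L2"
      using h by (auto simp: I_def)
    have dvd: "2 ^ s dvd c" for s
    proof -
      obtain v where "2 ^ s dvd poly L1 v" "2 ^ s dvd poly L2 v"
        using root by blast
      then have "2 ^ s dvd poly (A * L1 + B * L2) v"
        by simp
      then show ?thesis
        unfolding AB[symmetric] c by simp
    qed
    have "c \<noteq> 0"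
      using h c by auto
    \<comment> \<open>The exponent s = |c| already exceeds what a nonzero c allows.\<close>
    then have "2 ^ nat \<bar>c\<bar> \<le> \<bar>c\<bar>"
      using dvd[of "nat \<bar>c\<bar>"] by (metis dvd_imp_le_int abs_numeral abs_power_minus power_abs)
    moreover have "int (nat \<bar>c\<bar>) < 2 ^ nat \<bar>c\<bar>"
      by (rule of_nat_less_two_power)
    ultimately show False
      by simp
  qed
  obtain c1 q1 where 1: "c1 \<noteq> 0" "smult c1 L1 = h * q1"
    using mult_h[OF L1_I] by blast
  obtain c2 q2 where 2: "c2 \<noteq> 0" "smult c2 L2 = h * q2"
    using mult_h[OF L2_I] by blast
  have no: "\<not> L1 dvd [:c:]" if "c \<noteq> 0" for c
    using dvd_imp_degree_le[of L1 "[:c:]"] that deg by auto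
  have "L1 dvd h * q1"
    using 1(2) by (metis dvd_refl dvd_smult)
  then have "L1 dvd h \<or> L1 dvd q1"
    using prime by (simp add: prime_elem_dvd_mult_iff)
  moreover have "\<not> L1 dvd q1"
  proof
    assume "L1 dvd q1"
    then obtain q where "q1 = L1 * q"
      by (rule dvdE)
    then have "L1 * [:c1:] = L1 * (h * q)"
      using 1(2) by (simp add: mult.left_commute)
    then have "[:c1:] = h * q"
      using L1_nz by (simp del: mult_pCons_right)
    then have "h dvd [:c1:]"
      by (rule dvdI)
    then show False
      using dvd_imp_degree_le[of h "[:c1:]"] 1(1) deg_h by auto
  qed
  ultimately have "L1 dvd h"
    by blast
  then have "L1 dvd smult c2 L2"
    unfolding 2(2) by (rule dvd_mult2)
  moreover have "smult c2 L2 = [:c2:] * L2"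
    by simp
  ultimately have "L1 dvd [:c2:] * L2"
    by (simp only:)
  then have "L1 dvd [:c2:] \<or> L1 dvd L2"
    by (simp only: prime_elem_dvd_mult_iff[OF prime])
  then show ?thesis
    using no[OF 2(1)] by blast
qed

section \<open>The L-polynomials\<close>

text \<open>The list stops at degree n + 1, the last one not covered by
  \<open>chi_sum_eq_0\<close>.\<close>

definition L_sum :: "nat \<Rightarrow> int poly" where
  "L_sum n = Poly (map (chi_sum n) [0..<n + 2])"

lemma coeff_L_sum:
  assumes "odd n"
  shows "coeff (L_sum n) d = chi_sum n d"
proof (cases "d < n + 2")
  case True
  then have "map (chi_sum n) [0..<n + 2] ! d = chi_sum n d"
    by (simp del: upt_Suc)
  then show ?thesis
    using True by (simp add: L_sum_def coeff_Poly_eq nth_default_def del: upt_Suc)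
qed (use chi_sum_eq_0[OF assms, of d] in \<open>simp add: L_sum_def coeff_Poly_eq nth_default_def del: upt_Suc\<close>)

text \<open>The recursion \<open>chi_sum_recursion\<close> in generating-function form. It involves
  only m at least 1, so the constant coefficient on the right is set to 0.\<close>

lemma L_sum_logd:
  assumes "odd n"
  shows "fps_X * fps_deriv (fps_of_poly (L_sum n))
    = fps_of_poly (L_sum n) * Abs_fps (\<lambda>m. if m = 0 then 0 else char_sum n m)"
proof (rule fps_ext)
  fix d
  let ?S = "\<lambda>m. if m = 0 then 0 else char_sum n m"
  have n: "n \<ge> 1"
    using assms by (cases n) auto
  have "fps_nth (fps_of_poly (L_sum n) * Abs_fps ?S) d = fps_nth (Abs_fps ?S * fps_of_poly (L_sum n)) d"
    by (simp only: mult.commute)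
  also have "\<dots> = (\<Sum>m=0..d. ?S m * chi_sum n (d - m))"
    by (simp add: fps_mult_nth coeff_L_sum[OF assms])
  also have "\<dots> = (\<Sum>m=1..d. ?S m * chi_sum n (d - m))"
    by (simp add: sum.atLeast_Suc_atMost)
  also have "\<dots> = (\<Sum>m=1..d. char_sum n m * chi_sum n (d - m))"
    by (rule sum.cong) auto
  also have "\<dots> = int d * chi_sum n d"
    by (rule chi_sum_recursion[OF n, symmetric])
  also have "\<dots> = fps_nth (fps_X * fps_deriv (fps_of_poly (L_sum n))) d"
    by (cases d) (simp_all add: coeff_L_sum[OF assms] del: of_nat_Suc)
  finally show "fps_nth (fps_X * fps_deriv (fps_of_poly (L_sum n))) d
      = fps_nth (fps_of_poly (L_sum n) * Abs_fps ?S) d"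
    by (rule sym)
qed

lemma Mon_1: "Mon 1 = {[:1, 1:]}"
proof -
  have "f = [:1, 1:]" if f: "f \<in> Mon 1" for f
    using Mon_lead_coeff[OF f] f
    by (auto simp: Mon_def poly_eq_iff coeff_pCons coeff_eq_0 split: nat.splits)
  then show ?thesis
    by (auto simp: Mon_def)
qed

lemma one_unit_root_L_sum:
  assumes "odd n"
  shows "one_unit_root (L_sum n)"
proof -
  have "even (coeff (L_sum n - [:1, 1:]) i)" for i
  proof -
    consider "i = 0" | "i = 1" | "i \<ge> 2"
      by linarith
    then show ?thesis
    proof cases
      case 1
      then show ?thesis
        using chi_sum_0 by (simp add: coeff_L_sum[OF assms])
    next
      \<comment> \<open>In degree 1 there is a single polynomial, so the coefficient is 1 or -1, odd
        in either case.\<close>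
      case 2
      then show ?thesis
        using Mon_1 by (simp add: coeff_L_sum[OF assms] chi_sum_def chi_def)
    next
      case 3
      then show ?thesis
        using even_chi_sum[OF 3] by (auto simp: coeff_L_sum[OF assms] coeff_pCons split: nat.splits)
    qed
  qed
  then obtain M where "L_sum n - [:1, 1:] = smult 2 M"
    by (rule ex_half_poly)
  then show ?thesis
    unfolding one_unit_root_def by (metis add.commute diff_eq_eq)
qed

section \<open>The L-polynomial for k = 1\<close>

text \<open>Newton's identity \<open>p_3 = e_1^3 - 3 e_1 e_2 + 3 e_3\<close> read over the field
  with two elements, where \<open>e_1^3 = e_1\<close>.\<close>

lemma logd_nth_3:
  fixes F :: "bit fps"
  assumes "fps_nth F 0 = 1"
  shows "fps_nth (logd F) 3 = fps_nth F 3 + fps_nth F 1 + fps_nth F 1 * fps_nth F 2"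
proof -
  have F: "fps_nth (logd F * F) m = fps_nth (fps_X * fps_deriv F) m" for m
    using logd_mult_self[of F] assms by simp
  have sq: "x * x = x" for x :: bit
    by (cases x) auto
  have 1: "fps_nth (logd F) 1 = fps_nth F 1"
    using F[of 1] assms by (simp add: fps_mult_nth)
  have "fps_nth F 1 * fps_nth F 1 = fps_nth (logd F) 2"
    using F[of 2] assms 1
    by (simp add: fps_mult_nth numeral_2_eq_2 char2_eq_iff)
  then have 2: "fps_nth (logd F) 2 = fps_nth F 1"
    unfolding sq by (rule sym)
  have "fps_nth (logd F) 3 + fps_nth (logd F) 2 * fps_nth F 1 + fps_nth (logd F) 1 * fps_nth F 2
      = fps_nth F 3"
    using F[of 3] assms by (simp add: fps_mult_nth eval_nat_numeral algebra_simps)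
  then show ?thesis
    unfolding 1 2 sq by (metis char2_add_self_left add.commute add.assoc)
qed

lemma tau_3:
  assumes "f \<in> Mon d"
  shows "tau 3 f = coeff (reflect_poly f) 3 + coeff (reflect_poly f) 1
    + coeff (reflect_poly f) 1 * coeff (reflect_poly f) 2 + coeff f 1"
  using assms Mon_lead_coeff[OF assms]
  by (simp add: tau_eq Mon_def logd_nth_3)

lemma poly_eq_coeffs_4:
  assumes "degree f \<le> 4"
  shows "f = [:coeff f 0, coeff f 1, coeff f 2, coeff f 3, coeff f 4:]"
proof (rule poly_eqI)
  fix i :: nat
  consider "i = 0" | "i = 1" | "i = 2" | "i = 3" | "i = 4" | "i > 4"
    by linarith
  then show "coeff f i = coeff [:coeff f 0, coeff f 1, coeff f 2, coeff f 3, coeff f 4:] i"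
    using assms by cases (auto simp: coeff_eq_0 eval_nat_numeral coeff_pCons split: nat.splits)
qed

lemma Mon_2: "Mon 2 = {[:1, 0, 1:], [:1, 1, 1:]}"
  (is "_ = ?R")
proof
  show "Mon 2 \<subseteq> ?R"
  proof
    fix f assume f: "f \<in> Mon 2"
    have mem: "[:1, a, 1:] \<in> ?R" for a
      by (cases a) auto
    have eq: "f = [:1, coeff f 1, 1:]"
      using Mon_lead_coeff[OF f] f poly_eq_coeffs_4[of f] by (simp add: Mon_def coeff_eq_0)
    show "f \<in> ?R"
      using mem[of "coeff f 1"] unfolding eq[symmetric] .
  qed
qed (auto simp: Mon_def)

lemma Mon_3: "Mon 3 = {[:1, 0, 0, 1:], [:1, 0, 1, 1:], [:1, 1, 0, 1:], [:1, 1, 1, 1:]}"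
  (is "_ = ?R")
proof
  show "Mon 3 \<subseteq> ?R"
  proof
    fix f assume f: "f \<in> Mon 3"
    have mem: "[:1, a, b, 1:] \<in> ?R" for a b
      by (cases a; cases b) auto
    have eq: "f = [:1, coeff f 1, coeff f 2, 1:]"
      using Mon_lead_coeff[OF f] f poly_eq_coeffs_4[of f] by (simp add: Mon_def coeff_eq_0)
    show "f \<in> ?R"
      using mem[of "coeff f 1" "coeff f 2"] unfolding eq[symmetric] .
  qed
qed (auto simp: Mon_def)

lemma Mon_4: "Mon 4 = {[:1, 0, 0, 0, 1:], [:1, 0, 0, 1, 1:], [:1, 0, 1, 0, 1:], [:1, 0, 1, 1, 1:],
    [:1, 1, 0, 0, 1:], [:1, 1, 0, 1, 1:], [:1, 1, 1, 0, 1:], [:1, 1, 1, 1, 1:]}"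
  (is "_ = ?R")
proof
  show "Mon 4 \<subseteq> ?R"
  proof
    fix f assume f: "f \<in> Mon 4"
    have mem: "[:1, a, b, c, 1:] \<in> ?R" for a b c
      by (cases a; cases b; cases c) auto
    have eq: "f = [:1, coeff f 1, coeff f 2, coeff f 3, 1:]"
      using Mon_lead_coeff[OF f] f poly_eq_coeffs_4[of f] by (simp add: Mon_def coeff_eq_0)
    show "f \<in> ?R"
      using mem[of "coeff f 1" "coeff f 2" "coeff f 3"] unfolding eq[symmetric] .
  qed
qed (auto simp: Mon_def)

lemma chi_sum_3: "chi_sum 3 1 = 1" "chi_sum 3 2 = 0" "chi_sum 3 3 = 2" "chi_sum 3 4 = 4"
proof -
  have chi: "chi 3 f = (if coeff (reflect_poly f) 3 + coeff (reflect_poly f) 1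
      + coeff (reflect_poly f) 1 * coeff (reflect_poly f) 2 + coeff f 1 = 0 then 1 else -1)"
    if "coeff f 0 = 1" for f
    using tau_3[of f "degree f"] that by (simp add: chi_def Mon_def)
  note nums = coeff_reflect_poly numeral_2_eq_2 numeral_3_eq_3
  have 1: "chi 3 [:1, 1:] = 1"
    by (subst chi) (simp_all add: nums)
  \<comment> \<open>In degrees 2, 3 and 4 the value of \<open>tau\<close> simplifies to b, (1 + b)
    (1 + c) and d (1 + c).\<close>
  have 2: "chi 3 [:1, b, 1:] = (if b = 0 then 1 else -1)" for b
    by (subst chi) (simp_all add: nums)
  have 3: "chi 3 [:1, b, c, 1:] = (if b = 1 \<or> c = 1 then 1 else -1)" for b c
    by (subst chi) (cases b; cases c; simp add: nums)+
  have 4: "chi 3 [:1, b, c, d, 1:] = (if c = 1 \<or> d = 0 then 1 else -1)" for b c d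
    by (subst chi) (cases b; cases c; cases d; simp add: nums)+
  show "chi_sum 3 1 = 1" "chi_sum 3 2 = 0" "chi_sum 3 3 = 2" "chi_sum 3 4 = 4"
    unfolding chi_sum_def Mon_1 Mon_2 Mon_3 Mon_4
    by (simp_all add: 1 2 3 4)
qed

lemma L_sum_3: "L_sum 3 = [:1, 1, 0, 2, 4:]"
  using chi_sum_3 chi_sum_0[of 3] by (simp add: L_sum_def eval_nat_numeral upt_rec)

section \<open>Irreducibility of the L-polynomial for k = 1\<close>

lemma int_factors_4:
  assumes "a * b = (4 :: int)"
  shows "(a, b) \<in> {(1, 4), (2, 2), (4, 1), (-1, -4), (-2, -2), (-4, -1)}"
proof -
  have "\<bar>a\<bar> \<le> 4"
    using assms dvd_imp_le_int[of 4 a] by (metis abs_numeral dvd_triv_left zero_neq_numeral)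
  then have "a = -4 \<or> a = -3 \<or> a = -2 \<or> a = -1 \<or> a = 0 \<or> a = 1 \<or> a = 2 \<or> a = 3 \<or> a = 4"
    by arith
  then show ?thesis
    using assms by (elim disjE; simp; presburger)
qed

text \<open>The assumptions compare the coefficients of a product of a linear and a cubic polynomial
  with 1, 1, 0, 2, 4.\<close>

lemma no_linear_factor_L1:
  fixes p0 p1 q0 q1 q2 q3 :: int
  assumes "p0 * q0 = 1" "p0 * q1 + p1 * q0 = 1" "p0 * q2 + p1 * q1 = 0" "p0 * q3 + p1 * q2 = 2"
    "p1 * q3 = 4"
  shows False
proof -
  have "p0 = 1 \<and> q0 = 1 \<or> p0 = - 1 \<and> q0 = - 1"
    using assms(1) by (simp add: zmult_eq_1_iff)
  then show False
    using int_factors_4[OF assms(5)] assms(2-4) by auto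
qed

text \<open>With \<open>p0 = q0 = 1\<close> or \<open>p0 = q0 = -1\<close>, the sum p1 + q1 is 1 or
  -1, so p1 q1 is even. As p2 q2 = 4, the sum p2 + q2 is 4 or 5 up to sign, and so is p1 q1. Parity
  excludes 5, and two integers with product 4 or -4 never have sum 1 or -1.\<close>

lemma no_quadratic_factor_L1:
  fixes p0 p1 p2 q0 q1 q2 :: int
  assumes "p0 * q0 = 1" "p0 * q1 + p1 * q0 = 1" "p0 * q2 + p1 * q1 + p2 * q0 = 0"
    "p1 * q2 + p2 * q1 = 2" "p2 * q2 = 4"
  shows False
proof -
  have no: "x * y \<noteq> 4" if "x + y = 1 \<or> x + y = - 1 \<or> x - y = 1 \<or> y - x = 1" for x y :: int
    using int_factors_4[of x y] that by auto
  have s: "p0 = 1 \<and> q0 = 1 \<or> p0 = - 1 \<and> q0 = - 1"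
    using assms(1) by (simp add: zmult_eq_1_iff)
  then have "odd (p1 + q1)"
    using assms(2) by (metis add.commute add_uminus_conv_diff even_minus mult_1 mult_minus1 mult_minus1_right mult_cancel_left1 odd_one minus_add_distrib mult.commute)
  then have "even (p1 * q1)"
    by auto
  then have "p1 * q1 \<noteq> 5" "5 + p1 * q1 \<noteq> 0"
    by (metis odd_numeral, metis even_add even_zero odd_numeral)
  then show False
    using int_factors_4[OF assms(5)] assms(2-4) no[of p1 q1] no[of p1 "- q1"] s by auto
qed

lemma irreducible_L1: "irreducible ([:1, 1, 0, 2, 4:] :: int poly)"
proof (rule irreducibleI)
  have unit: "p dvd 1 \<or> q dvd 1"
    if eq: "p * q = [:1, 1, 0, 2, 4:]" and deg: "degree p \<le> degree q" for p q :: "int poly"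
  proof -
    have nz: "p \<noteq> 0" "q \<noteq> 0"
      using eq by auto
    have "degree p + degree q = degree (p * q)"
      using nz by (simp add: degree_mult_eq)
    then have d4: "degree p + degree q = 4"
      unfolding eq by simp
    have d: "degree p \<le> 4" "degree q \<le> 4"
      using d4 by auto
    have p: "p = [:coeff p 0, coeff p 1, coeff p 2, coeff p 3, coeff p 4:]"
      by (rule poly_eq_coeffs_4[OF d(1)])
    have q: "q = [:coeff q 0, coeff q 1, coeff q 2, coeff q 3, coeff q 4:]"
      by (rule poly_eq_coeffs_4[OF d(2)])
    consider "degree p = 0" | "degree p = 1" "degree q = 3" | "degree p = 2" "degree q = 2"
      using d4 deg by linarith
    then show ?thesis
    proof cases
      case 1
      then obtain c where c: "p = [:c:]"
        by (rule degree_eq_zeroE)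
      \<comment> \<open>Over the integers a constant factor must be a unit; it is one because it
        divides the constant term 1.\<close>
      have "coeff (p * q) 0 = 1"
        unfolding eq by simp
      then have "c * coeff q 0 = 1"
        unfolding c by simp
      then have "c dvd 1"
        by (metis dvdI)
      then show ?thesis
        unfolding c by (simp add: is_unit_const_poly_iff)
    next
      case 2
      then have "coeff p 2 = 0" "coeff p 3 = 0" "coeff p 4 = 0" "coeff q 4 = 0"
        by (simp_all add: coeff_eq_0)
      then have p': "p = [:coeff p 0, coeff p 1:]"
        and q': "q = [:coeff q 0, coeff q 1, coeff q 2, coeff q 3:]"
        using p q by simp_all
      have "[:coeff p 0, coeff p 1:] * [:coeff q 0, coeff q 1, coeff q 2, coeff q 3:] = [:1, 1, 0, 2, 4:]"
        using eq p' q' by metis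
      then show ?thesis
        using no_linear_factor_L1[of "coeff p 0" "coeff q 0" "coeff q 1" "coeff p 1" "coeff q 2"
            "coeff q 3"]
        by (simp add: algebra_simps)
    next
      case 3
      then have "coeff p 3 = 0" "coeff p 4 = 0" "coeff q 3 = 0" "coeff q 4 = 0"
        by (simp_all add: coeff_eq_0)
      then have p': "p = [:coeff p 0, coeff p 1, coeff p 2:]"
        and q': "q = [:coeff q 0, coeff q 1, coeff q 2:]"
        using p q by simp_all
      have "[:coeff p 0, coeff p 1, coeff p 2:] * [:coeff q 0, coeff q 1, coeff q 2:] = [:1, 1, 0, 2, 4:]"
        using eq p' q' by metis
      then show ?thesis
        using no_quadratic_factor_L1[of "coeff p 0" "coeff q 0" "coeff q 1" "coeff p 1" "coeff q 2"
            "coeff p 2"]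
        by (simp add: algebra_simps)
    qed
  qed
  fix p q :: "int poly"
  assume eq: "[:1, 1, 0, 2, 4:] = p * q"
  show "p dvd 1 \<or> q dvd 1"
  proof (cases "degree p \<le> degree q")
    case False
    then show ?thesis
      using unit[of q p] eq by (auto simp: mult.commute)
  qed (use unit[of p q] eq in auto)
qed (auto simp: is_unit_poly_iff)

lemma L_sum_3_dvd:
  assumes "odd n" "k \<ge> 1" and eq: "\<And>j. char_sum 3 (1 + j * k) = char_sum n (1 + j * k)"
  shows "L_sum 3 dvd L_sum n"
proof (rule prime_elem_dvd_if_common_roots)
  show "prime_elem (L_sum 3)"
    unfolding L_sum_3 by (rule irreducible_imp_prime_elem) (rule irreducible_L1)
  show "degree (L_sum 3) > 0"
    by (simp add: L_sum_3)
  show "\<exists>v. 2 ^ s dvd poly (L_sum 3) v \<and> 2 ^ s dvd poly (L_sum n) v" for s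
    by (rule common_root_mod_power_2[OF one_unit_root_L_sum L_sum_logd one_unit_root_L_sum L_sum_logd assms(2)])
      (use assms(1) eq in auto)
qed

section \<open>Zeta functions\<close>

text \<open>The quotient of the two series has derivative 0 and is therefore constant, by
  characteristic 0.\<close>

lemma logd_inject:
  fixes F H :: "'a :: field_char_0 fps"
  assumes "fps_nth F 0 = 1" "fps_nth H 0 = 1"
    and F: "fps_X * fps_deriv F = F * S" and H: "fps_X * fps_deriv H = H * S"
  shows "F = H"
proof -
  have nz: "fps_nth H 0 \<noteq> 0"
    using assms by simp
  have "fps_X * fps_deriv (F * inverse H)
      = (fps_X * fps_deriv F) * inverse H - F * (fps_X * fps_deriv H) * (inverse H)\<^sup>2"
    by (simp add: fps_inverse_deriv[OF nz] algebra_simps)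
  also have "\<dots> = F * S * inverse H - F * S * inverse H * (H * inverse H)"
    unfolding F H by (simp add: power2_eq_square algebra_simps)
  also have "H * inverse H = 1"
    using nz by (rule inverse_mult_eq_1')
  finally have "fps_deriv (F * inverse H) = 0"
    by simp
  then have "F * inverse H = fps_const (fps_nth (F * inverse H) 0)"
    by (simp only: fps_deriv_eq_0_iff)
  then have "F * inverse H = 1"
    using assms by simp
  then have "F * (inverse H * H) = H"
    by (simp flip: mult.assoc)
  then show ?thesis
    using nz by (simp add: inverse_mult_eq_1)
qed

text \<open>The logarithmic derivative of \<open>zeta k\<close> is the generating series of the
  point counts. Its parts 1 and \<open>2 ^ n\<close> cancel against the denominator E, and S is the
  part belonging to L. Since E is invertible, L is the only polynomial meeting the description in
  \<open>L_poly\<close>.\<close>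

lemma L_poly_eqI:
  assumes "coeff L 0 = 1"
    and logd: "fps_X * fps_deriv (fps_of_poly L) = fps_of_poly L * Abs_fps S" and "S 0 = 0"
    and points: "\<And>n. n \<ge> 1 \<Longrightarrow> int (num_points k n) = 2 ^ n + 1 + S n"
  shows "L_poly k = L"
proof -
  let ?Q = "\<lambda>L :: int poly. fps_of_poly (map_poly rat_of_int L)"
  define P where "P = Abs_fps (\<lambda>n. if n = 0 then 0 else of_nat (num_points k n) / rat_of_nat n)"
  define E where "E = (1 - fps_X) * (1 - 2 * fps_X :: rat fps)"
  define \<Sigma> where "\<Sigma> = Abs_fps (\<lambda>n. rat_of_int (S n))"
  have Z: "zeta k = fps_exp 1 oo P"
    by (simp add: zeta_def P_def)
  have P0: "fps_nth P 0 = 0"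
    by (simp add: P_def)
  have Z': "fps_deriv (zeta k) = zeta k * fps_deriv P"
    unfolding Z fps_compose_deriv[OF P0] by simp
  have Z0: "fps_nth (zeta k) 0 = 1"
    unfolding Z by (simp add: fps_compose_nth)
  have E0: "fps_nth E 0 = 1"
    by (simp add: E_def)
  define A where "A = Abs_fps (\<lambda>n. if n = 0 then 0 else 1 :: rat)"
  define B where "B = Abs_fps (\<lambda>n. if n = 0 then 0 else 2 ^ n :: rat)"
  have P': "fps_X * fps_deriv P = A + B + \<Sigma>"
  proof (rule fps_ext)
    fix n
    show "fps_nth (fps_X * fps_deriv P) n = fps_nth (A + B + \<Sigma>) n"
    proof (cases n)
      case (Suc m)
      have "rat_of_nat (num_points k n) = rat_of_int (int (num_points k n))"
        by simp
      also have "\<dots> = 2 ^ n + 1 + rat_of_int (S n)"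
        using points[of n] Suc by simp
      finally show ?thesis
        using Suc by (simp add: P_def A_def B_def \<Sigma>_def del: of_nat_Suc)
    qed (simp add: A_def B_def \<Sigma>_def assms)
  qed
  have A: "(1 - fps_X) * A = fps_X"
  proof (rule fps_ext)
    fix n
    show "fps_nth ((1 - fps_X) * A) n = fps_nth fps_X n"
      by (cases n) (auto simp: A_def left_diff_distrib)
  qed
  have B: "(1 - 2 * fps_X) * B = 2 * fps_X"
  proof (rule fps_ext)
    fix n
    show "fps_nth ((1 - 2 * fps_X) * B) n = fps_nth (2 * fps_X) n"
      by (cases n) (auto simp: B_def left_diff_distrib mult.assoc numeral_fps_const)
  qed
  have E': "fps_deriv E = - (1 - 2 * fps_X) - 2 * (1 - fps_X)"
    by (simp add: E_def)
  have "E * (A + B) = ((1 - fps_X) * A) * (1 - 2 * fps_X) + ((1 - 2 * fps_X) * B) * (1 - fps_X)"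
    by (simp add: E_def algebra_simps)
  \<comment> \<open>A + B is minus the logarithmic derivative of E.\<close>
  then have EAB: "E * (A + B) + fps_X * fps_deriv E = 0"
    unfolding A B E' by (simp add: algebra_simps)
  have "fps_X * fps_deriv (zeta k * E) = zeta k * (E * (fps_X * fps_deriv P) + fps_X * fps_deriv E)"
    by (simp add: Z' algebra_simps)
  also have "\<dots> = zeta k * ((E * (A + B) + fps_X * fps_deriv E) + E * \<Sigma>)"
    unfolding P' by (simp add: algebra_simps)
  finally have ZE: "fps_X * fps_deriv (zeta k * E) = (zeta k * E) * \<Sigma>"
    unfolding EAB by simp
  have QL: "?Q L * \<Sigma> = fps_X * fps_deriv (?Q L)"
  proof (rule fps_ext)
    fix n
    have "fps_nth (?Q L * \<Sigma>) n = rat_of_int (fps_nth (fps_of_poly L * Abs_fps S) n)"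
      by (simp add: fps_mult_nth \<Sigma>_def coeff_map_poly)
    also have "\<dots> = rat_of_int (fps_nth (fps_X * fps_deriv (fps_of_poly L)) n)"
      by (simp only: logd)
    also have "\<dots> = fps_nth (fps_X * fps_deriv (?Q L)) n"
      by (simp add: coeff_map_poly)
    finally show "fps_nth (?Q L * \<Sigma>) n = fps_nth (fps_X * fps_deriv (?Q L)) n" .
  qed
  have ZL: "zeta k * E = ?Q L"
    by (rule logd_inject[OF _ _ ZE QL[symmetric]]) (simp_all add: Z0 E0 coeff_map_poly assms(1))
  have iff: "zeta k = ?Q M / ((1 - fps_X) * (1 - 2 * fps_X)) \<longleftrightarrow> M = L" for M
  proof -
    have inv: "E * inverse E = 1"
      by (rule inverse_mult_eq_1') (simp add: E0)
    have "zeta k = ?Q M / E \<longleftrightarrow> zeta k = ?Q M * inverse E"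
      using E0 by (simp add: fps_divide_unit)
    also have "\<dots> \<longleftrightarrow> zeta k * E = ?Q M"
    proof
      assume "zeta k = ?Q M * inverse E"
      then show "zeta k * E = ?Q M"
        using inv by (simp add: mult.assoc mult.commute[of _ E])
    next
      assume "zeta k * E = ?Q M"
      then have "?Q M * inverse E = zeta k * (E * inverse E)"
        by (simp add: mult.assoc)
      then show "zeta k = ?Q M * inverse E"
        using inv by simp
    qed
    also have "\<dots> \<longleftrightarrow> M = L"
      unfolding ZL by (auto simp: fps_of_poly_eq_iff poly_eq_iff coeff_map_poly)
    finally show ?thesis
      unfolding E_def .
  qed
  show ?thesis
    unfolding L_poly_def iff by simp
qed

section \<open>Rings and homomorphisms inside a field\<close>

abbreviation "RT \<equiv> ring_of_type_algebra"

lemma RT_sel [simp]: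
  "carrier RT = UNIV" "x \<otimes>\<^bsub>RT\<^esub> y = x * y" "\<one>\<^bsub>RT\<^esub> = 1" "\<zero>\<^bsub>RT\<^esub> = 0" "x \<oplus>\<^bsub>RT\<^esub> y = x + y"
  by (simp_all add: ring_of_type_algebra_def)

lemma RT_a_inv [simp]: "\<ominus>\<^bsub>RT\<^esub> x = - (x :: 'a :: comm_ring_1)"
proof -
  interpret ring "RT :: 'a ring"
    by (rule ring_from_type_algebra)
  show ?thesis
    using r_neg[of x] by (simp add: eq_neg_iff_add_eq_0 add.commute)
qed

lemma RT_m_inv [simp]: "x \<noteq> 0 \<Longrightarrow> inv\<^bsub>RT\<^esub> x = inverse (x :: 'a :: field)"
proof -
  assume x: "x \<noteq> 0"
  interpret field "RT :: 'a ring"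
    by (rule field_from_type_algebra)
  show ?thesis
    by (rule comm_inv_char) (use x in auto)
qed

lemma subring_RT_iff:
  fixes A :: "'a :: field set"
  shows "subring A RT \<longleftrightarrow> 1 \<in> A \<and> (\<forall>a\<in>A. - a \<in> A) \<and> (\<forall>a\<in>A. \<forall>b\<in>A. a + b \<in> A \<and> a * b \<in> A)"
proof -
  interpret field "RT :: 'a ring"
    by (rule field_from_type_algebra)
  show ?thesis
  proof
    assume "subring A RT"
    then show "1 \<in> A \<and> (\<forall>a\<in>A. - a \<in> A) \<and> (\<forall>a\<in>A. \<forall>b\<in>A. a + b \<in> A \<and> a * b \<in> A)"
      using subringE[of A RT] by auto
  next
    assume "1 \<in> A \<and> (\<forall>a\<in>A. - a \<in> A) \<and> (\<forall>a\<in>A. \<forall>b\<in>A. a + b \<in> A \<and> a * b \<in> A)"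
    then show "subring A RT"
      by (intro subringI) auto
  qed
qed

lemma ring_hom_RT_iff:
  "\<phi> \<in> ring_hom (RT\<lparr>carrier := A\<rparr>) (RT\<lparr>carrier := B\<rparr>) \<longleftrightarrow>
    (\<forall>a\<in>A. \<phi> a \<in> B) \<and> \<phi> 1 = 1 \<and> (\<forall>a\<in>A. \<forall>b\<in>A. \<phi> (a + b) = \<phi> a + \<phi> b \<and> \<phi> (a * b) = \<phi> a * \<phi> b)"
  by (auto simp: ring_hom_def Pi_iff)

lemma rational_points_iff:
  fixes A F :: "'f :: field set" and \<phi> :: "'f \<Rightarrow> 'c :: field"
  shows "(A, \<phi>) \<in> rational_points F B \<longleftrightarrow>
    1 \<in> A \<and> (\<forall>a\<in>A. - a \<in> A) \<and> (\<forall>a\<in>A. \<forall>b\<in>A. a + b \<in> A \<and> a * b \<in> A) \<and>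
    A \<subset> F \<and> (\<forall>f\<in>F. f \<in> A \<or> inverse f \<in> A) \<and>
    (\<forall>a\<in>A. \<phi> a \<in> B) \<and> \<phi> 1 = 1 \<and>
    (\<forall>a\<in>A. \<forall>b\<in>A. \<phi> (a + b) = \<phi> a + \<phi> b \<and> \<phi> (a * b) = \<phi> a * \<phi> b) \<and>
    \<phi> \<in> extensional A \<and> (\<forall>f\<in>A. \<phi> f = 0 \<longleftrightarrow> f = 0 \<or> inverse f \<notin> A)"
  unfolding rational_points_def valuation_rings_def subring_RT_iff ring_hom_RT_iff nonunits_def
  by (auto simp: set_eq_iff)

lemma rational_point_zero:
  assumes "(A, \<phi>) \<in> rational_points F B"
  shows "0 \<in> A" "\<phi> 0 = 0"
proof -
  have "1 + - 1 \<in> A"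
    using assms unfolding rational_points_iff by blast
  then show "0 \<in> A"
    by simp
  then show "\<phi> 0 = 0"
    using assms by (simp add: rational_points_iff)
qed

section \<open>Regular points\<close>

lemma inverse_cancel: "f \<noteq> 0 \<Longrightarrow> inverse f * (f * x) = (x :: 'a :: field)"
  by (simp flip: mult.assoc)

text \<open>Here \<open>R\<close> is a coordinate ring, \<open>e\<close> the evaluation at a point and \<open>p\<close> a local parameter there;
  the assumption \<open>rep\<close> says that the local ring at the point is a discrete valuation ring.\<close>

lemma unique_rational_point:
  fixes F R :: "'f :: field set" and e :: "'f \<Rightarrow> 'c :: field"
  assumes R: "R \<subseteq> F" "1 \<in> R" "\<And>a. a \<in> R \<Longrightarrow> - a \<in> R" "\<And>a b. a \<in> R \<Longrightarrow> b \<in> R \<Longrightarrow> a + b \<in> R"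
      "\<And>a b. a \<in> R \<Longrightarrow> b \<in> R \<Longrightarrow> a * b \<in> R"
    and e: "e 1 = 1" "\<And>a b. a \<in> R \<Longrightarrow> b \<in> R \<Longrightarrow> e (a + b) = e a + e b"
      "\<And>a b. a \<in> R \<Longrightarrow> b \<in> R \<Longrightarrow> e (a * b) = e a * e b"
    and F: "\<And>a. a \<in> F \<Longrightarrow> inverse a \<in> F" "\<And>a. a \<in> F \<Longrightarrow> - a \<in> F"
      "\<And>a b. a \<in> F \<Longrightarrow> b \<in> F \<Longrightarrow> a + b \<in> F" "\<And>a b. a \<in> F \<Longrightarrow> b \<in> F \<Longrightarrow> a * b \<in> F"
    and B: "\<And>a. a \<in> R \<Longrightarrow> e a \<in> B" "\<And>a. a \<in> B \<Longrightarrow> inverse a \<in> B"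
      "\<And>a b. a \<in> B \<Longrightarrow> b \<in> B \<Longrightarrow> a * b \<in> B"
    and p: "p \<in> R" "p \<noteq> 0" "e p = 0"
    and rep: "\<And>f. f \<in> F \<Longrightarrow> f \<noteq> 0 \<Longrightarrow>
      \<exists>i. \<exists>r\<in>R. \<exists>s\<in>R. e r \<noteq> 0 \<and> e s \<noteq> 0 \<and> (f * s = p ^ i * r \<or> f * s * p ^ i = r)"
  shows "\<exists>!(A, \<phi>). (A, \<phi>) \<in> rational_points F B \<and> R \<subseteq> A \<and> (\<forall>r\<in>R. \<phi> r = e r)"
proof -
  have R0: "0 \<in> R"
    using R(2) R(3)[OF R(2)] R(4) by (metis add.right_inverse)
  have e0: "e 0 = 0"
    using e(2)[OF R0 R0] by (metis add_0_right add_left_cancel)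
  have pow: "p ^ i \<in> R" for i
    by (induction i) (auto simp: R p)
  \<comment> \<open>The localisation of R at the kernel of e, written without inverses of elements
    of R.\<close>
  define A where "A = {f \<in> F. \<exists>r\<in>R. \<exists>s\<in>R. e s \<noteq> 0 \<and> f * s = r}"
  have AI: "f \<in> A" if "f \<in> F" "r \<in> R" "s \<in> R" "e s \<noteq> 0" "f * s = r" for f r s
    using that unfolding A_def by blast
  define \<phi> where "\<phi> = restrict (\<lambda>f. THE c. \<exists>r\<in>R. \<exists>s\<in>R. e s \<noteq> 0 \<and> f * s = r \<and> c = e r / e s) A"
  have \<phi>_eq: "\<phi> f = e r / e s" if "f \<in> F" "r \<in> R" "s \<in> R" "e s \<noteq> 0" "f * s = r" for f r s
  proof -
    have fA: "f \<in> A"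
      using that by (rule AI)
    have "(THE c. \<exists>r\<in>R. \<exists>s\<in>R. e s \<noteq> 0 \<and> f * s = r \<and> c = e r / e s) = e r / e s"
    proof (rule the_equality)
      show "\<exists>r'\<in>R. \<exists>s'\<in>R. e s' \<noteq> 0 \<and> f * s' = r' \<and> e r / e s = e r' / e s'"
        using that by blast
      fix c assume "\<exists>r\<in>R. \<exists>s\<in>R. e s \<noteq> 0 \<and> f * s = r \<and> c = e r / e s"
      then obtain r' s' where *: "r' \<in> R" "s' \<in> R" "e s' \<noteq> 0" "f * s' = r'" "c = e r' / e s'"
        by blast
      have "r * s' = r' * s"
        using that(5) *(4) by (simp flip: that(5) *(4))
      then have "e r * e s' = e r' * e s"
        using e(3)[of r s'] e(3)[of r' s] that * by simp
      then show "c = e r / e s"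
        unfolding *(5) using that(4) *(3) by (simp add: frac_eq_eq)
    qed
    then show ?thesis
      using fA by (simp add: \<phi>_def)
  qed
  have AE: thesis if "f \<in> A" "\<And>r s. f \<in> F \<Longrightarrow> r \<in> R \<Longrightarrow> s \<in> R \<Longrightarrow> e s \<noteq> 0 \<Longrightarrow> f * s = r \<Longrightarrow> \<phi> f = e r / e s \<Longrightarrow> thesis"
    for f thesis
    using that(1) that(2) \<phi>_eq unfolding A_def by blast
  have RA: "r \<in> A" "\<phi> r = e r" if "r \<in> R" for r
  proof -
    have rF: "r \<in> F"
      using R(1) that by blast
    show "r \<in> A" "\<phi> r = e r"
      using AI[OF rF that R(2)] \<phi>_eq[OF rF that R(2)] e(1) by simp_all
  qed
  have add: "f + g \<in> A \<and> \<phi> (f + g) = \<phi> f + \<phi> g" if f: "f \<in> A" and g: "g \<in> A" for f g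
    using f
  proof (rule AE)
    fix r s assume 1: "f \<in> F" "r \<in> R" "s \<in> R" "e s \<noteq> 0" "f * s = r" "\<phi> f = e r / e s"
    show ?thesis
      using g
    proof (rule AE)
      fix r' s' assume 2: "g \<in> F" "r' \<in> R" "s' \<in> R" "e s' \<noteq> 0" "g * s' = r'" "\<phi> g = e r' / e s'"
      have ss: "e (s * s') = e s * e s'"
        by (rule e(3)[OF 1(3) 2(3)])
      have rr: "e (r * s' + r' * s) = e r * e s' + e r' * e s"
        using e(2)[OF R(5)[OF 1(2) 2(3)] R(5)[OF 2(2) 1(3)]] e(3)[OF 1(2) 2(3)] e(3)[OF 2(2) 1(3)]
        by simp
      have "(f + g) * (s * s') = (f * s) * s' + (g * s') * s"
        by (simp add: algebra_simps)
      then have eq: "(f + g) * (s * s') = r * s' + r' * s"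
        unfolding 1(5) 2(5) .
      have nz: "e (s * s') \<noteq> 0"
        using ss 1(4) 2(4) by simp
      note * = F(3)[OF 1(1) 2(1)] R(4)[OF R(5)[OF 1(2) 2(3)] R(5)[OF 2(2) 1(3)]] R(5)[OF 1(3) 2(3)]
        nz eq
      show ?thesis
        using AI[OF *] \<phi>_eq[OF *] 1(4,6) 2(4,6) unfolding ss rr by (simp add: add_frac_eq)
    qed
  qed
  have mult: "f * g \<in> A \<and> \<phi> (f * g) = \<phi> f * \<phi> g" if f: "f \<in> A" and g: "g \<in> A" for f g
    using f
  proof (rule AE)
    fix r s assume 1: "f \<in> F" "r \<in> R" "s \<in> R" "e s \<noteq> 0" "f * s = r" "\<phi> f = e r / e s"
    show ?thesis
      using g
    proof (rule AE)
      fix r' s' assume 2: "g \<in> F" "r' \<in> R" "s' \<in> R" "e s' \<noteq> 0" "g * s' = r'" "\<phi> g = e r' / e s'"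
      have ss: "e (s * s') = e s * e s'"
        by (rule e(3)[OF 1(3) 2(3)])
      have "(f * g) * (s * s') = (f * s) * (g * s')"
        by (simp add: algebra_simps)
      then have eq: "(f * g) * (s * s') = r * r'"
        unfolding 1(5) 2(5) .
      have nz: "e (s * s') \<noteq> 0"
        using ss 1(4) 2(4) by simp
      note * = F(4)[OF 1(1) 2(1)] R(5)[OF 1(2) 2(2)] R(5)[OF 1(3) 2(3)] nz eq
      show ?thesis
        using AI[OF *] \<phi>_eq[OF *] 1(6) 2(6) e(3)[OF 1(2) 2(2)] unfolding ss by simp
    qed
  qed
  have uminus: "- f \<in> A" if "f \<in> A" for f
    using mult[OF RA(1)[OF R(3)[OF R(2)]] that] by simp
  have valB: "\<phi> f \<in> B" if "f \<in> A" for f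
    using that by (rule AE) (simp add: B divide_inverse)
  have sub: "A \<subset> F"
  proof
    show "A \<subseteq> F"
      by (auto simp: A_def)
    \<comment> \<open>The parameter has value 0, so its inverse is a pole; this makes A a proper
      subring.\<close>
    have "inverse p \<notin> A"
    proof
      assume "inverse p \<in> A"
      then show False
      proof (rule AE)
        fix r s assume r: "r \<in> R" and "e s \<noteq> 0" "inverse p * s = r"
        then have "s = p * r"
          using inverse_cancel[of "inverse p" s] p(2) by simp
        then show False
          using \<open>e s \<noteq> 0\<close> e(3)[OF p(1) r] p(3) by simp
      qed
    qed
    moreover have "inverse p \<in> F"
      by (rule F(1)[OF subsetD[OF R(1) p(1)]])
    ultimately show "A \<noteq> F"
      by blast
  qed
  have val: "f \<in> A \<or> inverse f \<in> A" if f: "f \<in> F" for f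
  proof (cases "f = 0")
    case True
    then show ?thesis
      using RA(1)[OF R0] by simp
  next
    case False
    obtain i r s where *: "r \<in> R" "s \<in> R" "e r \<noteq> 0" "e s \<noteq> 0"
        "f * s = p ^ i * r \<or> f * s * p ^ i = r"
      using rep[OF f False] by blast
    show ?thesis
      using *(5)
    proof
      assume "f * s = p ^ i * r"
      then show ?thesis
        using AI[OF f _ *(2,4)] R(5)[OF pow *(1)] by blast
    next
      assume "f * s * p ^ i = r"
      then have "inverse f * r = s * p ^ i"
        using inverse_cancel[OF False, of "s * p ^ i"] by (simp add: mult.assoc)
      then show ?thesis
        using AI[OF F(1)[OF f] R(5)[OF *(2) pow] *(1,3)] by blast
    qed
  qed
  have ker: "\<phi> f = 0 \<longleftrightarrow> f = 0 \<or> inverse f \<notin> A" if f: "f \<in> A" for f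
  proof
    assume 0: "\<phi> f = 0"
    show "f = 0 \<or> inverse f \<notin> A"
    proof (rule ccontr)
      assume *: "\<not> (f = 0 \<or> inverse f \<notin> A)"
      then have "\<phi> (f * inverse f) = 0"
        using mult[OF f, of "inverse f"] 0 by simp
      then show False
        using * RA(2)[OF R(2)] e by simp
    qed
  next
    assume *: "f = 0 \<or> inverse f \<notin> A"
    show "\<phi> f = 0"
      using f
    proof (rule AE)
      fix r s assume 1: "f \<in> F" "r \<in> R" "s \<in> R" "e s \<noteq> 0" "f * s = r" "\<phi> f = e r / e s"
      show "\<phi> f = 0"
      proof (rule ccontr)
        assume "\<phi> f \<noteq> 0"
        then have "e r \<noteq> 0"
          using 1 by simp
        moreover from this have "f \<noteq> 0"
          using 1 e0 by auto
        moreover from this have "inverse f * r = s"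
          using inverse_cancel[of f s] 1(5) by simp
        ultimately show False
          using AI[OF F(1)[OF 1(1)] 1(3,2)] * by blast
      qed
    qed
  qed
  have ext: "\<phi> \<in> extensional A"
    by (simp add: \<phi>_def)
  have one: "\<phi> 1 = 1"
    using RA(2)[OF R(2)] e(1) by simp
  have point: "(A, \<phi>) \<in> rational_points F B"
    unfolding rational_points_iff
    by (intro conjI ballI RA(1)[OF R(2)] one uminus sub val valB ker ext
        conjunct1[OF add] conjunct1[OF mult] conjunct2[OF add] conjunct2[OF mult])
  show ?thesis
  proof (rule ex1I[of _ "(A, \<phi>)"])
    show "case (A, \<phi>) of (A, \<phi>) \<Rightarrow> (A, \<phi>) \<in> rational_points F B \<and> R \<subseteq> A \<and> (\<forall>r\<in>R. \<phi> r = e r)"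
      using point RA by auto
    fix x assume x: "case x of (A, \<phi>) \<Rightarrow> (A, \<phi>) \<in> rational_points F B \<and> R \<subseteq> A \<and> (\<forall>r\<in>R. \<phi> r = e r)"
    obtain A' \<psi> where x': "x = (A', \<psi>)"
      by (cases x)
    then have P: "(A', \<psi>) \<in> rational_points F B" and RA': "\<And>r. r \<in> R \<Longrightarrow> r \<in> A'"
        "\<And>r. r \<in> R \<Longrightarrow> \<psi> r = e r"
      using x by auto
    have mult': "a * b \<in> A' \<and> \<psi> (a * b) = \<psi> a * \<psi> b" if "a \<in> A'" "b \<in> A'" for a b
      using P that unfolding rational_points_iff by blast
    have ker': "\<psi> f = 0 \<longleftrightarrow> f = 0 \<or> inverse f \<notin> A'" if "f \<in> A'" for f
      using P that unfolding rational_points_iff by blast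
    have one': "\<psi> 1 = 1"
      using P unfolding rational_points_iff by blast
    \<comment> \<open>Elements of R with nonzero value lie outside the maximal ideal of A', so they
      are units there and the whole localisation embeds.\<close>
    have sub': "f \<in> A' \<and> \<psi> f = \<phi> f" if f: "f \<in> A" for f
      using f
    proof (rule AE)
      fix r s assume 1: "f \<in> F" "r \<in> R" "s \<in> R" "e s \<noteq> 0" "f * s = r" "\<phi> f = e r / e s"
      have s: "s \<in> A'" "\<psi> s \<noteq> 0"
        using RA'(1)[OF 1(3)] RA'(2)[OF 1(3)] 1(4) by auto
      then have s': "s \<noteq> 0" "inverse s \<in> A'"
        using ker'[OF s(1)] by auto
      have "f = r * inverse s"
        using 1(5) inverse_cancel[OF s'(1), of f] by (simp add: mult.commute)
      then have fA': "f \<in> A'"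
        using mult' RA'(1)[OF 1(2)] s'(2) by blast
      have "\<psi> f * \<psi> s = \<psi> r"
        using mult'[OF fA' s(1)] 1(5) by simp
      then have "\<psi> f = e r / e s"
        using RA'(2)[OF 1(2)] RA'(2)[OF 1(3)] 1(4) by (simp add: eq_divide_eq)
      then show ?thesis
        using fA' 1(6) by simp
    qed
    \<comment> \<open>An element of A' outside A would have its inverse in A with value 0, and then
      1 would have value 0 as well.\<close>
    have "A' \<subseteq> A"
    proof
      fix f assume f: "f \<in> A'"
      then have fF: "f \<in> F"
        using P unfolding rational_points_iff by blast
      show "f \<in> A"
      proof (rule ccontr)
        assume nf: "f \<notin> A"
        then have inv: "inverse f \<in> A"
          using val[OF fF] by blast
        have "f \<noteq> 0"
          using nf RA(1)[OF R0] by auto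
        have "\<phi> (inverse f) = 0"
          using ker[OF inv] nf by simp
        then have "\<psi> (f * inverse f) = 0"
          using sub'[OF inv] mult'[OF f] by simp
        then show False
          using one' \<open>f \<noteq> 0\<close> by simp
      qed
    qed
    then have A': "A' = A"
      using sub' by blast
    have "\<psi> \<in> extensional A'"
      using P unfolding rational_points_iff by blast
    then have "\<psi> = \<phi>"
      by (intro extensionalityI[of _ A]) (use A' sub' ext in auto)
    then show "x = (A, \<phi>)"
      using x' A' by simp
  qed
qed

section \<open>The affine curves \<open>z\<^sup>2 + \<alpha>(t) z = \<beta>(t)\<close>\<close>

text \<open>Both charts of \<open>D k\<close> have this shape, with t = x and t = 1 / x. The
  conditions \<open>ramified\<close> make the equation for z Eisenstein at t = 0: this gives
  irreducibility and also regularity at the origin. The pair (a, b) is a point of the chart with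
  coordinates in a second field.\<close>

locale affine_model =
  fixes t z :: "'f :: {char2_ring, field}" and \<alpha> \<beta> :: "bit poly" and a b :: "'c :: {char2_ring, field}"
  assumes eq: "z ^ 2 + ev \<alpha> t * z = ev \<beta> t"
    and point: "b ^ 2 + ev \<alpha> a * b = ev \<beta> a"
    and transcendental: "ev P t = 0 \<Longrightarrow> P = 0"
    and ramified: "coeff \<alpha> 0 = 0" "coeff \<beta> 0 = 0" "coeff \<beta> 1 = 1"
begin

definition el :: "bit poly \<Rightarrow> bit poly \<Rightarrow> 'f" where
  "el P Q = ev P t + ev Q t * z"

definition pt :: "bit poly \<Rightarrow> bit poly \<Rightarrow> 'c" where
  "pt P Q = ev P a + ev Q a * b"

lemma z_square: "z * z = ev \<beta> t + ev \<alpha> t * z"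
proof -
  have "z * z + ev \<alpha> t * z + ev \<alpha> t * z = ev \<beta> t + ev \<alpha> t * z"
    using eq by (simp add: power2_eq_square)
  then show ?thesis
    by (simp add: add.assoc)
qed

lemma b_square: "b * b = ev \<beta> a + ev \<alpha> a * b"
proof -
  have "b * b + ev \<alpha> a * b + ev \<alpha> a * b = ev \<beta> a + ev \<alpha> a * b"
    using point by (simp add: power2_eq_square)
  then show ?thesis
    by (simp add: add.assoc)
qed

lemma el_add: "el P Q + el P' Q' = el (P + P') (Q + Q')"
  by (simp add: el_def algebra_simps)

lemma pt_add: "pt P Q + pt P' Q' = pt (P + P') (Q + Q')"
  by (simp add: pt_def algebra_simps)

lemma el_mult: "el P Q * el P' Q' = el (P * P' + Q * Q' * \<beta>) (P * Q' + Q * P' + Q * Q' * \<alpha>)"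
proof -
  have "el P Q * el P' Q' = ev P t * ev P' t + (ev P t * ev Q' t + ev Q t * ev P' t) * z
      + ev Q t * ev Q' t * (z * z)"
    by (simp add: el_def algebra_simps)
  then show ?thesis
    unfolding z_square by (simp add: el_def algebra_simps)
qed

lemma pt_mult: "pt P Q * pt P' Q' = pt (P * P' + Q * Q' * \<beta>) (P * Q' + Q * P' + Q * Q' * \<alpha>)"
proof -
  have "pt P Q * pt P' Q' = ev P a * ev P' a + (ev P a * ev Q' a + ev Q a * ev P' a) * b
      + ev Q a * ev Q' a * (b * b)"
    by (simp add: pt_def algebra_simps)
  then show ?thesis
    unfolding b_square by (simp add: pt_def algebra_simps)
qed

text \<open>The norm of \<open>el P Q\<close> in the quadratic extension, where conjugation sends z
  to z + \<alpha>(t).\<close>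

definition nrm :: "bit poly \<Rightarrow> bit poly \<Rightarrow> bit poly" where
  "nrm P Q = P ^ 2 + P * Q * \<alpha> + Q ^ 2 * \<beta>"

lemma el_mult_conj: "el P Q * el (P + Q * \<alpha>) Q = ev (nrm P Q) t"
  unfolding el_mult by (simp add: el_def nrm_def algebra_simps power2_eq_square)

text \<open>Infinite descent: both components of a zero of the norm form are divisible by \<open>X\<close>.\<close>

lemma nrm_eq_0:
  assumes "nrm P Q = 0"
  shows "P = 0 \<and> Q = 0"
  using assms
proof (induction "degree P + degree Q" arbitrary: P Q rule: less_induct)
  case less
  obtain \<alpha>' where \<alpha>': "\<alpha> = [:0, 1:] * \<alpha>'"
    using ramified(1) by (metis X_dvd_iff dvdE)
  obtain \<beta>' where \<beta>': "\<beta> = [:0, 1:] * \<beta>'"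
    using ramified(2) by (metis X_dvd_iff dvdE)
  have "coeff \<beta>' 0 = 1"
    using ramified(3) by (simp add: \<beta>')
  have "coeff (nrm P Q) 0 = coeff P 0 ^ 2"
    using ramified by (simp add: nrm_def coeff_mult_0 power2_eq_square)
  then have "coeff P 0 = 0"
    using less.prems by simp
  then obtain P' where P': "P = [:0, 1:] * P'"
    by (metis X_dvd_iff dvdE)
  have "nrm P Q = [:0, 1:] * ([:0, 1:] * (P' ^ 2 + P' * Q * \<alpha>') + Q ^ 2 * \<beta>')"
    unfolding nrm_def unfolding P' \<alpha>' \<beta>' by (simp only: power2_eq_square algebra_simps)
  then have 0: "[:0, 1:] * (P' ^ 2 + P' * Q * \<alpha>') + Q ^ 2 * \<beta>' = 0"
    using less.prems by (simp del: mult_pCons_left)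
  then have "coeff ([:0, 1:] * (P' ^ 2 + P' * Q * \<alpha>') + Q ^ 2 * \<beta>') 0 = 0"
    by simp
  then have "coeff Q 0 = 0"
    using \<open>coeff \<beta>' 0 = 1\<close> by (simp add: coeff_mult_0 power2_eq_square)
  then obtain Q' where Q': "Q = [:0, 1:] * Q'"
    by (metis X_dvd_iff dvdE)
  have "nrm P Q = [:0, 1:] ^ 2 * nrm P' Q'"
    unfolding nrm_def unfolding P' Q' by (simp only: power2_eq_square algebra_simps)
  then have nrm': "nrm P' Q' = 0"
    using less.prems by (simp del: mult_pCons_left)
  show ?case
  proof (rule ccontr)
    assume "\<not> (P = 0 \<and> Q = 0)"
    then have "P' \<noteq> 0 \<or> Q' \<noteq> 0"
      using P' Q' by auto
    then have "degree P' + degree Q' < degree P + degree Q"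
      unfolding P' Q' by (cases "P' = 0"; cases "Q' = 0") auto
    then show False
      using less.hyps nrm' \<open>P' \<noteq> 0 \<or> Q' \<noteq> 0\<close> by blast
  qed
qed

lemma el_eq_0_iff [simp]: "el P Q = 0 \<longleftrightarrow> P = 0 \<and> Q = 0"
proof
  assume "el P Q = 0"
  then have "ev (nrm P Q) t = 0"
    using el_mult_conj[of P Q] by simp
  then show "P = 0 \<and> Q = 0"
    using transcendental nrm_eq_0 by blast
qed (simp add: el_def)

lemma el_inject: "el P Q = el P' Q' \<longleftrightarrow> P = P' \<and> Q = Q'"
proof
  assume "el P Q = el P' Q'"
  then have "el (P + P') (Q + Q') = 0"
    by (simp flip: el_add)
  then show "P = P' \<and> Q = Q'"
    by (simp add: char2_eq_iff)
qed simp

section \<open>Coordinate ring, evaluation at the point, and function field\<close>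

definition Rng :: "'f set" where
  "Rng = {el P Q |P Q. True}"

text \<open>Well defined because 1 and z are linearly independent over the polynomials in t, by
  \<open>el_inject\<close>.\<close>

definition eva :: "'f \<Rightarrow> 'c" where
  "eva r = (THE c. \<exists>P Q. r = el P Q \<and> c = pt P Q)"

lemma eva_el [simp]: "eva (el P Q) = pt P Q"
  unfolding eva_def by (rule the_equality) (auto simp: el_inject)

lemma el_Rng [simp, intro]: "el P Q \<in> Rng"
  by (auto simp: Rng_def)

text \<open>Denominators in t alone are enough: multiplying by the conjugate turns the inverse of
  \<open>el P Q\<close> into such a fraction.\<close>

definition Fld :: "'f set" where
  "Fld = {r / ev S t |r S. r \<in> Rng \<and> S \<noteq> 0}"

lemma FldI: "r \<in> Rng \<Longrightarrow> S \<noteq> 0 \<Longrightarrow> f = r / ev S t \<Longrightarrow> f \<in> Fld"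
  unfolding Fld_def by blast

lemma FldE:
  assumes "f \<in> Fld"
  obtains P Q S where "S \<noteq> 0" "f = el P Q / ev S t"
  using assms unfolding Fld_def Rng_def by blast

lemma ev_eq_el: "ev P t = el P 0"
  by (simp add: el_def)

lemma Rng_add: "r \<in> Rng \<Longrightarrow> s \<in> Rng \<Longrightarrow> r + s \<in> Rng"
  unfolding Rng_def using el_add by blast

lemma Rng_mult: "r \<in> Rng \<Longrightarrow> s \<in> Rng \<Longrightarrow> r * s \<in> Rng"
  unfolding Rng_def using el_mult by blast

lemma one_eq: "1 = el 1 0"
  by (simp add: el_def)

lemma Rng_1: "1 \<in> Rng"
  by (simp add: one_eq)

lemma ev_t_nz: "S \<noteq> 0 \<Longrightarrow> ev S t \<noteq> 0"
  using transcendental by blast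

lemma Fld_add: "f \<in> Fld \<Longrightarrow> g \<in> Fld \<Longrightarrow> f + g \<in> Fld"
proof (elim FldE)
  fix P Q S P' Q' S' assume "S \<noteq> 0" "f = el P Q / ev S t" "S' \<noteq> 0" "g = el P' Q' / ev S' t"
  then have "f + g = (el P Q * ev S' t + el P' Q' * ev S t) / ev (S * S') t"
    using ev_t_nz by (simp add: add_frac_eq)
  then show "f + g \<in> Fld"
    by (rule FldI[rotated 2]) (use \<open>S \<noteq> 0\<close> \<open>S' \<noteq> 0\<close> in \<open>auto simp: ev_eq_el intro!: Rng_add Rng_mult\<close>)
qed

lemma Fld_mult: "f \<in> Fld \<Longrightarrow> g \<in> Fld \<Longrightarrow> f * g \<in> Fld"
proof (elim FldE)
  fix P Q S P' Q' S' assume "S \<noteq> 0" "f = el P Q / ev S t" "S' \<noteq> 0" "g = el P' Q' / ev S' t"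
  then have "f * g = (el P Q * el P' Q') / ev (S * S') t"
    by simp
  then show "f * g \<in> Fld"
    by (rule FldI[rotated 2]) (use \<open>S \<noteq> 0\<close> \<open>S' \<noteq> 0\<close> in \<open>auto intro!: Rng_mult\<close>)
qed

lemma Rng_Fld: "r \<in> Rng \<Longrightarrow> r \<in> Fld"
  by (rule FldI[of r 1]) auto

lemma Fld_inverse: "f \<in> Fld \<Longrightarrow> inverse f \<in> Fld"
proof (elim FldE)
  fix P Q S assume S: "S \<noteq> 0" "f = el P Q / ev S t"
  show "inverse f \<in> Fld"
  proof (cases "el P Q = 0")
    case True
    then have "inverse f = 0"
      unfolding S(2) by (simp only: True div_0 inverse_zero)
    also have "0 = el 0 0"
      by (simp add: el_def)
    finally show ?thesis
      by (simp only: Rng_Fld el_Rng)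
  next
    case False
    then have PQ: "\<not> (P = 0 \<and> Q = 0)"
      by (simp only: el_eq_0_iff not_False_eq_True)
    then have n: "nrm P Q \<noteq> 0"
      using nrm_eq_0[of P Q] by (rule contrapos_nn)
    have c: "el (P + Q * \<alpha>) Q \<noteq> 0"
    proof
      assume "el (P + Q * \<alpha>) Q = 0"
      then have "P + Q * \<alpha> = 0" "Q = 0"
        unfolding el_eq_0_iff by blast+
      then show False
        using PQ by simp
    qed
    have "inverse f = ev S t / el P Q"
      unfolding S(2) by (rule inverse_divide)
    also have "\<dots> = (ev S t * el (P + Q * \<alpha>) Q) / (el P Q * el (P + Q * \<alpha>) Q)"
      by (rule mult_divide_mult_cancel_right[OF c, symmetric])
    finally have "inverse f = (ev S t * el (P + Q * \<alpha>) Q) / ev (nrm P Q) t"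
      unfolding el_mult_conj .
    then show ?thesis
      by (rule FldI[rotated 2]) (use n in \<open>auto simp: ev_eq_el intro!: Rng_mult\<close>)
  qed
qed

lemma t_el: "t = el [:0, 1:] 0"
  by (simp add: el_def)

lemma z_el: "z = el 0 1"
  by (simp add: el_def)

lemma Fld_eq_generate_field:
  assumes "H \<subseteq> Fld" "t \<in> generate_field RT H" "z \<in> generate_field RT H"
  shows "generate_field RT H = Fld"
proof
  let ?G = "generate_field RT H"
  show "?G \<subseteq> Fld"
  proof
    fix h assume "h \<in> ?G"
    then show "h \<in> Fld"
    proof induction
      case (m_inv h)
      then show ?case
        using Fld_inverse by simp
    qed (use assms(1) Fld_add Fld_mult Rng_Fld[OF Rng_1] in auto)
  qed
  have 1: "1 \<in> ?G"
    using generate_field.one[of RT H] by simp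
  have add: "x + y \<in> ?G" if "x \<in> ?G" "y \<in> ?G" for x y
    using generate_field.eng_add[OF that] by simp
  have mult: "x * y \<in> ?G" if "x \<in> ?G" "y \<in> ?G" for x y
    using generate_field.eng_mult[OF that] by simp
  have inv: "inverse x \<in> ?G" if "x \<in> ?G" "x \<noteq> 0" for x
    using generate_field.m_inv[OF that(1)] that(2) by simp
  have emb: "emb c \<in> ?G" for c
    using add[OF 1 1] 1 by (cases c) auto
  have ev: "ev P t \<in> ?G" for P
    by (induction P) (use emb[of 0] emb add mult assms(2) in auto)
  show "Fld \<subseteq> ?G"
  proof
    fix f assume "f \<in> Fld"
    then show "f \<in> ?G"
    proof (rule FldE)
      fix P Q S assume "S \<noteq> 0" "f = el P Q / ev S t"
      then have "f = (ev P t + ev Q t * z) * inverse (ev S t)"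
        by (simp add: el_def divide_inverse)
      moreover have "\<dots> \<in> ?G"
        using \<open>S \<noteq> 0\<close> ev_t_nz by (intro mult add ev inv assms(3)) auto
      ultimately show "f \<in> ?G"
        by simp
    qed
  qed
qed

lemma t_Rng: "t \<in> Rng" and z_Rng: "z \<in> Rng"
  using el_Rng[of "[:0, 1:]" 0] el_Rng[of 0 1] by (simp_all only: t_el[symmetric] z_el[symmetric])

lemma eva_t: "eva t = a" and eva_z: "eva z = b"
  using eva_el[of "[:0, 1:]" 0] eva_el[of 0 1]
  by (simp_all only: t_el[symmetric] z_el[symmetric]) (simp_all add: pt_def)

text \<open>Every nonzero function of the coordinate ring is a power of p times a unit of the local
  ring, the unit being written as r / s with neither vanishing at the point.\<close>

definition uniformizer :: "'f \<Rightarrow> bool" where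
  "uniformizer p \<longleftrightarrow> p \<in> Rng \<and> p \<noteq> 0 \<and> eva p = 0 \<and>
    (\<forall>f\<in>Rng. f \<noteq> 0 \<longrightarrow> (\<exists>i. \<exists>r\<in>Rng. \<exists>s\<in>Rng. eva r \<noteq> 0 \<and> eva s \<noteq> 0 \<and> f * s = p ^ i * r))"

lemma eva_add: "r \<in> Rng \<Longrightarrow> s \<in> Rng \<Longrightarrow> eva (r + s) = eva r + eva s"
  by (auto simp: Rng_def el_add pt_add)

lemma eva_mult: "r \<in> Rng \<Longrightarrow> s \<in> Rng \<Longrightarrow> eva (r * s) = eva r * eva s"
  by (auto simp: Rng_def el_mult pt_mult)

lemma eva_1: "eva 1 = 1"
  by (simp add: one_eq pt_def)

text \<open>Numerator and denominator have orders i and j. Exponents are natural numbers, so the two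
  alternatives are the two signs of i - j.\<close>

lemma uniformizer_field:
  assumes p: "uniformizer p" and f: "f \<in> Fld" "f \<noteq> 0"
  shows "\<exists>i. \<exists>r\<in>Rng. \<exists>s\<in>Rng. eva r \<noteq> 0 \<and> eva s \<noteq> 0 \<and> (f * s = p ^ i * r \<or> f * s * p ^ i = r)"
proof -
  obtain P Q S where S: "S \<noteq> 0" "f = el P Q / ev S t"
    using f(1) by (rule FldE)
  have dvs: "el P Q \<noteq> 0" "ev S t \<noteq> 0"
    using S f(2) ev_t_nz by auto
  obtain i r s where 1: "r \<in> Rng" "s \<in> Rng" "eva r \<noteq> 0" "eva s \<noteq> 0" "el P Q * s = p ^ i * r"
    using p dvs(1) el_Rng[of P Q] unfolding uniformizer_def by blast
  have "ev S t \<in> Rng"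
    by (simp add: ev_eq_el)
  then obtain j r' s' where 2: "r' \<in> Rng" "s' \<in> Rng" "eva r' \<noteq> 0" "eva s' \<noteq> 0"
      "ev S t * s' = p ^ j * r'"
    using p dvs(2) unfolding uniformizer_def by blast
  have pnz: "p \<noteq> 0"
    using p by (simp add: uniformizer_def)
  have "f * (s * r') * p ^ j = f * s * (ev S t * s')"
    unfolding 2(5) by (simp add: ac_simps)
  also have "\<dots> = (el P Q * s) * s'"
    using S dvs by simp
  also have "\<dots> = p ^ i * (r * s')"
    unfolding 1(5) by (simp add: ac_simps)
  finally have main: "f * (s * r') * p ^ j = p ^ i * (r * s')" .
  have "f * (s * r') = p ^ (i - j) * (r * s') \<or> f * (s * r') * p ^ (j - i) = r * s'"
  proof (cases "i \<ge> j")
    case True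
    then have "p ^ i = p ^ (i - j) * p ^ j"
      by (simp flip: power_add)
    then have "f * (s * r') * p ^ j = p ^ (i - j) * (r * s') * p ^ j"
      using main by (simp add: ac_simps)
    then show ?thesis
      using pnz by simp
  next
    case False
    then have "p ^ j = p ^ (j - i) * p ^ i"
      by (simp flip: power_add)
    then have "f * (s * r') * p ^ (j - i) * p ^ i = r * s' * p ^ i"
      using main by (simp add: ac_simps)
    then show ?thesis
      using pnz by simp
  qed
  moreover have "p ^ (j - i) = 1" if "i \<ge> j"
    using that by simp
  ultimately obtain e where "f * (s * r') = p ^ e * (r * s') \<or> f * (s * r') * p ^ e = r * s'"
    by blast
  moreover have "eva (r * s') \<noteq> 0" "eva (s * r') \<noteq> 0"
    using 1 2 by (simp_all add: eva_mult)
  ultimately show ?thesis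
    using Rng_mult[OF 1(1) 2(2)] Rng_mult[OF 1(2) 2(1)] by blast
qed

text \<open>The functions t and z generate the coordinate ring over the prime field, so the values
  at these two determine a point.\<close>

lemma unique_point:
  assumes p: "uniformizer p"
    and B: "a \<in> B" "b \<in> B" "0 \<in> B" "1 \<in> B" "\<And>x. x \<in> B \<Longrightarrow> inverse x \<in> B"
      "\<And>x y. x \<in> B \<Longrightarrow> y \<in> B \<Longrightarrow> x + y \<in> B" "\<And>x y. x \<in> B \<Longrightarrow> y \<in> B \<Longrightarrow> x * y \<in> B"
  shows "\<exists>!(A, \<phi>). (A, \<phi>) \<in> rational_points Fld B \<and> t \<in> A \<and> z \<in> A \<and> \<phi> t = a \<and> \<phi> z = b"
proof -
  have emb: "emb c \<in> B" for c
    using B by (cases c) auto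
  have evB: "ev P a \<in> B" for P
    by (induction P) (use B emb in auto)
  have sub: "Rng \<subseteq> Fld"
    using Rng_Fld by (rule subsetI)
  have evaB: "eva r \<in> B" if "r \<in> Rng" for r
  proof -
    obtain P Q where r: "r = el P Q"
      using \<open>r \<in> Rng\<close> unfolding Rng_def by blast
    show ?thesis
      unfolding r eva_el pt_def by (intro B(2,6,7) evB)
  qed
  have p': "p \<in> Rng" "p \<noteq> 0" "eva p = 0"
    using p unfolding uniformizer_def by blast+
  have neg: "- r \<in> Rng" if "r \<in> Rng" for r
    using that by (simp only: char2_uminus)
  have neg': "- r \<in> Fld" if "r \<in> Fld" for r
    using that by (simp only: char2_uminus)
  have *: "\<exists>!(A, \<phi>). (A, \<phi>) \<in> rational_points Fld B \<and> Rng \<subseteq> A \<and> (\<forall>r\<in>Rng. \<phi> r = eva r)"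
    by (rule unique_rational_point[where R = Rng and F = Fld and e = eva and B = B and p = p];
        (rule sub Rng_1 neg Rng_add Rng_mult eva_1 eva_add eva_mult Fld_inverse neg' Fld_add Fld_mult
          evaB B(5) B(7) p' uniformizer_field[OF p])?; assumption?)
  have "Rng \<subseteq> A \<and> (\<forall>r\<in>Rng. \<phi> r = eva r) \<longleftrightarrow> t \<in> A \<and> z \<in> A \<and> \<phi> t = a \<and> \<phi> z = b"
    if rp: "(A, \<phi>) \<in> rational_points Fld B" for A \<phi>
  proof
    assume "Rng \<subseteq> A \<and> (\<forall>r\<in>Rng. \<phi> r = eva r)"
    moreover have "t \<in> Rng" "z \<in> Rng" "eva t = a" "eva z = b"
      using t_Rng z_Rng eva_t eva_z .
    ultimately show "t \<in> A \<and> z \<in> A \<and> \<phi> t = a \<and> \<phi> z = b"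
      by auto
  next
    assume tz: "t \<in> A \<and> z \<in> A \<and> \<phi> t = a \<and> \<phi> z = b"
    have hom: "x + y \<in> A" "x * y \<in> A" "\<phi> (x + y) = \<phi> x + \<phi> y" "\<phi> (x * y) = \<phi> x * \<phi> y"
      if "x \<in> A" "y \<in> A" for x y
      using rp that unfolding rational_points_iff by blast+
    have one: "1 \<in> A" "\<phi> 1 = 1"
      using rp unfolding rational_points_iff by blast+
    note zero = rational_point_zero[OF rp]
    have emb: "emb c \<in> A" "\<phi> (emb c) = emb c" for c
      using zero one by (cases c; simp)+
    have ev: "ev P t \<in> A \<and> \<phi> (ev P t) = ev P a" for P
      by (induction P) (use zero emb tz in \<open>auto simp: hom\<close>)
    then have "el P Q \<in> A \<and> \<phi> (el P Q) = pt P Q" for P Q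
      using tz by (simp add: el_def pt_def hom)
    then show "Rng \<subseteq> A \<and> (\<forall>r\<in>Rng. \<phi> r = eva r)"
      by (auto simp: Rng_def)
  qed
  then have "(\<lambda>(A, \<phi>). (A, \<phi>) \<in> rational_points Fld B \<and> Rng \<subseteq> A \<and> (\<forall>r\<in>Rng. \<phi> r = eva r))
      = (\<lambda>(A, \<phi>). (A, \<phi>) \<in> rational_points Fld B \<and> t \<in> A \<and> z \<in> A \<and> \<phi> t = a \<and> \<phi> z = b)"
    by (auto simp: fun_eq_iff)
  then show ?thesis
    using * by (simp only:)
qed

end

section \<open>Local parameters at unramified and at ramified points\<close>

context affine_model
begin

lemma Rng_cases:
  assumes "f \<in> Rng"
  obtains P Q where "f = el P Q"
  using assms unfolding Rng_def by blast

lemma poly_pow_decomp: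
  assumes \<pi>: "\<And>P. ev P a = 0 \<longleftrightarrow> \<pi> dvd P" and "N \<noteq> 0"
  shows "\<exists>i N'. N = \<pi> ^ i * N' \<and> ev N' a \<noteq> 0"
  using assms(2)
proof (induction "degree N" arbitrary: N rule: less_induct)
  case less
  show ?case
  proof (cases "ev N a = 0")
    case True
    then obtain M where M: "N = \<pi> * M"
      using \<pi> by (auto elim: dvdE)
    have "degree \<pi> \<noteq> 0"
    proof
      assume "degree \<pi> = 0"
      then have "\<pi> dvd 1"
        using M less.prems by (auto simp: is_unit_iff_degree)
      then show False
        using \<pi>[of 1] by simp
    qed
    moreover have "M \<noteq> 0" "\<pi> \<noteq> 0"
      using M less.prems by auto
    ultimately have "degree M < degree N"
      unfolding M by (simp add: degree_mult_eq)
    then obtain i N' where "M = \<pi> ^ i * N'" "ev N' a \<noteq> 0"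
      using less.hyps \<open>M \<noteq> 0\<close> by blast
    then have "N = \<pi> ^ Suc i * N' \<and> ev N' a \<noteq> 0"
      using M by (simp add: mult.assoc)
    then show ?thesis
      by blast
  next
    case False
    then have "N = \<pi> ^ 0 * N \<and> ev N a \<noteq> 0"
      by simp
    then show ?thesis
      by blast
  qed
qed

text \<open>Here \<pi> is the minimal polynomial of a. The conjugate point has second coordinate b +
  \<alpha>(a), different from b. If \<open>el P Q\<close> vanishes at the point but \<pi> does not
  divide both P and Q, its conjugate does not vanish, so the order can be read off from the
  norm.\<close>

lemma uniformizer_unramified:
  assumes \<pi>: "\<And>P. ev P a = 0 \<longleftrightarrow> \<pi> dvd P" and nz: "\<pi> \<noteq> 0" and \<alpha>: "ev \<alpha> a \<noteq> 0"
  shows "uniformizer (ev \<pi> t)"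
proof -
  have deg: "degree \<pi> \<noteq> 0"
  proof
    assume "degree \<pi> = 0"
    then have "\<pi> dvd 1"
      using nz by (auto simp: is_unit_iff_degree)
    then show False
      using \<pi>[of 1] by simp
  qed
  have "\<exists>i. \<exists>r\<in>Rng. \<exists>s\<in>Rng. eva r \<noteq> 0 \<and> eva s \<noteq> 0 \<and> el P Q * s = ev \<pi> t ^ i * r"
    if "\<not> (P = 0 \<and> Q = 0)" for P Q
    using that
  proof (induction "degree P + degree Q" arbitrary: P Q rule: less_induct)
    case less
    consider "\<pi> dvd P \<and> \<pi> dvd Q" | "pt P Q \<noteq> 0" | "\<not> (\<pi> dvd P \<and> \<pi> dvd Q)" "pt P Q = 0"
      by blast
    then show ?case
    proof cases
      case 1
      then obtain P' Q' where PQ: "P = \<pi> * P'" "Q = \<pi> * Q'"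
        by (auto elim!: dvdE)
      have ne: "\<not> (P' = 0 \<and> Q' = 0)"
        using less.prems PQ by auto
      then have "degree P' + degree Q' < degree P + degree Q"
        unfolding PQ using nz deg by (cases "P' = 0"; cases "Q' = 0") (auto simp: degree_mult_eq)
      then obtain i r s where *: "r \<in> Rng" "s \<in> Rng" "eva r \<noteq> 0" "eva s \<noteq> 0"
          "el P' Q' * s = ev \<pi> t ^ i * r"
        using less.hyps[OF _ ne] by blast
      have "el P Q * s = ev \<pi> t * (el P' Q' * s)"
        unfolding PQ el_def by (simp add: algebra_simps)
      also have "\<dots> = ev \<pi> t ^ Suc i * r"
        unfolding *(5) by (simp add: mult.assoc)
      finally show ?thesis
        using *(1-4) by blast
    next
      case 2
      have "el P Q * 1 = ev \<pi> t ^ 0 * el P Q"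
        by simp
      moreover have "eva (el P Q) \<noteq> 0"
        using 2 by simp
      moreover have "eva 1 \<noteq> 0"
        by (simp add: eva_1)
      ultimately show ?thesis
        using el_Rng[of P Q] Rng_1 by blast
    next
      case 3
      have "ev Q a \<noteq> 0"
      proof
        assume "ev Q a = 0"
        then have "ev P a = 0"
          using 3(2) by (simp add: pt_def)
        then show False
          using 3(1) \<open>ev Q a = 0\<close> \<pi> by blast
      qed
      have "pt (P + Q * \<alpha>) Q = pt P Q + ev Q a * ev \<alpha> a"
        by (simp add: pt_def algebra_simps)
      then have c: "eva (el (P + Q * \<alpha>) Q) \<noteq> 0"
        using 3(2) \<alpha> \<open>ev Q a \<noteq> 0\<close> by simp
      obtain i N' where N: "nrm P Q = \<pi> ^ i * N'" "ev N' a \<noteq> 0"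
        using poly_pow_decomp[OF \<pi>, of "nrm P Q"] nrm_eq_0[of P Q] less.prems by blast
      have "el P Q * el (P + Q * \<alpha>) Q = ev \<pi> t ^ i * el N' 0"
        unfolding el_mult_conj N by (simp add: el_def)
      moreover have "eva (el N' 0) \<noteq> 0"
        using N by (simp add: pt_def)
      ultimately show ?thesis
        using c el_Rng by blast
    qed
  qed
  moreover have "ev \<pi> t \<noteq> 0"
    using nz transcendental by blast
  moreover have "eva (ev \<pi> t) = 0"
    unfolding ev_eq_el eva_el using \<pi>[of \<pi>] by (simp add: pt_def)
  moreover have "ev \<pi> t \<in> Rng"
    unfolding ev_eq_el by (rule el_Rng)
  ultimately show ?thesis
    unfolding uniformizer_def by (auto elim!: Rng_cases)
qed

text \<open>The equation reads t \<eta> = z^2 with \<eta> = \<beta>/t + (\<alpha>/t) z of value 1 at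
  the origin, so t has order 2 with respect to z. Common factors t are split off; what remains has
  order 0 if P is nonzero at 0 and order 1 otherwise.\<close>

lemma uniformizer_ramified:
  assumes a: "a = 0" and b: "b = 0"
  shows "uniformizer z"
proof -
  obtain \<alpha>' where \<alpha>': "\<alpha> = [:0, 1:] * \<alpha>'"
    using ramified(1) by (metis X_dvd_iff dvdE)
  obtain \<beta>' where \<beta>': "\<beta> = [:0, 1:] * \<beta>'"
    using ramified(2) by (metis X_dvd_iff dvdE)
  have \<beta>'0: "coeff \<beta>' 0 = 1"
    using ramified(3) by (simp add: \<beta>')
  have pt0: "pt P Q = emb (coeff P 0)" for P Q
    unfolding pt_def unfolding a b by (simp add: ev_at_0)
  define \<eta> where "\<eta> = el \<beta>' \<alpha>'"
  have t\<eta>: "t * \<eta> = z * z"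
    unfolding \<eta>_def z_square el_def by (simp add: \<alpha>' \<beta>' algebra_simps)
  have \<eta>: "\<eta> \<in> Rng" "eva \<eta> = 1"
    using \<beta>'0 by (simp_all add: \<eta>_def pt0)
  have "\<exists>i. \<exists>r\<in>Rng. \<exists>s\<in>Rng. eva r \<noteq> 0 \<and> eva s \<noteq> 0 \<and> el P Q * s = z ^ i * r"
    if "\<not> (P = 0 \<and> Q = 0)" for P Q
    using that
  proof (induction "degree P + degree Q" arbitrary: P Q rule: less_induct)
    case less
    consider "coeff P 0 = 1" | "coeff P 0 = 0" "coeff Q 0 = 0" | "coeff P 0 = 0" "coeff Q 0 = 1"
      using bit_not_zero_iff by blast
    then show ?case
    proof cases
      case 1
      have "el P Q * 1 = z ^ 0 * el P Q"
        by simp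
      moreover have "eva (el P Q) \<noteq> 0"
        using 1 by (simp add: pt0)
      moreover have "eva 1 \<noteq> 0"
        by (simp add: eva_1)
      ultimately show ?thesis
        using el_Rng[of P Q] Rng_1 by blast
    next
      case 2
      then obtain P' Q' where PQ: "P = [:0, 1:] * P'" "Q = [:0, 1:] * Q'"
        by (metis X_dvd_iff dvdE)
      have ne: "\<not> (P' = 0 \<and> Q' = 0)"
        using less.prems PQ by auto
      then have "degree P' + degree Q' < degree P + degree Q"
        unfolding PQ by (cases "P' = 0"; cases "Q' = 0") auto
      then obtain i r s where *: "r \<in> Rng" "s \<in> Rng" "eva r \<noteq> 0" "eva s \<noteq> 0"
          "el P' Q' * s = z ^ i * r"
        using less.hyps[OF _ ne] by blast
      have "el P Q * (s * \<eta>) = (t * \<eta>) * (el P' Q' * s)"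
        unfolding PQ el_def by (simp add: algebra_simps)
      also have "\<dots> = z ^ (i + 2) * r"
        unfolding t\<eta> *(5) by (simp add: ac_simps power2_eq_square power_add)
      finally have "el P Q * (s * \<eta>) = z ^ (i + 2) * r" .
      moreover have "eva (s * \<eta>) \<noteq> 0"
        using * \<eta> by (simp add: eva_mult)
      ultimately show ?thesis
        using *(1,3) Rng_mult[OF *(2) \<eta>(1)] by blast
    next
      case 3
      then obtain P' where P: "P = [:0, 1:] * P'"
        by (metis X_dvd_iff dvdE)
      let ?r = "el 0 P' + el Q 0 * \<eta>"
      have "el P Q * \<eta> = (t * \<eta>) * ev P' t + ev Q t * z * \<eta>"
        unfolding P el_def by (simp add: algebra_simps)
      also have "\<dots> = z ^ 1 * ?r"
        unfolding t\<eta> by (simp add: el_def algebra_simps)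
      finally have "el P Q * \<eta> = z ^ 1 * ?r" .
      moreover have "?r \<in> Rng"
        by (intro Rng_add Rng_mult el_Rng \<eta>)
      moreover have "eva ?r \<noteq> 0"
        using 3(2) \<eta> by (simp add: eva_add eva_mult Rng_mult pt0)
      moreover have "eva \<eta> \<noteq> 0"
        using \<eta> by simp
      ultimately show ?thesis
        using \<eta>(1) by blast
    qed
  qed
  moreover have "z \<noteq> 0"
    using el_eq_0_iff[of 0 1] by (simp only: z_el[symmetric]) simp
  moreover have "eva z = 0"
    by (rule trans[OF eva_z b])
  ultimately show ?thesis
    using z_Rng unfolding uniformizer_def by (auto elim!: Rng_cases)
qed

end

section \<open>Counting points of \<open>D k\<close>\<close>

lemma GF2_closed:
  "0 \<in> GF2 n" "1 \<in> GF2 n"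
  "x \<in> GF2 n \<Longrightarrow> inverse x \<in> GF2 n"
  "x \<in> GF2 n \<Longrightarrow> y \<in> GF2 n \<Longrightarrow> x + y \<in> GF2 n"
  "x \<in> GF2 n \<Longrightarrow> y \<in> GF2 n \<Longrightarrow> x * y \<in> GF2 n"
  by (simp_all add: GF2_def char2_power_add power_mult_distrib power_inverse)

lemma ex_min_poly:
  fixes a :: K
  assumes "a \<in> GF2 n" "n \<ge> 1"
  obtains \<pi> where "\<pi> \<noteq> 0" "\<And>P. ev P a = 0 \<longleftrightarrow> \<pi> dvd P"
proof -
  let ?P = "monom 1 (2 ^ n) + [:0, 1:] :: bit poly"
  have "(2::nat) ^ 1 \<le> 2 ^ n"
    using assms by (intro power_increasing) auto
  then have "coeff ?P 1 = 1"
    using assms by auto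
  then have "?P \<noteq> 0"
    by (metis coeff_0 zero_neq_one)
  then have P: "?P \<noteq> 0 \<and> ev ?P a = 0"
    using assms(1) by (simp add: ev_monom GF2_def)
  define \<pi> where "\<pi> = arg_min degree (\<lambda>P. P \<noteq> 0 \<and> ev P a = 0)"
  have \<pi>: "\<pi> \<noteq> 0 \<and> ev \<pi> a = 0"
    unfolding \<pi>_def by (rule arg_min_natI[of "\<lambda>P. P \<noteq> 0 \<and> ev P a = 0", OF P])
  have min: "degree \<pi> \<le> degree P" if "P \<noteq> 0" "ev P a = 0" for P
    unfolding \<pi>_def by (rule arg_min_nat_le) (use that in simp)
  have "\<pi> dvd P" if "ev P a = 0" for P
  proof -
    have "P = \<pi> * (P div \<pi>) + P mod \<pi>"
      by simp
    then have "ev P a = ev \<pi> a * ev (P div \<pi>) a + ev (P mod \<pi>) a"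
      by (metis ev_simps(3,4))
    then have "ev (P mod \<pi>) a = 0"
      using that \<pi> by simp
    then have "P mod \<pi> = 0"
      using min[of "P mod \<pi>"] degree_mod_less[of \<pi> P] \<pi> by fastforce
    then show ?thesis
      by (simp add: dvd_eq_mod_eq_0)
  qed
  then show ?thesis
    using that[of \<pi>] \<pi> ev_dvd by blast
qed

lemma Tr_artin_schreier: "Tr n (c ^ 2 + c) = c ^ 2 ^ n + c"
proof (induction n)
  case (Suc n)
  have "(c ^ 2 + c) ^ 2 ^ n = c ^ 2 ^ Suc n + c ^ 2 ^ n"
    by (simp add: char2_power_add power_mult[symmetric])
  then show ?case
    using Suc by (simp add: Tr_def ac_simps)
qed (simp add: Tr_def)

text \<open>The two solutions c and c + 1 exist in the algebraic closure. The trace of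
  \<open>c ^ 2 + c\<close> telescopes to \<open>c ^ 2 ^ n + c\<close>, which vanishes exactly when c
  lies in \<open>GF2 n\<close>.\<close>

lemma card_artin_schreier:
  "card {c \<in> GF2 n. c ^ 2 + c = h} = (if Tr n h = 0 then 2 else 0)"
proof -
  obtain c where "poly [:h, 1, 1:] c = 0"
    using alg_closed_imp_poly_has_root[of "[:h, 1, 1:]"] by auto
  then have "h + (c ^ 2 + c) = 0"
    by (simp add: algebra_simps power2_eq_square)
  then have c: "c ^ 2 + c = h"
    by (simp add: char2_eq_iff)
  have sols: "x ^ 2 + x = h \<longleftrightarrow> x = c \<or> x = c + 1" for x
  proof -
    have "x ^ 2 + x = h \<longleftrightarrow> (x ^ 2 + x) + (c ^ 2 + c) = 0"
      unfolding c by (rule char2_eq_iff[symmetric])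
    also have "(x ^ 2 + x) + (c ^ 2 + c) = (x + c) ^ 2 + (x + c)"
      by (simp add: char2_square_add ac_simps)
    also have "\<dots> = 0 \<longleftrightarrow> (x + c) ^ 2 = x + c"
      by (rule char2_eq_iff)
    also have "\<dots> \<longleftrightarrow> x + c = 0 \<or> x + c = 1"
      by (rule square_eq_self_iff)
    also have "x + c = 0 \<longleftrightarrow> x = c"
      by (rule char2_eq_iff)
    also have "x + c = 1 \<longleftrightarrow> x = c + 1"
      using char2_eq_iff[of "x + c" 1] char2_eq_iff[of x "c + 1"] by (simp add: add.assoc)
    finally show ?thesis .
  qed
  have mem: "x \<in> GF2 n \<longleftrightarrow> Tr n h = 0" if "x ^ 2 + x = h" for x
    using Tr_artin_schreier[of n x] that by (simp add: GF2_def char2_eq_iff)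
  have "{c \<in> GF2 n. c ^ 2 + c = h} = (if Tr n h = 0 then {c, c + 1} else {})"
    using sols mem by auto
  then show ?thesis
    by simp
qed

lemma ev_x_fun: "ev P x_fun = to_ac (Fract P 1)"
proof (induction P)
  case 0
  then show ?case
    by (simp add: Zero_fract_def[symmetric])
next
  case (pCons c P)
  have "emb c = to_ac (Fract [:c:] 1)"
  proof (cases "c = 0")
    case False
    have "to_ac (Fract [:1:] 1) = (1 :: bit poly fract alg_closure)"
      by (simp add: one_pCons[symmetric] One_fract_def[symmetric])
    then show ?thesis
      using False by simp
  qed (simp add: Zero_fract_def[symmetric])
  moreover have "Fract (pCons c P) 1 = Fract [:c:] 1 + Fract [:0, 1:] 1 * Fract P 1"
    by simp
  ultimately show ?case
    using pCons by (simp add: x_fun_def del: add_fract mult_fract)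
qed

lemma x_fun_transcendental: "ev P x_fun = 0 \<Longrightarrow> P = 0"
  by (simp add: ev_x_fun eq_fract Zero_fract_def)

lemma x_fun_nz: "x_fun \<noteq> 0"
  using x_fun_transcendental[of "[:0, 1:]"] by auto

lemma inverse_x_fun_transcendental:
  assumes "ev P (inverse x_fun) = 0"
  shows "P = 0"
proof -
  have "ev (reflect_poly P) x_fun = x_fun ^ degree P * ev P (inverse x_fun)"
    unfolding ev_def embp_reflect by (simp add: poly_reflect_poly_nz x_fun_nz)
  then show ?thesis
    using assms x_fun_transcendental[of "reflect_poly P"] by simp
qed

text \<open>Valuation rings are integrally closed: if z were outside A, its inverse would be in A,
  and z = d / z - c would put z back into A.\<close>

lemma integral_in_valuation_ring:
  assumes p: "(A, \<phi>) \<in> rational_points F B" and z: "z \<in> F" and c: "c \<in> A" "d \<in> A" "z * z + c * z = d"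
  shows "z \<in> A"
proof (rule ccontr)
  assume "z \<notin> A"
  moreover have "0 \<in> A"
    using p by (rule rational_point_zero)
  ultimately have "z \<noteq> 0"
    by auto
  have "inverse z \<in> A"
    using p z \<open>z \<notin> A\<close> unfolding rational_points_iff by blast
  moreover have "z = d * inverse z + - c"
  proof -
    have "z * z * inverse z + c * z * inverse z = d * inverse z"
      by (simp only: c(3)[symmetric] distrib_right)
    then show ?thesis
      using \<open>z \<noteq> 0\<close> by (simp add: mult.assoc eq_diff_eq)
  qed
  ultimately have "z \<in> A"
    using p c(1,2) unfolding rational_points_iff by metis
  then show False
    using \<open>z \<notin> A\<close> by blast
qed

lemma generate_field_closed:
  fixes H :: "'a :: field set"
  shows "x \<in> H \<Longrightarrow> x \<in> generate_field RT H"
    "x \<in> generate_field RT H \<Longrightarrow> y \<in> generate_field RT H \<Longrightarrow> x * y \<in> generate_field RT H"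
    "x \<in> generate_field RT H \<Longrightarrow> x \<noteq> 0 \<Longrightarrow> inverse x \<in> generate_field RT H"
    "x \<in> generate_field RT H \<Longrightarrow> x ^ m \<in> generate_field RT H"
proof -
  show "x \<in> H \<Longrightarrow> x \<in> generate_field RT H"
    by (rule generate_field.incl)
  show mult: "x * y \<in> generate_field RT H" if "x \<in> generate_field RT H" "y \<in> generate_field RT H" for x y
    using generate_field.eng_mult[OF that] by simp
  show "x \<in> generate_field RT H \<Longrightarrow> x \<noteq> 0 \<Longrightarrow> inverse x \<in> generate_field RT H"
    using generate_field.m_inv[of x RT H] by simp
  show "x \<in> generate_field RT H \<Longrightarrow> x ^ m \<in> generate_field RT H"
    using generate_field.one[of RT H] by (induction m) (auto simp: mult)
qed

section \<open>The two charts of \<open>D k\<close>\<close>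

context
  fixes k :: nat
begin

text \<open>Multiplying y by x clears the pole of 1 / x and leaves a right-hand side with a simple
  zero at x = 0.\<close>

definition z_fin :: "bit poly fract alg_closure" where
  "z_fin = x_fun * y_fun k"

definition beta_poly :: "bit poly" where
  "beta_poly = [:0, 1:] + monom 1 (2 ^ k + 3)"

text \<open>With t = 1 / x the right-hand side has a pole of odd order \<open>2 ^ k + 1\<close>. The
  square of the factor of y is \<open>t ^ (2 ^ k + 2)\<close>, one more than that order, so again a
  simple zero remains; the result is the same \<open>beta_poly\<close> in t.\<close>

definition z_inf :: "bit poly fract alg_closure" where
  "z_inf = inverse x_fun ^ (2 ^ (k - 1) + 1) * y_fun k"

definition alpha_inf :: "bit poly" where
  "alpha_inf = monom 1 (2 ^ (k - 1) + 1)"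

lemma z_fin_eq: "z_fin ^ 2 + x_fun * z_fin = x_fun + x_fun ^ (2 ^ k + 3)"
proof -
  have "z_fin ^ 2 + x_fun * z_fin = x_fun ^ 2 * (y_fun k ^ 2 + y_fun k)"
    by (simp add: z_fin_def power2_eq_square algebra_simps)
  also have "\<dots> = x_fun ^ 2 * x_fun ^ (2 ^ k + 1) + x_fun * (x_fun * inverse x_fun)"
    unfolding y_fun by (simp only: distrib_left power2_eq_square mult.assoc)
  also have "x_fun ^ 2 * x_fun ^ (2 ^ k + 1) = x_fun ^ (2 ^ k + 3)"
    unfolding power_add[symmetric] by (rule arg_cong) simp
  finally show ?thesis
    using x_fun_nz by (simp add: add.commute)
qed

lemma z_inf_eq:
  assumes "k \<ge> 1"
  shows "z_inf ^ 2 + inverse x_fun ^ (2 ^ (k - 1) + 1) * z_inf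
    = inverse x_fun + inverse x_fun ^ (2 ^ k + 3)"
proof -
  let ?t = "inverse x_fun"
  let ?m = "2 ^ (k - 1) + 1 :: nat"
  have m: "?m + ?m = (2 ^ k + 1) + 1"
    using assms by (cases k) auto
  have "z_inf ^ 2 + ?t ^ ?m * z_inf = ?t ^ ?m * ?t ^ ?m * (y_fun k ^ 2 + y_fun k)"
    unfolding z_inf_def power2_eq_square by (simp add: algebra_simps)
  also have "?t ^ ?m * ?t ^ ?m = ?t ^ (2 ^ k + 1) * ?t"
    unfolding power_add[symmetric] m by simp
  also have "\<dots> * (y_fun k ^ 2 + y_fun k)
      = (?t ^ (2 ^ k + 1) * x_fun ^ (2 ^ k + 1)) * ?t + ?t ^ (2 ^ k + 1) * ?t * ?t"
    unfolding y_fun by (simp only: distrib_left ac_simps)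
  also have "?t ^ (2 ^ k + 1) * x_fun ^ (2 ^ k + 1) = 1"
    using x_fun_nz by (simp only: power_mult_distrib[symmetric]) simp
  also have "?t ^ (2 ^ k + 1) * ?t * ?t = ?t ^ (2 ^ k + 3)"
    by (simp add: power_add eval_nat_numeral ac_simps)
  finally show ?thesis
    by simp
qed

lemma finite_model:
  fixes a b :: K
  assumes "b ^ 2 + a * b = a + a ^ (2 ^ k + 3)"
  shows "affine_model x_fun z_fin [:0, 1:] beta_poly a b"
  by unfold_locales (use assms z_fin_eq x_fun_transcendental in \<open>auto simp: beta_poly_def ev_monom\<close>)

lemma infinite_model:
  assumes "k \<ge> 1"
  shows "affine_model (inverse x_fun) z_inf alpha_inf beta_poly (0 :: K) 0"
  by unfold_locales
    (use z_inf_eq[OF assms] inverse_x_fun_transcendental in \<open>auto simp: alpha_inf_def beta_poly_def ev_monom\<close>)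

lemma D_mem: "x_fun \<in> D k" "y_fun k \<in> D k" "inverse x_fun \<in> D k" "z_fin \<in> D k" "z_inf \<in> D k"
proof -
  show x: "x_fun \<in> D k" and y: "y_fun k \<in> D k"
    unfolding D_def by (rule generate_field_closed(1); simp)+
  show ix: "inverse x_fun \<in> D k"
    using x x_fun_nz unfolding D_def by (rule generate_field_closed(3))
  show "z_fin \<in> D k"
    using x y unfolding D_def z_fin_def by (rule generate_field_closed(2))
  show "z_inf \<in> D k"
    using ix y unfolding D_def z_inf_def by (intro generate_field_closed(2,4))
qed

lemma D_finite_model: "D k = affine_model.Fld x_fun z_fin"
proof -
  \<comment> \<open>The field \<open>Fld\<close> does not involve the point; the origin lies on
    every such chart.\<close>
  interpret affine_model x_fun z_fin "[:0, 1:]" beta_poly "0 :: K" "0 :: K"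
    by (rule finite_model) simp
  have "x_fun \<in> Fld"
    using t_Rng by (rule Rng_Fld)
  moreover have "y_fun k = z_fin / ev [:0, 1:] x_fun"
    using x_fun_nz by (simp add: z_fin_def)
  then have "y_fun k \<in> Fld"
    by (rule FldI[OF z_Rng, rotated]) simp
  ultimately show ?thesis
    using D_mem(1,4) unfolding D_def by (intro Fld_eq_generate_field) simp_all
qed

lemma D_infinite_model:
  assumes "k \<ge> 1"
  shows "D k = affine_model.Fld (inverse x_fun) z_inf"
proof -
  interpret affine_model "inverse x_fun" z_inf alpha_inf beta_poly "0 :: K" "0 :: K"
    by (rule infinite_model[OF assms])
  have "x_fun = 1 / ev [:0, 1:] (inverse x_fun)"
    by (simp add: divide_inverse)
  then have "x_fun \<in> Fld"
    by (rule FldI[OF Rng_1, rotated]) simp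
  moreover have "y_fun k = z_inf / ev (monom 1 (2 ^ (k - 1) + 1)) (inverse x_fun)"
    unfolding ev_monom z_inf_def using x_fun_nz by simp
  then have "y_fun k \<in> Fld"
    by (rule FldI[OF z_Rng, rotated]) simp
  ultimately show ?thesis
    using D_mem(3,5) unfolding D_def by (intro Fld_eq_generate_field) simp_all
qed

text \<open>In this chart \<alpha> is X, so the point is unramified unless a = 0, and then b = 0 is
  the origin.\<close>

lemma unique_finite_point:
  assumes n: "n \<ge> 1" and ab: "a \<in> GF2 n" "b \<in> GF2 n" "b ^ 2 + a * b = a + a ^ (2 ^ k + 3)"
  shows "\<exists>!(A, \<phi>). (A, \<phi>) \<in> rational_points (D k) (GF2 n) \<and> x_fun \<in> A \<and> z_fin \<in> A \<and> \<phi> x_fun = a \<and> \<phi> z_fin = b"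
proof -
  interpret affine_model x_fun z_fin "[:0, 1:]" beta_poly a b
    by (rule finite_model) (rule ab)
  have "\<exists>p. uniformizer p"
  proof (cases "a = 0")
    case True
    then have "b = 0"
      using ab(3) by (simp add: power_0_left)
    then show ?thesis
      using uniformizer_ramified True by blast
  next
    case False
    obtain \<pi> where "\<pi> \<noteq> 0" "\<And>P. ev P a = 0 \<longleftrightarrow> \<pi> dvd P"
      using ex_min_poly[OF ab(1) n] by blast
    then have "uniformizer (ev \<pi> x_fun)"
      using False by (intro uniformizer_unramified) auto
    then show ?thesis
      by blast
  qed
  then obtain p where "uniformizer p"
    by blast
  then show ?thesis
    unfolding D_finite_model by (rule unique_point[OF _ ab(1,2) GF2_closed])
qed

lemma unique_infinite_point:
  assumes k: "k \<ge> 1"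
  shows "\<exists>!(A, \<phi>). (A, \<phi>) \<in> rational_points (D k) (GF2 n) \<and>
    inverse x_fun \<in> A \<and> z_inf \<in> A \<and> \<phi> (inverse x_fun) = 0 \<and> \<phi> z_inf = 0"
proof -
  interpret affine_model "inverse x_fun" z_inf alpha_inf beta_poly "0 :: K" "0 :: K"
    by (rule infinite_model[OF k])
  have "uniformizer z_inf"
    by (rule uniformizer_ramified) auto
  then show ?thesis
    unfolding D_infinite_model[OF k]
    by (rule unique_point[OF _ GF2_closed(1,1) GF2_closed])
qed

definition affine_points :: "nat \<Rightarrow> (K \<times> K) set" where
  "affine_points n = (SIGMA a:GF2 n. {b \<in> GF2 n. b ^ 2 + a * b = a + a ^ (2 ^ k + 3)})"

text \<open>Over a = 0 there is one point. Over any other a, the substitution b = a c turns the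
  fibre into an Artin-Schreier equation with 2 or 0 solutions, that is 1 plus the summand of
  \<open>G\<close>.\<close>

lemma card_affine_points:
  assumes n: "n \<ge> 1"
  shows "int (card (affine_points n)) = 2 ^ n + G k n"
proof -
  let ?S = "\<lambda>a. {b \<in> GF2 n. b ^ 2 + a * b = a + a ^ (2 ^ k + 3)}"
  let ?T = "\<lambda>a. Tr n (a ^ (2 ^ k + 1) + inverse a)"
  have fin: "finite (GF2 n)"
    using n by (rule finite_GF2)
  have 0: "?S 0 = {0}"
    using GF2_closed(1) by (auto simp: power_0_left)
  have nz: "card (?S a) = (if ?T a = 0 then 2 else 0)" if a: "a \<in> GF2 n - {0}" for a
  proof -
    let ?h = "a ^ (2 ^ k + 1) + inverse a"
    have a0: "a \<noteq> 0"
      using a by simp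
    have "a ^ 2 * ?h = a ^ 2 * a ^ (2 ^ k + 1) + a * (a * inverse a)"
      by (simp only: distrib_left power2_eq_square mult.assoc)
    also have "a ^ 2 * a ^ (2 ^ k + 1) = a ^ (2 ^ k + 3)"
      unfolding power_add[symmetric] by (rule arg_cong) simp
    finally have h: "a + a ^ (2 ^ k + 3) = a ^ 2 * ?h"
      using a0 by (simp add: add.commute)
    have eq: "(a * c) ^ 2 + a * (a * c) = a + a ^ (2 ^ k + 3) \<longleftrightarrow> c ^ 2 + c = ?h" for c
    proof -
      have ac: "(a * c) ^ 2 + a * (a * c) = a ^ 2 * (c ^ 2 + c)"
        by (simp add: algebra_simps power2_eq_square)
      show ?thesis
        unfolding h ac using a0 by simp
    qed
    have "bij_betw (\<lambda>c. a * c) {c \<in> GF2 n. c ^ 2 + c = ?h} (?S a)"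
    proof (rule bij_betwI[where g = "\<lambda>b. inverse a * b"])
      show "(\<lambda>c. a * c) \<in> {c \<in> GF2 n. c ^ 2 + c = ?h} \<rightarrow> ?S a"
        by (intro funcsetI CollectI conjI) (use a in \<open>simp add: GF2_closed(5)\<close>, simp only: eq mem_Collect_eq)
      show "(\<lambda>b. inverse a * b) \<in> ?S a \<rightarrow> {c \<in> GF2 n. c ^ 2 + c = ?h}"
      proof
        fix b assume b: "b \<in> ?S a"
        have "a * (inverse a * b) = b"
          using a0 by simp
        then have "(inverse a * b) ^ 2 + inverse a * b = ?h"
          using b eq[of "inverse a * b"] by (simp only: mem_Collect_eq) blast
        then show "inverse a * b \<in> {c \<in> GF2 n. c ^ 2 + c = ?h}"
          using b GF2_closed(3,5) a by (simp only: mem_Collect_eq) blast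
      qed
    qed (use a0 in simp_all)
    then have "card (?S a) = card {c \<in> GF2 n. c ^ 2 + c = ?h}"
      by (rule bij_betw_same_card[symmetric])
    then show ?thesis
      unfolding card_artin_schreier .
  qed
  have "card (affine_points n) = (\<Sum>a\<in>GF2 n. card (?S a))"
    unfolding affine_points_def using fin by (intro card_SigmaI) auto
  also have "\<dots> = card (?S 0) + (\<Sum>a\<in>GF2 n - {0}. card (?S a))"
    by (rule sum.remove[OF fin GF2_closed(1)])
  also have "\<dots> = 1 + (\<Sum>a\<in>GF2 n - {0}. if ?T a = 0 then 2 else 0)"
    unfolding 0 using nz by simp
  finally have "int (card (affine_points n)) = 1 + (\<Sum>a\<in>GF2 n - {0}. if ?T a = 0 then 2 else 0)"
    by (simp add: of_nat_sum if_distrib cong: if_cong)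
  also have "(\<Sum>a\<in>GF2 n - {0}. if ?T a = 0 then 2 else 0 :: int)
      = (\<Sum>a\<in>GF2 n - {0}. 1 + (if ?T a = 0 then 1 else -1))"
    by (rule sum.cong) auto
  also have "\<dots> = int (card (GF2 n - {0})) + G k n"
    by (simp add: sum.distrib G_def)
  also have "card (GF2 n - {0}) = 2 ^ n - 1"
    using fin GF2_closed(1) card_GF2[OF n] by simp
  finally show ?thesis
    by (simp add: of_nat_diff)
qed

text \<open>The places where x is regular correspond to the affine points of the finite chart; the
  remaining summand 1 is the single place at infinity.\<close>

lemma num_points_eq_G:
  assumes k: "k \<ge> 1" and n: "n \<ge> 1"
  shows "int (num_points k n) = 2 ^ n + 1 + G k n"
proof -
  let ?RP = "rational_points (D k) (GF2 n)"
  let ?fin = "{p \<in> ?RP. x_fun \<in> fst p}" and ?inf = "{p \<in> ?RP. x_fun \<notin> fst p}"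
  have hom: "x + y \<in> A" "x * y \<in> A" "\<phi> (x + y) = \<phi> x + \<phi> y" "\<phi> (x * y) = \<phi> x * \<phi> y"
    if "(A, \<phi>) \<in> ?RP" "x \<in> A" "y \<in> A" for A \<phi> x y
    using that unfolding rational_points_iff by blast+
  have one: "1 \<in> A" "\<phi> 1 = 1" if "(A, \<phi>) \<in> ?RP" for A \<phi>
    using that unfolding rational_points_iff by blast+
  have pow: "x ^ m \<in> A \<and> \<phi> (x ^ m) = \<phi> x ^ m" if "(A, \<phi>) \<in> ?RP" "x \<in> A" for A \<phi> x m
    by (induction m) (use one[OF that(1)] hom(2,4)[OF that] in auto)
  \<comment> \<open>Integrality makes the second coordinate regular wherever x is.\<close>
  have fin_z: "z_fin \<in> A" if p: "(A, \<phi>) \<in> ?RP" and x: "x_fun \<in> A" for A \<phi>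
  proof (rule integral_in_valuation_ring[OF p D_mem(4) x])
    show "x_fun + x_fun ^ (2 ^ k + 3) \<in> A"
      using hom(1)[OF p x] pow[OF p x] by blast
    show "z_fin * z_fin + x_fun * z_fin = x_fun + x_fun ^ (2 ^ k + 3)"
      using z_fin_eq by (simp add: power2_eq_square)
  qed
  have fin_pt: "(\<phi> x_fun, \<phi> z_fin) \<in> affine_points n" if p: "(A, \<phi>) \<in> ?RP" and x: "x_fun \<in> A" for A \<phi>
  proof -
    note z = fin_z[OF p x]
    have "\<phi> (z_fin ^ 2 + x_fun * z_fin) = \<phi> (x_fun + x_fun ^ (2 ^ k + 3))"
      by (simp only: z_fin_eq)
    then have "\<phi> z_fin ^ 2 + \<phi> x_fun * \<phi> z_fin = \<phi> x_fun + \<phi> x_fun ^ (2 ^ k + 3)"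
      using pow[OF p x] pow[OF p z] hom(2)[OF p x z] hom(3)[OF p] hom(4)[OF p x z] x by simp
    moreover have "\<phi> x_fun \<in> GF2 n" "\<phi> z_fin \<in> GF2 n"
      using p x z unfolding rational_points_iff by blast+
    ultimately show ?thesis
      unfolding affine_points_def by blast
  qed
  have uniq: "\<exists>!(A, \<phi>). (A, \<phi>) \<in> ?RP \<and> x_fun \<in> A \<and> z_fin \<in> A \<and> \<phi> x_fun = fst c \<and> \<phi> z_fin = snd c"
    if "c \<in> affine_points n" for c
  proof (rule unique_finite_point[OF n])
    show "fst c \<in> GF2 n" "snd c \<in> GF2 n"
        "snd c ^ 2 + fst c * snd c = fst c + fst c ^ (2 ^ k + 3)"
      using that unfolding affine_points_def by (simp_all add: Sigma_def split: prod.splits) auto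
  qed
  have bij: "bij_betw (\<lambda>p. (snd p x_fun, snd p z_fin)) ?fin (affine_points n)"
  proof (rule bij_betwI')
    fix p q assume p: "p \<in> ?fin" and q: "q \<in> ?fin"
    show "((snd p x_fun, snd p z_fin) = (snd q x_fun, snd q z_fin)) = (p = q)"
    proof
      assume eq: "(snd p x_fun, snd p z_fin) = (snd q x_fun, snd q z_fin)"
      define c where "c = (snd p x_fun, snd p z_fin)"
      define Q where "Q = (\<lambda>(A, \<phi>). (A, \<phi>) \<in> ?RP \<and> x_fun \<in> A \<and> z_fin \<in> A \<and>
          \<phi> x_fun = fst c \<and> \<phi> z_fin = snd c)"
      have "c \<in> affine_points n"
        using p fin_pt[of "fst p" "snd p"] by (simp add: c_def)
      then have ex1: "\<exists>!r. Q r"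
        unfolding Q_def by (rule uniq)
      have "Q p"
        using p fin_z[of "fst p" "snd p"] by (simp add: Q_def c_def case_prod_beta)
      moreover have "Q q"
        using q eq fin_z[of "fst q" "snd q"] by (simp add: Q_def c_def case_prod_beta)
      ultimately show "p = q"
        using ex1 by blast
    qed simp
  next
    fix p assume "p \<in> ?fin"
    then show "(snd p x_fun, snd p z_fin) \<in> affine_points n"
      using fin_pt[of "fst p" "snd p"] by simp
  next
    fix c assume "c \<in> affine_points n"
    then obtain A \<phi> where "(A, \<phi>) \<in> ?RP" "x_fun \<in> A" "\<phi> x_fun = fst c" "\<phi> z_fin = snd c"
      using ex1_implies_ex[OF uniq[of c]] by (auto simp: case_prod_beta)
    then show "\<exists>p\<in>?fin. c = (snd p x_fun, snd p z_fin)"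
      by (intro bexI[of _ "(A, \<phi>)"]) simp_all
  qed
  have inf_iff: "(A, \<phi>) \<in> ?RP \<and> x_fun \<notin> A \<longleftrightarrow>
      (A, \<phi>) \<in> ?RP \<and> inverse x_fun \<in> A \<and> z_inf \<in> A \<and> \<phi> (inverse x_fun) = 0 \<and> \<phi> z_inf = 0" for A \<phi>
  proof
    assume "(A, \<phi>) \<in> ?RP \<and> x_fun \<notin> A"
    then have p: "(A, \<phi>) \<in> ?RP" and x: "x_fun \<notin> A"
      by blast+
    let ?t = "inverse x_fun"
    have t: "?t \<in> A"
      using p x D_mem(1) unfolding rational_points_iff by blast
    have "\<phi> ?t = 0 \<longleftrightarrow> ?t = 0 \<or> inverse ?t \<notin> A"
      using p t unfolding rational_points_iff by blast
    then have t0: "\<phi> ?t = 0"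
      using x by simp
    note tm = pow[OF p t]
    have z: "z_inf \<in> A"
    proof (rule integral_in_valuation_ring[OF p D_mem(5)])
      show "?t ^ (2 ^ (k - 1) + 1) \<in> A"
        using tm by blast
      show "?t + ?t ^ (2 ^ k + 3) \<in> A"
        using hom(1)[OF p t] tm by blast
      show "z_inf * z_inf + ?t ^ (2 ^ (k - 1) + 1) * z_inf = ?t + ?t ^ (2 ^ k + 3)"
        using z_inf_eq[OF k] by (simp only: power2_eq_square)
    qed
    have "\<phi> (z_inf ^ 2 + ?t ^ (2 ^ (k - 1) + 1) * z_inf) = \<phi> (?t + ?t ^ (2 ^ k + 3))"
      by (simp only: z_inf_eq[OF k])
    then have "\<phi> z_inf ^ 2 + \<phi> ?t ^ (2 ^ (k - 1) + 1) * \<phi> z_inf = \<phi> ?t + \<phi> ?t ^ (2 ^ k + 3)"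
      using tm pow[OF p z] hom[OF p] t z by (simp only: simp_thms)
    \<comment> \<open>At t = 0 the equation of the chart at infinity reduces to z^2 = 0.\<close>
    then have "\<phi> z_inf = 0"
      unfolding t0 by (simp add: power_0_left)
    then show "(A, \<phi>) \<in> ?RP \<and> ?t \<in> A \<and> z_inf \<in> A \<and> \<phi> ?t = 0 \<and> \<phi> z_inf = 0"
      using p t z t0 by blast
  next
    assume *: "(A, \<phi>) \<in> ?RP \<and> inverse x_fun \<in> A \<and> z_inf \<in> A \<and> \<phi> (inverse x_fun) = 0 \<and> \<phi> z_inf = 0"
    have "x_fun \<notin> A"
    proof
      assume x: "x_fun \<in> A"
      have "\<phi> (x_fun * inverse x_fun) = 0"
        using hom(4)[of A \<phi> x_fun "inverse x_fun"] * x by simp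
      then show False
        using one(2)[of A \<phi>] * x_fun_nz by simp
    qed
    then show "(A, \<phi>) \<in> ?RP \<and> x_fun \<notin> A"
      using * by blast
  qed
  have "\<exists>!(A, \<phi>). (A, \<phi>) \<in> ?RP \<and> x_fun \<notin> A"
    unfolding inf_iff by (rule unique_infinite_point[OF k])
  then have "\<exists>!p. p \<in> ?inf"
    by (simp add: case_prod_unfold)
  then obtain p where "?inf = {p}"
    by blast
  have "finite (affine_points n)"
    unfolding affine_points_def using finite_GF2[OF n] by (intro finite_SigmaI) auto
  then have "finite ?fin"
    using bij_betw_finite[OF bij] by blast
  have "num_points k n = card (?fin \<union> ?inf)"
    unfolding num_points_def by (rule arg_cong[of _ _ card]) blast
  also have "\<dots> = card ?fin + card ?inf"
    using \<open>finite ?fin\<close> \<open>?inf = {p}\<close> by (intro card_Un_disjoint) auto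
  also have "card ?fin = card (affine_points n)"
    using bij by (rule bij_betw_same_card)
  also have "card ?inf = 1"
    unfolding \<open>?inf = {p}\<close> by simp
  finally show ?thesis
    using card_affine_points[OF n] by simp
qed

end

section \<open>The divisibility\<close>

lemma L_poly_eq_L_sum:
  assumes "k \<ge> 1"
  shows "L_poly k = L_sum (2 ^ k + 1)"
proof (rule L_poly_eqI)
  have odd: "odd (2 ^ k + 1 :: nat)"
    using assms by simp
  show "coeff (L_sum (2 ^ k + 1)) 0 = 1"
    unfolding coeff_L_sum[OF odd] by (rule chi_sum_0)
  show "fps_X * fps_deriv (fps_of_poly (L_sum (2 ^ k + 1)))
      = fps_of_poly (L_sum (2 ^ k + 1)) * Abs_fps (\<lambda>m. if m = 0 then 0 else char_sum (2 ^ k + 1) m)"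
    by (rule L_sum_logd[OF odd])
  show "int (num_points k n) = 2 ^ n + 1 + (if n = 0 then 0 else char_sum (2 ^ k + 1) n)" if "n \<ge> 1" for n
    using num_points_eq_G[OF assms that] that by (simp add: G_eq_char_sum)
qed simp

theorem theorem23:
  assumes "\<And>k m. k \<ge> 1 \<Longrightarrow> m \<ge> 1 \<Longrightarrow> gcd k m = 1 \<Longrightarrow> G k m = G 1 m"
  shows "\<forall>k\<ge>1. L_poly 1 dvd L_poly k"
proof (intro allI impI)
  fix k :: nat assume k: "k \<ge> 1"
  have "L_sum 3 dvd L_sum (2 ^ k + 1)"
  proof (rule L_sum_3_dvd[OF _ k])
    fix j
    \<comment> \<open>The progression 1 + j k is chosen so that the hypothesis applies to all its
      members while consecutive ones differ by k.\<close>
    have "gcd k (1 + j * k) = 1"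
      by (metis gcd_1_nat gcd_add_mult add.commute)
    then have "G k (1 + j * k) = G 1 (1 + j * k)"
      using assms[OF k] by simp
    then show "char_sum 3 (1 + j * k) = char_sum (2 ^ k + 1) (1 + j * k)"
      by (simp add: G_eq_char_sum)
  qed (use k in simp)
  then show "L_poly 1 dvd L_poly k"
    using L_poly_eq_L_sum[of 1] L_poly_eq_L_sum[OF k] by simp
qed

end
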